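(* Let $\mathcal G=\mathfrak g_1\oplus\mathfrak g_2$ be such that $(\mathcal G,\mathfrak g_1,\mathfrak g_2)$ is a twilled 3-Lie algebra, with bracket $\Omega=\hat\mu_1+\hat\psi+\hat\mu_2$ decomposed into its homogeneous components of bidegrees $2|0$, $1|1$, $0|2$. For $m\ge 0$ let $C^m(\mathfrak g_2,\mathfrak g_1)$ be the space of $m$-cochains on $\mathfrak g_2$ with values in $\mathfrak g_1$, regarded as placed in degree $m$. For $g_1\in C^m(\mathfrak g_2,\mathfrak g_1)$, $g_2\in C^n(\mathfrak g_2,\mathfrak g_1)$, $g_3\in C^r(\mathfrak g_2,\mathfrak g_1)$ define $$l_1(g_1)=[\hat\mu_2,\hat g_1]\in C^{m+1}(\mathfrak g_2,\mathfrak g_1),\qquad l_2(g_1,g_2)=[[\hat\psi,\hat g_1],\hat g_2]\in C^{m+n+1}(\mathfrak g_2,\mathfrak g_1),$$ $$l_3(g_1,g_2,g_3)=[[[\hat\mu_1,\hat g_1],\hat g_2],\hat g_3]\in C^{m+n+r+1}(\mathfrak g_2,\mathfrak g_1),$$ where $[\cdot,\cdot]$ is the graded commutator bracket on $C^*(\mathcal G,\mathcal G)$, $\hat g$ denotes the lift of $g$, and elements of $C^*(\mathfrak g_2,\mathfrak g_1)$ are identified with their lifts. Then $\left(\bigoplus_{m\ge0}C^m(\mathfrak g_2,\mathfrak g_1),l_1,l_2,l_3\right)$ is an $L_\infty$-algebra (with $l_k=0$ for $k\ge4$).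
   Context: All vector spaces are finite-dimensional over an algebraically closed field of characteristic $0$. **3-Lie algebra.** A vector space $\mathfrak g$ with a skew-symmetric trilinear bracket satisfying $[x_1,x_2,[x_3,x_4,x_5]]=[[x_1,x_2,x_3],x_4,x_5]+[x_3,[x_1,x_2,x_4],x_5]+[x_3,x_4,[x_1,x_2,x_5]]$. **Cochains.** For vector spaces $V,W$ and $n\ge0$ let $C^n(V,W)=\mathrm{Hom}(\underbrace{\wedge^2V\otimes\cdots\otimes\wedge^2V}_{n}\wedge V,W)$; that is, $C^0(V,W)=\mathrm{Hom}(V,W)$ and, for $n\ge1$, the maps $f(\mathfrak X_1,\dots,\mathfrak X_n,x)$, multilinear in $\mathfrak X_i\in\wedge^2V$ and $x\in V$, which for $\mathfrak X_n=x_n\wedge y_n$ are skew-symmetric in $x_n,y_n,x$. Put $C^*(V,V)=\bigoplus_n C^n(V,V)$, with $C^n$ in degree $n$. **Graded bracket.** For $P\in C^p(V,V)$, $Q\in C^q(V,V)$, $\mathfrak X_i=x_i\wedge y_i$, define $P\circ Q\in C^{p+q}(V,V)$ by $$\begin{aligned}(P\circ Q)&(\mathfrak X_1,\dots,\mathfrak X_{p+q},x)\\=&\sum_{k=1}^p(-1)^{(k-1)q}\sum_{\sigma\in S(k-1,q)}(-1)^\sigma P(\mathfrak X_{\sigma(1)},\dots,\mathfrak X_{\sigma(k-1)},Q(\mathfrak X_{\sigma(k)},\dots,\mathfrak X_{\sigma(k+q-1)},x_{k+q})\wedge y_{k+q},\mathfrak X_{k+q+1},\dots,\mathfrak X_{p+q},x)\\&+\sum_{k=1}^p(-1)^{(k-1)q}\sum_{\sigma\in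 S(k-1,q)}(-1)^\sigma P(\mathfrak X_{\sigma(1)},\dots,\mathfrak X_{\sigma(k-1)},x_{k+q}\wedge Q(\mathfrak X_{\sigma(k)},\dots,\mathfrak X_{\sigma(k+q-1)},y_{k+q}),\mathfrak X_{k+q+1},\dots,\mathfrak X_{p+q},x)\\&+\sum_{\sigma\in S(p,q)}(-1)^{pq}(-1)^\sigma P(\mathfrak X_{\sigma(1)},\dots,\mathfrak X_{\sigma(p)},Q(\mathfrak X_{\sigma(p+1)},\dots,\mathfrak X_{\sigma(p+q)},x)),\end{aligned}$$ where $S(i,j)$ is the set of $(i,j)$-shuffles of $\{1,\dots,i+j\}$. Set $[P,Q]=P\circ Q-(-1)^{pq}Q\circ P$. It is known that this makes $C^*(V,V)$ a graded Lie algebra, and that $\pi\in C^1(V,V)=\mathrm{Hom}(\wedge^3V,V)$ is a 3-Lie bracket iff $[\pi,\pi]=0$. **Twilled 3-Lie algebra.** A 3-Lie algebra $(\mathcal G,\Omega=[\cdot,\cdot,\cdot]_{\mathcal G})$ with a vector space decomposition $\mathcal G=\mathfrak g_1\oplus\mathfrak g_2$ such that $\mathfrak g_1$ and $\mathfrak g_2$ are both subalgebras. Write $[\alpha,\beta,\gamma]_i$ for the $\mathfrak g_i$-component of $[\alpha,\beta,\gamma]_{\mathcal G}$. For $x,y,z\in\mathfrak g_1$, $u,v,w\in\mathfrak g_2$, the bracket decomposes as $\Omega=\hat\mu_1+\hat\psi+\hat\mu_2$ with $\hat\mu_1((x,u),(y,v),(z,w))=([x,y,z]_1,[x,y,w]_2+[u,y,z]_2+[x,v,z]_2)$,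 $\hat\psi((x,u),(y,v),(z,w))=([x,y,w]_1+[u,y,z]_1+[x,v,z]_1,[x,v,w]_2+[u,y,w]_2+[u,v,z]_2)$, $\hat\mu_2((x,u),(y,v),(z,w))=([x,v,w]_1+[u,y,w]_1+[u,v,z]_1,[u,v,w]_2)$. **Lift.** The lift $\hat g\in C^m(\mathcal G,\mathcal G)$ of $g\in C^m(\mathfrak g_2,\mathfrak g_1)$ is obtained by projecting all arguments to $\mathfrak g_2$, applying $g$, and including $\mathfrak g_1\subset\mathcal G$. **$L_\infty$-algebra.** A $\mathbb Z$-graded vector space $\mathfrak g=\bigoplus_k\mathfrak g^k$ with linear maps $l_k:\otimes^k\mathfrak g\to\mathfrak g$ $(k\ge1)$ of degree $1$ such that for homogeneous $x_1,\dots,x_n$: (i) $l_n(x_{\sigma(1)},\dots,x_{\sigma(n)})=\varepsilon(\sigma)l_n(x_1,\dots,x_n)$ for all permutations $\sigma$, where $\varepsilon(\sigma)$ is the Koszul sign; (ii) for all $n\ge1$, $\sum_{i=1}^n\sum_{\sigma\in S(i,n-i)}\varepsilon(\sigma)\,l_{n-i+1}(l_i(x_{\sigma(1)},\dots,x_{\sigma(i)}),x_{\sigma(i+1)},\dots,x_{\sigma(n)})=0$. *)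

theory Defs
  imports
    "HOL-Library.Function_Algebras"
    "HOL-Computational_Algebra.Polynomial"
    "HOL-Combinatorics.Permutations"
begin

section \<open>3-Lie algebras and twilled 3-Lie algebras\<close>

locale three_Lie_algebra =
  finite_dimensional_vector_space scale Basis
  for scale :: "'k::{alg_closed_field, field_char_0} \<Rightarrow> 'v::ab_group_add \<Rightarrow> 'v"
    and Basis :: "'v set" +
  fixes br :: "'v \<Rightarrow> 'v \<Rightarrow> 'v \<Rightarrow> 'v"
  assumes br_linear1: "Vector_Spaces.linear scale scale (\<lambda>x. br x y z)"
    and br_linear2: "Vector_Spaces.linear scale scale (\<lambda>y. br x y z)"
    and br_linear3: "Vector_Spaces.linear scale scale (\<lambda>z. br x y z)"
    and br_skew12: "br y x z = - br x y z"
    and br_skew23: "br x z y = - br x y z"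
    and fundamental_identity:
      "br x1 x2 (br x3 x4 x5) =
         br (br x1 x2 x3) x4 x5 + br x3 (br x1 x2 x4) x5 + br x3 x4 (br x1 x2 x5)"

locale twilled_three_Lie_algebra =
  three_Lie_algebra scale Basis br
  for scale :: "'k::{alg_closed_field, field_char_0} \<Rightarrow> 'v::ab_group_add \<Rightarrow> 'v"
    and Basis :: "'v set"
    and br :: "'v \<Rightarrow> 'v \<Rightarrow> 'v \<Rightarrow> 'v" +
  fixes g1 g2 :: "'v set"
  assumes subspace_g1: "subspace g1"
    and subspace_g2: "subspace g2"
    and g1_inter_g2: "g1 \<inter> g2 = {0}"
    and g1_plus_g2: "{x + u |x u. x \<in> g1 \<and> u \<in> g2} = UNIV"
    and subalgebra_g1: "x \<in> g1 \<Longrightarrow> y \<in> g1 \<Longrightarrow> z \<in> g1 \<Longrightarrow> br x y z \<in> g1"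
    and subalgebra_g2: "u \<in> g2 \<Longrightarrow> v \<in> g2 \<Longrightarrow> w \<in> g2 \<Longrightarrow> br u v w \<in> g2"

text \<open>The component of a vector in \<open>U\<close>, for an ambient space \<open>U \<oplus> W\<close>.\<close>

definition component :: "'v::ab_group_add set \<Rightarrow> 'v set \<Rightarrow> 'v \<Rightarrow> 'v" where
  "component U W a = (THE x. x \<in> U \<and> a - x \<in> W)"

text \<open>In the next three definitions \<open>a = (x, u)\<close>, \<open>b = (y, v)\<close>, \<open>c = (z, w)\<close> in \<open>g1 \<oplus> g2\<close>.\<close>

definition mu1_map ::
    "('v::ab_group_add \<Rightarrow> 'v \<Rightarrow> 'v \<Rightarrow> 'v) \<Rightarrow> 'v set \<Rightarrow> 'v set \<Rightarrow> 'v \<Rightarrow> 'v \<Rightarrow> 'v \<Rightarrow> 'v" where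
  "mu1_map br g1 g2 a b c =
    (let p1 = component g1 g2; p2 = component g2 g1;
         x = p1 a; u = p2 a; y = p1 b; v = p2 b; z = p1 c; w = p2 c
     in p1 (br x y z) + (p2 (br x y w) + p2 (br u y z) + p2 (br x v z)))"

definition psi_map ::
    "('v::ab_group_add \<Rightarrow> 'v \<Rightarrow> 'v \<Rightarrow> 'v) \<Rightarrow> 'v set \<Rightarrow> 'v set \<Rightarrow> 'v \<Rightarrow> 'v \<Rightarrow> 'v \<Rightarrow> 'v" where
  "psi_map br g1 g2 a b c =
    (let p1 = component g1 g2; p2 = component g2 g1;
         x = p1 a; u = p2 a; y = p1 b; v = p2 b; z = p1 c; w = p2 c
     in (p1 (br x y w) + p1 (br u y z) + p1 (br x v z))
        + (p2 (br x v w) + p2 (br u y w) + p2 (br u v z)))"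

definition mu2_map ::
    "('v::ab_group_add \<Rightarrow> 'v \<Rightarrow> 'v \<Rightarrow> 'v) \<Rightarrow> 'v set \<Rightarrow> 'v set \<Rightarrow> 'v \<Rightarrow> 'v \<Rightarrow> 'v \<Rightarrow> 'v" where
  "mu2_map br g1 g2 a b c =
    (let p1 = component g1 g2; p2 = component g2 g1;
         x = p1 a; u = p2 a; y = p1 b; v = p2 b; z = p1 c; w = p2 c
     in (p1 (br x v w) + p1 (br u y w) + p1 (br u v z)) + p2 (br u v w))"

context twilled_three_Lie_algebra
begin

lemma component_g1_eq:
  assumes "x \<in> g1" "u \<in> g2"
  shows "component g1 g2 (x + u) = x"
  unfolding component_def
proof (rule the_equality)
  show "x \<in> g1 \<and> x + u - x \<in> g2" using assms by simp
next
  fix x' assume x': "x' \<in> g1 \<and> x + u - x' \<in> g2"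
  have "x - x' \<in> g1" using assms x' subspace_g1 by (simp add: subspace_diff)
  moreover have "x - x' = (x + u - x') - u" by simp
  then have "x - x' \<in> g2" using assms x' subspace_g2 by (metis subspace_diff)
  ultimately show "x' = x" using g1_inter_g2 by (metis IntI eq_iff_diff_eq_0 singletonD)
qed

lemma component_g2_eq:
  assumes "x \<in> g1" "u \<in> g2"
  shows "component g2 g1 (x + u) = u"
  unfolding component_def
proof (rule the_equality)
  show "u \<in> g2 \<and> x + u - u \<in> g1" using assms by simp
next
  fix u' assume u': "u' \<in> g2 \<and> x + u - u' \<in> g1"
  have "u - u' \<in> g2" using assms u' subspace_g2 by (simp add: subspace_diff)
  moreover have "u - u' = (x + u - u') - x" by simp
  then have "u - u' \<in> g1" using assms u' subspace_g1 by (metis subspace_diff)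
  ultimately show "u' = u" using g1_inter_g2 by (metis IntI eq_iff_diff_eq_0 singletonD)
qed

lemma decompose:
  obtains x u where "x \<in> g1" "u \<in> g2" "a = x + u"
  using g1_plus_g2 by blast

lemma component_sum: "component g1 g2 a + component g2 g1 a = a"
  by (metis decompose component_g1_eq component_g2_eq)

lemma component_g1_self: "x \<in> g1 \<Longrightarrow> component g1 g2 x = x"
  using component_g1_eq[of x 0] subspace_g2 by (simp add: subspace_0)

lemma component_g2_self: "u \<in> g2 \<Longrightarrow> component g2 g1 u = u"
  using component_g2_eq[of 0 u] subspace_g1 by (simp add: subspace_0)

lemma br_decomposition:
  "br a b c = mu1_map br g1 g2 a b c + psi_map br g1 g2 a b c + mu2_map br g1 g2 a b c"
proof -
  obtain x u where a: "x \<in> g1" "u \<in> g2" "a = x + u" by (rule decompose)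
  obtain y v where b: "y \<in> g1" "v \<in> g2" "b = y + v" by (rule decompose)
  obtain z w where c: "z \<in> g1" "w \<in> g2" "c = z + w" by (rule decompose)
  have add: "br (s + t) p q = br s p q + br t p q" "br p (s + t) q = br p s q + br p t q"
    "br p q (s + t) = br p q s + br p q t" for s t p q
    by (rule module_hom.add[OF Vector_Spaces.linear.axioms(3)] br_linear1 br_linear2 br_linear3)+
  let ?p1 = "component g1 g2" and ?p2 = "component g2 g1"
  have "br a b c = br x y z + (br x y w + br u y z + br x v z)
      + (br x v w + br u y w + br u v z) + br u v w"
    unfolding a b c by (simp only: add add_ac)
  also have "\<dots> = br x y z
      + ((?p1 (br x y w) + ?p2 (br x y w)) + (?p1 (br u y z) + ?p2 (br u y z))
         + (?p1 (br x v z) + ?p2 (br x v z)))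
      + ((?p1 (br x v w) + ?p2 (br x v w)) + (?p1 (br u y w) + ?p2 (br u y w))
         + (?p1 (br u v z) + ?p2 (br u v z))) + br u v w"
    by (simp only: component_sum)
  also have "\<dots> = mu1_map br g1 g2 a b c + psi_map br g1 g2 a b c + mu2_map br g1 g2 a b c"
    unfolding mu1_map_def psi_map_def mu2_map_def Let_def a b c
      component_g1_eq[OF a(1,2)] component_g2_eq[OF a(1,2)] component_g1_eq[OF b(1,2)]
      component_g2_eq[OF b(1,2)] component_g1_eq[OF c(1,2)] component_g2_eq[OF c(1,2)]
      component_g1_self[OF subalgebra_g1[OF a(1) b(1) c(1)]]
      component_g2_self[OF subalgebra_g2[OF a(2) b(2) c(2)]]
    by (simp only: add_ac)
  finally show ?thesis .
qed

end


section \<open>Cochains\<close>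

text \<open>
  A cochain takes the list of its arguments \<open>X\<^sub>i = x\<^sub>i \<and> y\<^sub>i\<close>, each given as the pair
  \<open>(x\<^sub>i, y\<^sub>i)\<close>, followed by the last argument \<open>x\<close>; maps on \<open>\<and>\<^sup>2 V\<close> are bilinear alternating maps
  on pairs.  The number of list entries is the degree.  Cochains on a subspace \<open>V\<close> are extended
  by \<open>0\<close> outside their domain; so the spaces \<open>cochains scale V W n\<close>, \<open>n \<ge> 0\<close>, are
  independent subspaces of one function space, in which their direct sum is their span.
\<close>

type_synonym 'v cochain = "('v \<times> 'v) list \<Rightarrow> 'v \<Rightarrow> 'v"

definition linear_on ::
    "('k \<Rightarrow> 'v \<Rightarrow> 'v) \<Rightarrow> 'v::ab_group_add set \<Rightarrow> ('v \<Rightarrow> 'v) \<Rightarrow> bool" where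
  "linear_on scale V h \<longleftrightarrow>
     (\<forall>a\<in>V. \<forall>b\<in>V. h (a + b) = h a + h b) \<and> (\<forall>c. \<forall>a\<in>V. h (scale c a) = scale c (h a))"

definition cochain_domain :: "'v set \<Rightarrow> nat \<Rightarrow> (('v \<times> 'v) list \<times> 'v) set" where
  "cochain_domain V n = {(Xs, x). length Xs = n \<and> set Xs \<subseteq> V \<times> V \<and> x \<in> V}"

text \<open>
  Linearity in the second entry of each pair follows from linearity in the first one and
  skew-symmetry.
\<close>

definition cochains ::
    "('k \<Rightarrow> 'v \<Rightarrow> 'v) \<Rightarrow> 'v::ab_group_add set \<Rightarrow> 'v set \<Rightarrow> nat \<Rightarrow> 'v cochain set" where
  "cochains scale V W n = {f.
     (\<forall>Xs x. (Xs, x) \<in> cochain_domain V n \<longrightarrow> f Xs x \<in> W) \<and>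
     (\<forall>Xs x. (Xs, x) \<notin> cochain_domain V n \<longrightarrow> f Xs x = 0) \<and>
     (\<forall>Xs. length Xs = n \<and> set Xs \<subseteq> V \<times> V \<longrightarrow> linear_on scale V (f Xs)) \<and>
     (\<forall>Xs x i. \<forall>b\<in>V. (Xs, x) \<in> cochain_domain V n \<and> i < n \<longrightarrow>
        linear_on scale V (\<lambda>a. f (Xs[i := (a, b)]) x)) \<and>
     (\<forall>Xs x i. \<forall>a\<in>V. \<forall>b\<in>V. (Xs, x) \<in> cochain_domain V n \<and> i < n \<longrightarrow>
        f (Xs[i := (b, a)]) x = - f (Xs[i := (a, b)]) x) \<and>
     (\<forall>Xs a b x. (Xs @ [(a, b)], x) \<in> cochain_domain V n \<longrightarrow>
        f (Xs @ [(a, x)]) b = - f (Xs @ [(a, b)]) x)}"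

definition cochain_scale :: "('k \<Rightarrow> 'v \<Rightarrow> 'v) \<Rightarrow> 'k \<Rightarrow> 'v cochain \<Rightarrow> 'v cochain" where
  "cochain_scale scale c f = (\<lambda>Xs x. scale c (f Xs x))"

definition cochain_of_map :: "('v \<Rightarrow> 'v \<Rightarrow> 'v \<Rightarrow> 'v::ab_group_add) \<Rightarrow> 'v cochain" where
  "cochain_of_map t = (\<lambda>Xs z. case Xs of [(x, y)] \<Rightarrow> t x y z | _ \<Rightarrow> 0)"


section \<open>The graded bracket\<close>

definition unshuffles :: "nat \<Rightarrow> nat \<Rightarrow> (nat \<Rightarrow> nat) set" where
  "unshuffles i j = {\<sigma>. \<sigma> permutes {1..i + j} \<and>
     strict_mono_on {1..i} \<sigma> \<and> strict_mono_on {i + 1..i + j} \<sigma>}"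

text \<open>
  \<open>circ scale p q P Q\<close> is \<open>P \<circ> Q\<close> for \<open>P\<close> of degree \<open>p\<close> and \<open>Q\<close> of degree \<open>q\<close>; it is only used
  on lists \<open>Xs\<close> of length \<open>p + q\<close>.
\<close>

definition circ ::
    "('k::field \<Rightarrow> 'v \<Rightarrow> 'v) \<Rightarrow> nat \<Rightarrow> nat \<Rightarrow> 'v cochain \<Rightarrow> 'v cochain \<Rightarrow> 'v::ab_group_add cochain"
  where
  "circ scale p q P Q = (\<lambda>Xs x.
     let X = (\<lambda>i. Xs ! (i - 1)) in
     (\<Sum>k=1..p. \<Sum>\<sigma>\<in>unshuffles (k - 1) q.
        scale ((-1) ^ ((k - 1) * q) * of_int (sign \<sigma>))
          (P (map (X \<circ> \<sigma>) [1..<k]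
              @ [(Q (map (X \<circ> \<sigma>) [k..<k + q]) (fst (X (k + q))), snd (X (k + q)))]
              @ map X [k + q + 1..<p + q + 1]) x))
     + (\<Sum>k=1..p. \<Sum>\<sigma>\<in>unshuffles (k - 1) q.
        scale ((-1) ^ ((k - 1) * q) * of_int (sign \<sigma>))
          (P (map (X \<circ> \<sigma>) [1..<k]
              @ [(fst (X (k + q)), Q (map (X \<circ> \<sigma>) [k..<k + q]) (snd (X (k + q))))]
              @ map X [k + q + 1..<p + q + 1]) x))
     + (\<Sum>\<sigma>\<in>unshuffles p q.
        scale ((-1) ^ (p * q) * of_int (sign \<sigma>))
          (P (map (X \<circ> \<sigma>) [1..<p + 1]) (Q (map (X \<circ> \<sigma>) [p + 1..<p + q + 1]) x))))"

text \<open>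
  The bilinear extension to the whole direct sum of the bracket
  \<open>[P, Q] = P \<circ> Q - (-1)\<^bsup>pq\<^esup> Q \<circ> P\<close> of homogeneous cochains: the value on \<open>n\<close> pairs
  collects the contributions of all components of \<open>P\<close> and \<open>Q\<close> of degrees \<open>p + q = n\<close>.
  Lemma \<open>gbracket_homogeneous\<close> below recovers the formula for homogeneous cochains.
\<close>

definition gbracket ::
    "('k::field \<Rightarrow> 'v \<Rightarrow> 'v) \<Rightarrow> 'v cochain \<Rightarrow> 'v cochain \<Rightarrow> 'v::ab_group_add cochain" where
  "gbracket scale P Q = (\<lambda>Xs x.
     \<Sum>(p, q)\<in>{(p, q). p + q = length Xs}.
       circ scale p q P Q Xs x - scale ((-1) ^ (p * q)) (circ scale q p Q P Xs x))"

lemma cochain_domain_UNIV: "(Xs, x) \<in> cochain_domain UNIV n \<longleftrightarrow> length Xs = n"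
  by (simp add: cochain_domain_def)

lemma cochains_wrong_length:
  "P \<in> cochains scale UNIV W p \<Longrightarrow> length Xs \<noteq> p \<Longrightarrow> P Xs x = 0"
  by (simp add: cochains_def cochain_domain_def)

lemma (in vector_space) linear_on_zero:
  assumes "linear_on scale UNIV h" shows "h 0 = 0"
proof -
  have "h (scale 0 0) = scale 0 (h 0)" using assms unfolding linear_on_def by blast
  then show ?thesis by simp
qed

lemma (in vector_space) cochains_zero_arg:
  assumes P: "P \<in> cochains scale UNIV W p"
  shows "P Xs 0 = 0" "P (As @ [(0, b)] @ Bs) x = 0" "P (As @ [(b, 0)] @ Bs) x = 0"
proof -
  show "P Xs 0 = 0"
  proof (cases "length Xs = p")
    case True
    then have "linear_on scale UNIV (P Xs)" using P by (simp add: cochains_def)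
    then show ?thesis by (rule linear_on_zero)
  qed (simp add: cochains_wrong_length[OF P])
  show zero1: "P (As @ [(0, b)] @ Bs) x = 0" for b
  proof (cases "length (As @ [(0, b)] @ Bs) = p")
    case True
    have "\<forall>Xs x i b. length Xs = p \<and> i < p \<longrightarrow>
        linear_on scale UNIV (\<lambda>a. P (Xs[i := (a, b)]) x)"
      using P unfolding cochains_def mem_Collect_eq cochain_domain_UNIV by blast
    moreover have "length As < p" using True by simp
    ultimately have
      "linear_on scale UNIV (\<lambda>a. P ((As @ [(0, b)] @ Bs)[length As := (a, b)]) x)"
      using True by blast
    from linear_on_zero[OF this] show ?thesis by simp
  next
    case False
    then show ?thesis using cochains_wrong_length[OF P] by blast
  qed
  show "P (As @ [(b, 0)] @ Bs) x = 0"
  proof (cases "length (As @ [(b, 0)] @ Bs) = p")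
    case True
    have "\<forall>Xs x i a b. length Xs = p \<and> i < p \<longrightarrow>
        P (Xs[i := (b, a)]) x = - P (Xs[i := (a, b)]) x"
      using P unfolding cochains_def mem_Collect_eq cochain_domain_UNIV by blast
    moreover have "length (As @ [(0, b)] @ Bs) = p" "length As < p" using True by simp_all
    ultimately have "P ((As @ [(0, b)] @ Bs)[length As := (b, 0)]) x =
        - P ((As @ [(0, b)] @ Bs)[length As := (0, b)]) x"
      by blast
    with zero1 show ?thesis by simp
  next
    case False
    then show ?thesis using cochains_wrong_length[OF P] by blast
  qed
qed

lemma (in vector_space) circ_wrong_degree:
  assumes P: "P \<in> cochains scale UNIV UNIV p" and Q: "Q \<in> cochains scale UNIV UNIV q"
    and ne: "p' \<noteq> p \<or> q' \<noteq> q"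
  shows "circ scale p' q' P Q Xs x = 0"
proof -
  have sum3: "a + b + c = 0" if "a = 0" "b = 0" "c = 0" for a b c :: 'b
    using that by simp
  have Q0: "Q (map f [k..<k + q']) y = 0" if "q' \<noteq> q" for f k y
    by (rule cochains_wrong_length[OF Q]) (use that in simp)
  have Q0': "Q (map f [p' + 1..<p' + q' + 1]) y = 0" if "q' \<noteq> q" for f y
    by (rule cochains_wrong_length[OF Q]) (use that in simp)
  have P0: "P (map f [1..<k] @ [ab] @ map g [k + q' + 1..<p' + q' + 1]) y = 0"
    if "p' \<noteq> p" "k \<in> {1..p'}" for f k ab g y
    by (rule cochains_wrong_length[OF P]) (use that in auto)
  have P0': "P (map f [1..<p' + 1]) y = 0" if "p' \<noteq> p" for f y
    by (rule cochains_wrong_length[OF P]) (use that in simp)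
  have sc0: "scale c v = 0" if "v = 0" for c v
    using that by simp
  show ?thesis
  proof (cases "q' = q")
    case False
    have "scale c (P (map f [1..<k] @ [(Q (map h [k..<k + q']) y, b)] @ Bs) x) = 0"
      for c f k h y b Bs
      unfolding Q0[OF False] by (intro sc0 cochains_zero_arg[OF P])
    moreover have "scale c (P (map f [1..<k] @ [(b, Q (map h [k..<k + q']) y)] @ Bs) x) = 0"
      for c f k h y b Bs
      unfolding Q0[OF False] by (intro sc0 cochains_zero_arg[OF P])
    moreover have "scale c (P As (Q (map h [p' + 1..<p' + q' + 1]) x)) = 0" for c h As
      unfolding Q0'[OF False] by (intro sc0 cochains_zero_arg[OF P])
    ultimately show ?thesis
      unfolding circ_def Let_def by (intro sum3 sum.neutral ballI)
  next
    case True
    with ne have ne': "p' \<noteq> p" by simp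
    have "scale c (P (map f [1..<k] @ [ab] @ map g [k + q' + 1..<p' + q' + 1]) x) = 0"
      if "k \<in> {1..p'}" for c f k ab g
      by (intro sc0 P0 ne' that)
    moreover have "scale c (P (map f [1..<p' + 1]) y) = 0" for c f y
      by (intro sc0 P0' ne')
    ultimately show ?thesis
      unfolding circ_def Let_def by (intro sum3 sum.neutral ballI)
  qed
qed

lemma (in vector_space) gbracket_homogeneous:
  assumes P: "P \<in> cochains scale UNIV UNIV p" and Q: "Q \<in> cochains scale UNIV UNIV q"
  shows "gbracket scale P Q Xs x =
    (if length Xs = p + q
     then circ scale p q P Q Xs x - scale ((-1) ^ (p * q)) (circ scale q p Q P Xs x) else 0)"
proof -
  let ?S = "{(i, j). i + j = length Xs}"
  let ?t = "\<lambda>i j. circ scale i j P Q Xs x - scale ((-1) ^ (i * j)) (circ scale j i Q P Xs x)"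
  have fin: "finite ?S"
    by (rule finite_subset[of _ "{..length Xs} \<times> {..length Xs}"]) auto
  have zero: "?t i j = 0" if "(i, j) \<noteq> (p, q)" for i j
    using that circ_wrong_degree[OF P Q, of i j] circ_wrong_degree[OF Q P, of j i] by auto
  have "(case ij of (i, j) \<Rightarrow> ?t i j) = (if ij = (p, q) then ?t p q else 0)" for ij
    using zero by (cases ij) auto
  then have "gbracket scale P Q Xs x = (\<Sum>ij\<in>?S. if ij = (p, q) then ?t p q else 0)"
    unfolding gbracket_def by (rule sum.cong[OF refl])
  also have "\<dots> = (if length Xs = p + q then ?t p q else 0)"
    using fin by (simp add: sum.delta eq_commute)
  finally show ?thesis .
qed


section \<open>L-infinity algebras\<close>

locale graded_vector_space =
  vector_space scale
  for scale :: "'k::field \<Rightarrow> 'x::ab_group_add \<Rightarrow> 'x" +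
  fixes G :: "int \<Rightarrow> 'x set"
  assumes subspace_G: "subspace (G d)"
    and independent_G: "finite D \<Longrightarrow> (\<And>d. d \<in> D \<Longrightarrow> y d \<in> G d) \<Longrightarrow> (\<Sum>d\<in>D. y d) = 0 \<Longrightarrow>
      d \<in> D \<Longrightarrow> y d = 0"
begin

definition total :: "'x set" where
  "total = span (\<Union>d. G d)"

end

text \<open>
  The sign \<open>\<epsilon>(\<sigma>)\<close> in \<open>x\<^sub>1 \<dots> x\<^sub>n = \<epsilon>(\<sigma>) x\<^bsub>\<sigma>(1)\<^esub> \<dots> x\<^bsub>\<sigma>(n)\<^esub>\<close> for graded commuting \<open>x\<^sub>i\<close> of
  degree \<open>d i\<close>: a factor \<open>(-1)\<^bsup>|a| |b|\<^esup>\<close> for each inversion.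
\<close>

definition koszul_sign :: "nat \<Rightarrow> (nat \<Rightarrow> int) \<Rightarrow> (nat \<Rightarrow> nat) \<Rightarrow> int" where
  "koszul_sign n d \<sigma> =
     (\<Prod>(i, j)\<in>{(i, j). 1 \<le> i \<and> i < j \<and> j \<le> n \<and> \<sigma> j < \<sigma> i}.
        if odd (d (\<sigma> i) * d (\<sigma> j)) then -1 else 1)"

text \<open>The operation \<open>l\<^sub>k\<close> is the restriction of \<open>l\<close> to lists of length \<open>k \<ge> 1\<close>.\<close>

locale L_infinity_algebra =
  graded_vector_space scale G
  for scale :: "'k::field \<Rightarrow> 'x::ab_group_add \<Rightarrow> 'x" and G :: "int \<Rightarrow> 'x set" +
  fixes l :: "'x list \<Rightarrow> 'x"
  assumes l_closed: "xs \<noteq> [] \<Longrightarrow> set xs \<subseteq> total \<Longrightarrow> l xs \<in> total"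
    and l_multilinear: "set xs \<subseteq> total \<Longrightarrow> i < length xs \<Longrightarrow>
      linear_on scale total (\<lambda>y. l (xs[i := y]))"
    and l_degree: "xs \<noteq> [] \<Longrightarrow> list_all2 (\<lambda>x d. x \<in> G d) xs ds \<Longrightarrow> l xs \<in> G (sum_list ds + 1)"
    and l_symmetric: "n \<ge> 1 \<Longrightarrow> (\<And>i. i \<in> {1..n} \<Longrightarrow> x i \<in> G (d i)) \<Longrightarrow> \<sigma> permutes {1..n} \<Longrightarrow>
      l (map (x \<circ> \<sigma>) [1..<n + 1]) =
        scale (of_int (koszul_sign n d \<sigma>)) (l (map x [1..<n + 1]))"
    and l_jacobi: "n \<ge> 1 \<Longrightarrow> (\<And>i. i \<in> {1..n} \<Longrightarrow> x i \<in> G (d i)) \<Longrightarrow>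
      (\<Sum>i=1..n. \<Sum>\<sigma>\<in>unshuffles i (n - i).
         scale (of_int (koszul_sign n d \<sigma>))
           (l (l (map (x \<circ> \<sigma>) [1..<i + 1]) # map (x \<circ> \<sigma>) [i + 1..<n + 1]))) = 0"


section \<open>The operations of a twilled 3-Lie algebra\<close>

definition lift :: "'v::ab_group_add set \<Rightarrow> 'v set \<Rightarrow> 'v cochain \<Rightarrow> 'v cochain" where
  "lift g1 g2 g = (\<lambda>Xs x.
     g (map (map_prod (component g2 g1) (component g2 g1)) Xs) (component g2 g1 x))"

text \<open>
  Restriction of the arguments to \<open>g2\<close>; this takes the lift of a cochain on \<open>g2\<close> back to that
  cochain.
\<close>

definition unlift :: "'v::ab_group_add set \<Rightarrow> 'v cochain \<Rightarrow> 'v cochain" where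
  "unlift g2 f = (\<lambda>Xs x. if set Xs \<subseteq> g2 \<times> g2 \<and> x \<in> g2 then f Xs x else 0)"

lemma (in twilled_three_Lie_algebra) unlift_lift:
  assumes "g \<in> cochains scale g2 g1 m"
  shows "unlift g2 (lift g1 g2 g) = g"
proof (intro ext)
  fix Xs x
  show "unlift g2 (lift g1 g2 g) Xs x = g Xs x"
  proof (cases "set Xs \<subseteq> g2 \<times> g2 \<and> x \<in> g2")
    case True
    then have "map (map_prod (component g2 g1) (component g2 g1)) Xs = Xs"
      by (intro map_idI) (auto simp: component_g2_self)
    with True show ?thesis by (simp add: unlift_def lift_def component_g2_self)
  next
    case False
    with assms show ?thesis by (auto simp: unlift_def cochains_def cochain_domain_def)
  qed
qed

definition mu1_hat :: "('v::ab_group_add \<Rightarrow> 'v \<Rightarrow> 'v \<Rightarrow> 'v) \<Rightarrow> 'v set \<Rightarrow> 'v set \<Rightarrow> 'v cochain" where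
  "mu1_hat br g1 g2 = cochain_of_map (mu1_map br g1 g2)"

definition psi_hat :: "('v::ab_group_add \<Rightarrow> 'v \<Rightarrow> 'v \<Rightarrow> 'v) \<Rightarrow> 'v set \<Rightarrow> 'v set \<Rightarrow> 'v cochain" where
  "psi_hat br g1 g2 = cochain_of_map (psi_map br g1 g2)"

definition mu2_hat :: "('v::ab_group_add \<Rightarrow> 'v \<Rightarrow> 'v \<Rightarrow> 'v) \<Rightarrow> 'v set \<Rightarrow> 'v set \<Rightarrow> 'v cochain" where
  "mu2_hat br g1 g2 = cochain_of_map (mu2_map br g1 g2)"

fun twilled_l ::
    "('k::field \<Rightarrow> 'v \<Rightarrow> 'v) \<Rightarrow> ('v \<Rightarrow> 'v \<Rightarrow> 'v \<Rightarrow> 'v) \<Rightarrow> 'v set \<Rightarrow> 'v set \<Rightarrow>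
     'v cochain list \<Rightarrow> 'v::ab_group_add cochain" where
  "twilled_l scale br g1 g2 [a] =
     unlift g2 (gbracket scale (mu2_hat br g1 g2) (lift g1 g2 a))"
| "twilled_l scale br g1 g2 [a, b] =
     unlift g2 (gbracket scale (gbracket scale (psi_hat br g1 g2) (lift g1 g2 a)) (lift g1 g2 b))"
| "twilled_l scale br g1 g2 [a, b, c] =
     unlift g2 (gbracket scale
       (gbracket scale (gbracket scale (mu1_hat br g1 g2) (lift g1 g2 a)) (lift g1 g2 b))
       (lift g1 g2 c))"
| "twilled_l scale br g1 g2 _ = 0"

definition cochain_grading ::
    "('k \<Rightarrow> 'v \<Rightarrow> 'v) \<Rightarrow> 'v::ab_group_add set \<Rightarrow> 'v set \<Rightarrow> int \<Rightarrow> 'v cochain set" where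
  "cochain_grading scale V W d = (if d \<ge> 0 then cochains scale V W (nat d) else {0})"

end

theory Submission
  imports Defs
begin

text \<open>
  The theorem is an instance of the construction of higher derived brackets.  Write
  \<open>\<Omega> 1 = mu2_hat\<close>, \<open>\<Omega> 2 = psi_hat\<close>, \<open>\<Omega> 3 = mu1_hat\<close> and \<open>\<Omega> k = 0\<close> otherwise, so that \<open>l\<^sub>k\<close> sends
  \<open>a\<^sub>1, \<dots>, a\<^sub>k\<close> to \<open>[\<dots>[\<Omega> k, a\<^sub>1], \<dots>, a\<^sub>k]\<close>.  Put \<open>g2\<close> in degree \<open>0\<close> and \<open>g1\<close> in degree \<open>1\<close>.
  A cochain on \<open>g1 \<oplus> g2\<close> then splits into homogeneous parts, the bracket adds degrees, \<open>\<Omega> k\<close> has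
  degree \<open>1 - k\<close>, lifts are exactly the cochains of degree \<open>1\<close>, and nothing has a degree above \<open>1\<close>
  (\<open>homogeneous_1_is_lift\<close>, \<open>homogeneous_ge_2_zero\<close>).  Hence lifts commute, the value of \<open>l\<^sub>k\<close> is
  again a lift, and \<open>l\<^sub>k\<close> is graded symmetric, because \<open>[[F, a], b]\<close> and \<open>[[F, b], a]\<close> differ
  by the term \<open>[F, [a, b]] = 0\<close> only.

  For the generalized Jacobi identity, the part of degree \<open>1 - n\<close> of \<open>[\<Omega>, \<Omega>] = 0\<close> reads
  \<open>\<Sum> [\<Omega> j, \<Omega> i] = 0\<close> over \<open>i + j = n + 1\<close> (\<open>structure_equation\<close>).  Its bracket with
  \<open>a\<^sub>1, \<dots>, a\<^sub>n\<close> is, by the derivation rule, a signed sum of terms \<open>[\<Omega> j B, \<Omega> i A]\<close> over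
  all ways to split the arguments into \<open>A\<close> and \<open>B\<close>.  The two entries have degrees at most \<open>1\<close> that
  add up to \<open>1\<close>; so one of them has degree \<open>1\<close> and is a value of \<open>l\<close>, and moving it into the
  first place of the other one gives a summand of the Jacobi identity.  Both entries can play
  this role, and the two sums agree: twice the Jacobi sum is zero (\<open>generalized_jacobi\<close>).

  All of this takes place in the graded Lie algebra of cochains, and that it is one has to be
  proved first.  The shuffle formula for \<open>P \<circ> Q\<close> is equivalent to the rule
  \<open>i\<^sub>X (P \<circ> Q) = P \<circ> i\<^sub>X Q + (-1)\<^sup>q i\<^sub>X P \<circ> Q + i\<^bsub>QX\<^esub> P\<close> for the contraction \<open>i\<^sub>X\<close> with the first pair
  \<open>X\<close>, where the last term occurs for \<open>q = 0\<close> only (\<open>circ_eq_pre_lie\<close>).  In this form the graded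
  pre-Lie identity follows by induction on the number of pairs (\<open>associator_symmetric\<close>), and a
  commutator of a graded pre-Lie product satisfies the graded Jacobi identity.
\<close>

section \<open>The pre-Lie product as a recursion over the argument list\<close>

text \<open>
  Multiplication by \<open>(-1)\<^sup>n\<close> in an arbitrary abelian group, so that signs stay apart from the
  scalar multiplication.
\<close>

definition sg :: "nat \<Rightarrow> 'a::ab_group_add \<Rightarrow> 'a" where
  "sg n v = (if even n then v else - v)"

lemma sg_simps [simp]: "sg 0 v = v" "sg (Suc 0) v = - v" "sg n (0::'a::ab_group_add) = 0"
  "sg n (sg m v) = sg (n + m) v" "sg n (- v) = - sg n v" "sg (Suc n) v = - sg n v"
  by (auto simp: sg_def)

lemma sg_add: "sg n (v + w) = sg n v + sg n w"
  by (simp add: sg_def)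

lemma sg_diff: "sg n (v - w) = sg n v - sg n w"
  by (simp add: sg_def)

lemma sg_apply: "sg n f x = sg n (f x)"
  by (simp add: sg_def)

lemma sg_cong: "even (n + m) \<Longrightarrow> sg n v = sg m v"
  by (auto simp: sg_def)

definition contr :: "'v \<times> 'v \<Rightarrow> 'v cochain \<Rightarrow> 'v cochain" where
  "contr X P = (\<lambda>Xs. P (X # Xs))"

text \<open>
  The parity involution.  A contraction that passes \<open>Q\<close> picks up the sign \<open>(-1)\<^sup>q\<close>; applying
  \<open>twist\<close> to \<open>Q\<close> records it for cochains that are not homogeneous as well.
\<close>

definition twist :: "'v::ab_group_add cochain \<Rightarrow> 'v cochain" where
  "twist P = (\<lambda>Xs. sg (length Xs) (P Xs))"

text \<open>
  The first pair \<open>X\<close> is an argument of \<open>Q\<close>, or an argument of \<open>P\<close> that precedes the place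
  where \<open>Q\<close> is inserted, or it is this place itself; in the last case \<open>Q\<close> can only have consumed
  earlier pairs, hence none.
\<close>

primrec pre_lie_at ::
    "('v \<times> 'v) list \<Rightarrow> 'v::ab_group_add cochain \<Rightarrow> 'v cochain \<Rightarrow> 'v \<Rightarrow> 'v" where
  "pre_lie_at [] = (\<lambda>P Q x. P [] (Q [] x))"
| "pre_lie_at (X # Xs) = (\<lambda>P Q x.
     pre_lie_at Xs P (contr X Q) x + pre_lie_at Xs (contr X P) (twist Q) x
     + P ((Q [] (fst X), snd X) # Xs) x + P ((fst X, Q [] (snd X)) # Xs) x)"

definition pre_lie ::
    "'v::ab_group_add cochain \<Rightarrow> 'v cochain \<Rightarrow> 'v cochain" (infixl "\<odot>" 70) where
  "P \<odot> Q = (\<lambda>Xs. pre_lie_at Xs P Q)"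

text \<open>
  Contraction with the image of \<open>X\<close> under the derivation of \<open>\<and>\<^sup>2 V\<close> induced by \<open>T\<close>; this image is
  a sum of two pairs.
\<close>

definition act :: "('v \<Rightarrow> 'v) \<Rightarrow> 'v \<times> 'v \<Rightarrow> 'v::ab_group_add cochain \<Rightarrow> 'v cochain" where
  "act T X P = contr (T (fst X), snd X) P + contr (fst X, T (snd X)) P"

lemma pre_lie_Nil: "(P \<odot> Q) [] x = P [] (Q [] x)"
  by (simp add: pre_lie_def)

lemma pre_lie_Cons:
  "(P \<odot> Q) (X # Xs) x = (P \<odot> contr X Q) Xs x + (contr X P \<odot> twist Q) Xs x
     + P ((Q [] (fst X), snd X) # Xs) x + P ((fst X, Q [] (snd X)) # Xs) x"
  by (simp add: pre_lie_def)

lemma contr_pre_lie: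
  "contr X (P \<odot> Q) = P \<odot> contr X Q + contr X P \<odot> twist Q + act (Q []) X P"
  by (auto simp: fun_eq_iff contr_def[of X "P \<odot> Q"] pre_lie_Cons act_def)
     (simp add: contr_def)

lemma contr_simps [simp]: "contr X (P + Q) = contr X P + contr X Q"
  "contr X (P - Q) = contr X P - contr X Q" "contr X (- P) = - contr X P" "contr X 0 = 0"
  by (simp_all add: contr_def fun_eq_iff)

lemma twist_simps [simp]: "twist (P + Q) = twist P + twist Q" "twist (- P) = - twist P"
  "twist (P - Q) = twist P - twist Q" "twist (twist P) = P" "twist 0 = 0"
  by (simp_all add: twist_def fun_eq_iff sg_def)

lemma twist_Nil [simp]: "twist P [] = P []"
  by (simp add: twist_def)

lemma contr_twist [simp]: "contr X (twist P) = - twist (contr X P)"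
  by (simp add: contr_def twist_def fun_eq_iff sg_def)

lemma pre_lie_add_left: "(P + P') \<odot> Q = P \<odot> Q + P' \<odot> Q"
proof (intro ext)
  fix Xs x show "((P + P') \<odot> Q) Xs x = (P \<odot> Q + P' \<odot> Q) Xs x"
    by (induction Xs arbitrary: P P' Q) (simp_all add: pre_lie_Nil pre_lie_Cons algebra_simps)
qed

lemma pre_lie_minus_left: "(- P) \<odot> Q = - (P \<odot> Q)"
proof (intro ext)
  fix Xs x show "((- P) \<odot> Q) Xs x = (- (P \<odot> Q)) Xs x"
    by (induction Xs arbitrary: P Q) (simp_all add: pre_lie_Nil pre_lie_Cons algebra_simps)
qed

lemma pre_lie_diff_left: "(P - P') \<odot> Q = P \<odot> Q - P' \<odot> Q"
  using pre_lie_add_left[of P "- P'" Q] by (simp add: pre_lie_minus_left)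

lemma pre_lie_zero_left [simp]: "0 \<odot> Q = 0"
  using pre_lie_diff_left[of 0 0 Q] by simp

abbreviation lin :: "('k \<Rightarrow> 'v \<Rightarrow> 'v) \<Rightarrow> ('v::ab_group_add \<Rightarrow> 'v) \<Rightarrow> bool" where
  "lin scale h \<equiv> linear_on scale UNIV h"

text \<open>
  There is no condition on the number of pairs, so direct sums of cochains of different degrees
  are covered.
\<close>

definition multilinear :: "('k \<Rightarrow> 'v \<Rightarrow> 'v) \<Rightarrow> 'v::ab_group_add cochain \<Rightarrow> bool" where
  "multilinear scale P \<longleftrightarrow> (\<forall>Xs. lin scale (P Xs)) \<and>
     (\<forall>As b Bs x. lin scale (\<lambda>a. P (As @ (a, b) # Bs) x)) \<and>
     (\<forall>As a Bs x. lin scale (\<lambda>b. P (As @ (a, b) # Bs) x))"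

abbreviation \<C> :: "('k \<Rightarrow> 'v \<Rightarrow> 'v) \<Rightarrow> nat \<Rightarrow> 'v::ab_group_add cochain set" where
  "\<C> scale n \<equiv> cochains scale UNIV UNIV n"

context vector_space
begin

lemma lin_simps:
  fixes h :: "'b \<Rightarrow> 'b" and a b :: 'b and c :: 'a
  assumes "lin scale h"
  shows "h (a + b) = h a + h b" "h (scale c a) = scale c (h a)" "h 0 = 0" "h (- a) = - h a"
    "h (a - b) = h a - h b" "h (sg n a) = sg n (h a)"
proof -
  show add: "h (a + b) = h a + h b" for a b using assms unfolding linear_on_def by blast
  show scale: "h (scale c a) = scale c (h a)" for c a using assms unfolding linear_on_def by blast
  show "h 0 = 0" using assms by (rule linear_on_zero)
  show neg: "h (- a) = - h a" for a using scale[of "-1" a] by simp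
  show "h (a - b) = h a - h b" using add[of a "- b"] neg[of b] by simp
  show "h (sg n a) = sg n (h a)" by (simp add: sg_def neg)
qed

lemma scale_sg: "scale c (sg n v) = sg n (scale c v)"
  by (simp add: sg_def)

lemma scale_power_minus_one: "scale ((-1) ^ n) v = sg n v"
  by (simp add: sg_def)

lemma lin_intros:
  "lin scale (\<lambda>x. 0)"
  "lin scale f \<Longrightarrow> lin scale g \<Longrightarrow> lin scale (\<lambda>x. f x + g x)"
  "lin scale f \<Longrightarrow> lin scale (\<lambda>x. - f x)"
  "lin scale f \<Longrightarrow> lin scale g \<Longrightarrow> lin scale (\<lambda>x. f x - g x)"
  "lin scale f \<Longrightarrow> lin scale (\<lambda>x. sg n (f x))"
  "lin scale f \<Longrightarrow> lin scale (\<lambda>x. scale c (f x))"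
  by (auto simp: linear_on_def algebra_simps scale_right_distrib scale_right_diff_distrib sg_add
      scale_sg scale_left_commute)

lemma lin_comp: "lin scale f \<Longrightarrow> lin scale g \<Longrightarrow> lin scale (\<lambda>x. f (g x))"
  by (simp add: linear_on_def)

lemma multilinearD:
  assumes "multilinear scale P"
  shows "lin scale (P Xs)" "lin scale (\<lambda>a. P (As @ (a, b) # Bs) x)" "lin scale (\<lambda>b. P (As @ (a, b) # Bs) x)"
    "lin scale (\<lambda>a. P ((a, b) # Bs) x)" "lin scale (\<lambda>b. P ((a, b) # Bs) x)"
proof -
  show "lin scale (P Xs)" using assms by (simp add: multilinear_def)
  show 1: "lin scale (\<lambda>a. P (As @ (a, b) # Bs) x)" for As
    using assms by (simp add: multilinear_def)
  show 2: "lin scale (\<lambda>b. P (As @ (a, b) # Bs) x)" for As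
    using assms by (simp add: multilinear_def)
  show "lin scale (\<lambda>a. P ((a, b) # Bs) x)" "lin scale (\<lambda>b. P ((a, b) # Bs) x)"
    using 1[of "[]"] 2[of "[]"] by simp_all
qed

lemma multilinear_add: "multilinear scale P \<Longrightarrow> multilinear scale Q \<Longrightarrow> multilinear scale (P + Q)"
  unfolding multilinear_def by (simp add: lin_intros plus_fun_def)

lemma multilinear_minus: "multilinear scale P \<Longrightarrow> multilinear scale (- P)"
  unfolding multilinear_def by (simp add: lin_intros fun_Compl_def)

lemma multilinear_diff: "multilinear scale P \<Longrightarrow> multilinear scale Q \<Longrightarrow> multilinear scale (P - Q)"
  unfolding multilinear_def by (simp add: lin_intros fun_diff_def)

lemma multilinear_zero: "multilinear scale 0"
  unfolding multilinear_def by (simp add: lin_intros zero_fun_def)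

lemma multilinear_cochain_scale: "multilinear scale P \<Longrightarrow> multilinear scale (cochain_scale scale c P)"
  unfolding multilinear_def cochain_scale_def by (simp add: lin_intros)

lemma multilinear_sum: "(\<And>i. i \<in> I \<Longrightarrow> multilinear scale (f i)) \<Longrightarrow> multilinear scale (\<Sum>i\<in>I. f i)"
  by (induction I rule: infinite_finite_induct) (simp_all add: multilinear_zero multilinear_add)

lemma multilinear_contr: "multilinear scale P \<Longrightarrow> multilinear scale (contr X P)"
  unfolding contr_def
  using multilinearD(1)[of P "X # Xs" for Xs] multilinearD(2,3)[of P "X # As" for As]
  by (simp add: multilinear_def)

lemma multilinear_twist: "multilinear scale P \<Longrightarrow> multilinear scale (twist P)"
  unfolding multilinear_def twist_def sg_apply by (simp add: lin_intros)

lemma multilinear_act: "multilinear scale P \<Longrightarrow> multilinear scale (act T X P)"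
  unfolding act_def by (intro multilinear_add multilinear_contr)

lemmas multilinear_intros = multilinear_zero multilinear_add multilinear_minus multilinear_diff
  multilinear_contr multilinear_twist multilinear_act multilinear_cochain_scale

lemma pre_lie_add_right:
  assumes "multilinear scale P"
  shows "P \<odot> (Q + Q') = P \<odot> Q + P \<odot> Q'"
proof (intro ext)
  fix Xs x from assms show "(P \<odot> (Q + Q')) Xs x = (P \<odot> Q + P \<odot> Q') Xs x"
  proof (induction Xs arbitrary: P Q Q')
    case Nil
    then show ?case by (simp add: pre_lie_Nil lin_simps[OF multilinearD(1)])
  next
    case (Cons X Xs)
    show ?case
      using lin_simps(1)[OF multilinearD(4)[OF Cons.prems]]
        lin_simps(1)[OF multilinearD(5)[OF Cons.prems]]
      unfolding pre_lie_Cons contr_simps twist_simps Cons.IH[OF Cons.prems]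
        Cons.IH[OF multilinear_contr[OF Cons.prems]]
      unfolding plus_fun_apply pre_lie_Cons by (simp only: add_ac)
  qed
qed

lemma cochain_scale_simps:
  "cochain_scale scale c (P + Q) = cochain_scale scale c P + cochain_scale scale c Q"
  "contr X (cochain_scale scale c P) = cochain_scale scale c (contr X P)"
  "twist (cochain_scale scale c P) = cochain_scale scale c (twist P)"
  by (simp_all add: fun_eq_iff cochain_scale_def scale_right_distrib contr_def twist_def sg_def)

lemma pre_lie_scale_right:
  assumes "multilinear scale P"
  shows "P \<odot> cochain_scale scale c Q = cochain_scale scale c (P \<odot> Q)"
proof (intro ext)
  fix Xs x from assms
  show "(P \<odot> cochain_scale scale c Q) Xs x = cochain_scale scale c (P \<odot> Q) Xs x"
  proof (induction Xs arbitrary: P Q)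
    case Nil
    then show ?case by (simp add: pre_lie_Nil lin_simps[OF multilinearD(1)] cochain_scale_def)
  next
    case (Cons X Xs)
    show ?case
      using lin_simps(2)[OF multilinearD(4)[OF Cons.prems]]
        lin_simps(2)[OF multilinearD(5)[OF Cons.prems]]
      by (simp add: pre_lie_Cons Cons.IH Cons.prems multilinear_contr cochain_scale_simps)
         (simp add: cochain_scale_def pre_lie_Cons scale_right_distrib)
  qed
qed

lemma pre_lie_scale_left: "cochain_scale scale c P \<odot> Q = cochain_scale scale c (P \<odot> Q)"
proof (intro ext)
  fix Xs x
  show "(cochain_scale scale c P \<odot> Q) Xs x = cochain_scale scale c (P \<odot> Q) Xs x"
    by (induction Xs arbitrary: P Q)
       (simp_all add: pre_lie_Nil pre_lie_Cons cochain_scale_def scale_right_distrib contr_def)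
qed

lemma pre_lie_minus_right: "multilinear scale P \<Longrightarrow> P \<odot> (- Q) = - (P \<odot> Q)"
  using pre_lie_scale_right[of P "-1" Q] by (simp add: cochain_scale_def fun_Compl_def)

lemma pre_lie_diff_right: "multilinear scale P \<Longrightarrow> P \<odot> (Q - Q') = P \<odot> Q - P \<odot> Q'"
  using pre_lie_add_right[of P Q "- Q'"] by (simp add: pre_lie_minus_right)

lemma pre_lie_zero_right: "multilinear scale P \<Longrightarrow> P \<odot> 0 = 0"
  using pre_lie_diff_right[of P 0 0] by simp

text \<open>
  The place \<open>As\<close> of the varied pair moves to the front under the recursion; at the front each of
  the four summands depends linearly on it, through \<open>P\<close> or through \<open>Q\<close>.
\<close>

lemma multilinear_pre_lie:
  assumes P: "multilinear scale P" and Q: "multilinear scale Q"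
  shows "multilinear scale (P \<odot> Q)"
proof -
  have args: "lin scale (\<lambda>a. contr (a, b) P Xs x)" "lin scale (\<lambda>b. contr (a, b) P Xs x)"
    if "multilinear scale P" for P a b Xs x
    unfolding contr_def by (intro multilinearD(4,5) that)+
  \<comment> \<open>Families of second or first factors that depend linearly on a vector.\<close>
  have fam: "lin scale (\<lambda>a. (P \<odot> f a) Xs x)"
    if P: "multilinear scale P" and f: "\<And>Xs x. lin scale (\<lambda>a. f a Xs x)" for f Xs x and P :: "'b cochain"
  proof -
    have "f (a + b) = f a + f b" for a b
      unfolding plus_fun_def fun_eq_iff using lin_simps(1)[OF f] by blast
    moreover have "f (scale c a) = cochain_scale scale c (f a)" for c a
      unfolding cochain_scale_def fun_eq_iff
      using lin_simps(2)[OF f] by blast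
    ultimately show ?thesis
      by (simp add: linear_on_def pre_lie_add_right[OF P] pre_lie_scale_right[OF P])
         (simp add: cochain_scale_def)
  qed
  have fam': "lin scale (\<lambda>a. (f a \<odot> Q) Xs x)"
    if f: "\<And>Xs x. lin scale (\<lambda>a. f a Xs x)" for f Xs x and Q :: "'b cochain"
  proof -
    have "f (a + b) = f a + f b" for a b
      unfolding plus_fun_def fun_eq_iff using lin_simps(1)[OF f] by blast
    moreover have "f (scale c a) = cochain_scale scale c (f a)" for c a
      unfolding cochain_scale_def fun_eq_iff
      using lin_simps(2)[OF f] by blast
    ultimately show ?thesis
      by (simp add: linear_on_def pre_lie_add_left pre_lie_scale_left)
         (simp add: cochain_scale_def)
  qed
  have "lin scale ((P \<odot> Q) Xs)" for Xs
    using P Q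
  proof (induction Xs arbitrary: P Q)
    case Nil
    show ?case unfolding pre_lie_Nil[abs_def]
      by (intro lin_comp[OF multilinearD(1)[OF Nil(1)] multilinearD(1)[OF Nil(2)]])
  next
    case (Cons X Xs)
    show ?case
      unfolding pre_lie_Cons[abs_def]
      by (intro lin_intros(2) Cons.IH multilinear_contr multilinear_twist Cons.prems
          multilinearD(1)[OF Cons.prems(1)])
  qed
  moreover have "lin scale (\<lambda>a. (P \<odot> Q) (As @ (a, b) # Bs) x)" for As b Bs x
    using P Q
  proof (induction As arbitrary: P Q)
    case Nil
    show ?case
      unfolding append_Nil pre_lie_Cons fst_conv snd_conv
      by (intro lin_intros(2) fam fam' args Nil multilinearD(4)
          lin_comp[OF multilinearD(4)[OF Nil(1)] multilinearD(1)[OF Nil(2)]])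
  next
    case (Cons X As)
    show ?case
      using multilinearD(2)[OF Cons.prems(1), of "Y # As" for Y]
      unfolding append_Cons pre_lie_Cons
      by (intro lin_intros(2) Cons.IH multilinear_contr multilinear_twist Cons.prems) assumption+
  qed
  moreover have "lin scale (\<lambda>b. (P \<odot> Q) (As @ (a, b) # Bs) x)" for As a Bs x
    using P Q
  proof (induction As arbitrary: P Q)
    case Nil
    show ?case
      unfolding append_Nil pre_lie_Cons fst_conv snd_conv
      by (intro lin_intros(2) fam fam' args Nil multilinearD(5)
          lin_comp[OF multilinearD(5)[OF Nil(1)] multilinearD(1)[OF Nil(2)]])
  next
    case (Cons X As)
    show ?case
      using multilinearD(3)[OF Cons.prems(1), of "Y # As" for Y]
      unfolding append_Cons pre_lie_Cons
      by (intro lin_intros(2) Cons.IH multilinear_contr multilinear_twist Cons.prems) assumption+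
  qed
  ultimately show ?thesis unfolding multilinear_def by blast
qed

end

section \<open>The graded pre-Lie identity\<close>

text \<open>
  All signs depend on degrees modulo \<open>2\<close>.  Parity is flipped by every contraction, whereas the
  degree cannot be lowered below \<open>0\<close>; this makes parity the better invariant for inductions over
  the list of pairs.
\<close>

definition parity :: "nat \<Rightarrow> 'v::ab_group_add cochain \<Rightarrow> bool" where
  "parity n P \<longleftrightarrow> (\<forall>Xs x. odd (length Xs + n) \<longrightarrow> P Xs x = 0)"

lemma parity_contr: "parity n P \<Longrightarrow> parity (Suc n) (contr X P)"
  by (simp add: parity_def contr_def)

lemma twist_parity: "parity n P \<Longrightarrow> twist P = sg n P"
  unfolding parity_def twist_def fun_eq_iff sg_apply by (metis sg_cong sg_simps(3))

definition super_bracket ::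
    "nat \<Rightarrow> nat \<Rightarrow> 'v::ab_group_add cochain \<Rightarrow> 'v cochain \<Rightarrow> 'v cochain" where
  "super_bracket p q P Q = P \<odot> Q - sg (p * q) (Q \<odot> P)"

definition associator ::
    "'v::ab_group_add cochain \<Rightarrow> 'v cochain \<Rightarrow> 'v cochain \<Rightarrow> 'v cochain" where
  "associator P Q R = (P \<odot> Q) \<odot> R - P \<odot> (Q \<odot> R)"

context vector_space
begin

lemma twist_pre_lie:
  assumes "multilinear scale P"
  shows "twist (P \<odot> Q) = twist P \<odot> twist Q"
proof -
  have "sg (length Xs) ((P \<odot> Q) Xs x) = (twist P \<odot> twist Q) Xs x" for Xs x
    using assms
  proof (induction Xs arbitrary: P Q)
    case Nil
    then show ?case by (simp add: pre_lie_Nil)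
  next
    case (Cons X Xs)
    have "(twist P \<odot> contr X (twist Q)) Xs x = - sg (length Xs) ((P \<odot> contr X Q) Xs x)"
      "(contr X (twist P) \<odot> twist (twist Q)) Xs x = - sg (length Xs) ((contr X P \<odot> twist Q) Xs x)"
      using Cons.IH[OF Cons.prems, of "contr X Q"]
        Cons.IH[OF multilinear_contr[OF Cons.prems], of X "twist Q"] Cons.prems
      by (simp_all add: pre_lie_minus_right multilinear_twist pre_lie_minus_left del: twist_simps(4))
    then show ?case
      unfolding pre_lie_Cons by (simp add: sg_add twist_def[of P] sg_apply)
  qed
  then show ?thesis by (simp add: fun_eq_iff twist_def[of "P \<odot> Q"] sg_apply)
qed

lemma pre_lie_sg:
  assumes "multilinear scale P"
  shows "P \<odot> sg n Q = sg n (P \<odot> Q)" "sg n Q \<odot> P = sg n (Q \<odot> P)"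
  using assms by (auto simp: sg_def pre_lie_minus_right pre_lie_minus_left)

lemma multilinear_sg: "multilinear scale P \<Longrightarrow> multilinear scale (sg n P)"
  by (simp add: sg_def multilinear_minus)

lemma associator_sg:
  assumes "multilinear scale P" "multilinear scale Q"
  shows "associator P Q (sg n R) Xs x = sg n (associator P Q R Xs x)"
    "associator P (sg n Q) R Xs x = sg n (associator P Q R Xs x)"
  using assms by (auto simp: associator_def pre_lie_sg multilinear_pre_lie sg_diff sg_def
      pre_lie_minus_right pre_lie_minus_left)

text \<open>
  Both products expand by \<open>contr_pre_lie\<close>.  The terms in which \<open>Q\<close> acts on the result of \<open>R\<close>
  cancel; there remain associators of contractions, which the induction in
  \<open>associator_symmetric\<close> handles, and the terms in which \<open>Q\<close> and \<open>R\<close> act independently of each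
  other.  The last two summands come from the two entries of one pair: the derivation of
  \<open>\<and>\<^sup>2 V\<close> induced by a composition is not the composition of the induced derivations.
\<close>

lemma contr_associator:
  assumes P: "multilinear scale P" and Q: "multilinear scale Q"
  shows "contr (a, b) (associator P Q R) =
    associator P Q (contr (a, b) R) + associator P (contr (a, b) Q) (twist R)
    + associator (contr (a, b) P) (twist Q) (twist R)
    + (act (Q []) (a, b) P \<odot> twist R + act (R []) (a, b) P \<odot> twist Q
    + (contr (R [] a, Q [] b) P + contr (Q [] a, R [] b) P))"
proof -
  have act0: "act ((Q \<odot> R) []) (a, b) P = contr (Q [] (R [] a), b) P + contr (a, Q [] (R [] b)) P"
    by (simp add: act_def pre_lie_Nil)
  have act1: "act (R []) (a, b) (P \<odot> Q) = P \<odot> act (R []) (a, b) Q + act (R []) (a, b) P \<odot> twist Q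
    + (contr (Q [] (R [] a), b) P + contr (R [] a, Q [] b) P
       + (contr (Q [] a, R [] b) P + contr (a, Q [] (R [] b)) P))"
    unfolding act_def[of "R []"] fst_conv snd_conv contr_pre_lie pre_lie_add_left
      pre_lie_add_right[OF P]
    by (simp add: act_def algebra_simps del: plus_fun_apply)
  show ?thesis
    unfolding associator_def contr_simps contr_pre_lie pre_lie_add_left act0 act1
      twist_pre_lie[OF Q] pre_lie_add_right[OF P]
    by (simp add: algebra_simps del: plus_fun_apply)
qed

text \<open>
  The graded right pre-Lie identity.  In \<open>contr_associator\<close> the three associators are exchanged
  with those for \<open>R\<close> and \<open>Q\<close> by induction, and the other terms are visibly symmetric if \<open>Q\<close> or
  \<open>R\<close> is even and vanish if both are odd.
\<close>

lemma associator_symmetric: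
  assumes "multilinear scale P" "multilinear scale Q" "multilinear scale R"
    and "parity q Q" "parity r R"
  shows "associator P Q R = sg (q * r) (associator P R Q)"
proof (intro ext)
  fix Xs x
  from assms show "associator P Q R Xs x = sg (q * r) (associator P R Q) Xs x"
  proof (induction Xs arbitrary: P Q R q r)
    case Nil
    then show ?case by (simp add: associator_def pre_lie_Nil sg_apply)
  next
    case (Cons X Xs)
    obtain a b where X: "X = (a, b)" by (cases X)
    note ml = Cons.prems(1-3) Cons.prems(1-3)[THEN multilinear_contr]
    have tw: "twist Q = sg q Q" "twist R = sg r R" using Cons.prems by (auto intro: twist_parity)
    have z: "odd q \<Longrightarrow> Q [] = 0" "odd r \<Longrightarrow> R [] = 0"
      using Cons.prems(4,5) by (auto simp: parity_def fun_eq_iff)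
    have ih1: "associator P Q (contr X R) Xs x = sg (q * Suc r) (associator P (contr X R) Q Xs x)"
      using Cons.IH[of P Q "contr X R" q "Suc r"] Cons.prems ml parity_contr[OF Cons.prems(4), of X]
        parity_contr[OF Cons.prems(5), of X] by (simp add: sg_apply)
    have ih2: "associator P (contr X Q) R Xs x = sg (Suc q * r) (associator P R (contr X Q) Xs x)"
      using Cons.IH[of P "contr X Q" R "Suc q" r] Cons.prems ml parity_contr[OF Cons.prems(4), of X]
        parity_contr[OF Cons.prems(5), of X] by (simp add: sg_apply)
    have ih3: "associator (contr X P) Q R Xs x = sg (q * r) (associator (contr X P) R Q Xs x)"
      using Cons.IH[of "contr X P" Q R q r] Cons.prems ml by (simp add: sg_apply)
    \<comment> \<open>The terms of the contracted associator that are not associators.\<close>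
    define E where "E Q R = act (Q []) (a, b) P \<odot> twist R + act (R []) (a, b) P \<odot> twist Q
      + (contr (R [] a, Q [] b) P + contr (Q [] a, R [] b) P)" for Q R
    have lz: "contr (0, c) P = 0" "contr (c, 0) P = 0" for c
      using lin_simps(3)[OF multilinearD(4)[OF Cons.prems(1)]]
        lin_simps(3)[OF multilinearD(5)[OF Cons.prems(1)]]
      by (auto simp: contr_def fun_eq_iff)
    have E: "E Q R = sg (q * r) (E R Q)"
    proof (cases "even q \<or> even r")
      case True
      then show ?thesis by (auto simp: E_def sg_def add_ac)
    next
      case False
      then show ?thesis using z by (simp add: E_def act_def lz)
    qed
    have unroll: "associator P Q R (X # Xs) x = associator P Q (contr X R) Xs x
      + associator P (contr X Q) (twist R) Xs x + associator (contr X P) (twist Q) (twist R) Xs x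
      + E Q R Xs x" if "multilinear scale Q" for Q R
      using contr_associator[OF Cons.prems(1) that, of a b R] X
      by (simp add: E_def fun_eq_iff contr_def[of "(a, b)" "associator P Q R"])
    show ?case
      unfolding sg_apply unroll[OF Cons.prems(2)] unroll[OF Cons.prems(3)] E tw
        associator_sg[OF ml(1) multilinear_sg[OF ml(2)]]
        associator_sg[OF ml(1) multilinear_sg[OF ml(3)]]
        associator_sg[OF ml(1) ml(5)] associator_sg[OF ml(1) ml(6)]
        associator_sg[OF ml(4) multilinear_sg[OF ml(2)]] associator_sg[OF ml(4) ml(2)]
        associator_sg[OF ml(4) multilinear_sg[OF ml(3)]] associator_sg[OF ml(4) ml(3)]
        ih1 ih2 ih3
      by (cases "even q"; cases "even r") (simp_all add: sg_def)
  qed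
qed

lemma super_bracket_antisymmetric:
  "super_bracket p q P Q = - sg (p * q) (super_bracket q p Q P)"
  by (simp add: super_bracket_def sg_def mult.commute)

text \<open>
  As for every commutator of a pre-Lie product, all associators cancel by their symmetry in the
  last two factors.
\<close>

lemma super_bracket_jacobi:
  assumes F: "multilinear scale F" "parity f F"
    and A: "multilinear scale A" "parity a A"
    and B: "multilinear scale B" "parity b B"
  shows "super_bracket (f + a) b (super_bracket f a F A) B =
    super_bracket f (a + b) F (super_bracket a b A B)
    + sg (a * b) (super_bracket (f + b) a (super_bracket f b F B) A)"
proof -
  note ml = F(1) A(1) B(1)
  have 1: "(F \<odot> A) \<odot> B = F \<odot> (A \<odot> B) + sg (a * b) ((F \<odot> B) \<odot> A - F \<odot> (B \<odot> A))"
    using associator_symmetric[OF F(1) A(1) B(1) A(2) B(2)]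
    by (simp add: associator_def algebra_simps)
  have 2: "(A \<odot> F) \<odot> B = A \<odot> (F \<odot> B) + sg (f * b) ((A \<odot> B) \<odot> F - A \<odot> (B \<odot> F))"
    using associator_symmetric[OF A(1) F(1) B(1) F(2) B(2)]
    by (simp add: associator_def algebra_simps)
  have 3: "(B \<odot> F) \<odot> A = B \<odot> (F \<odot> A) + sg (f * a) ((B \<odot> A) \<odot> F - B \<odot> (A \<odot> F))"
    using associator_symmetric[OF B(1) F(1) A(1) F(2) A(2)]
    by (simp add: associator_def algebra_simps)
  show ?thesis
    unfolding super_bracket_def pre_lie_diff_left
      pre_lie_diff_right[OF F(1)] pre_lie_diff_right[OF A(1)] pre_lie_diff_right[OF B(1)]
      pre_lie_sg[OF F(1)] pre_lie_sg[OF A(1)] pre_lie_sg[OF B(1)]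
      1 2 3
    by (cases "even f"; cases "even a"; cases "even b") (simp_all add: sg_def algebra_simps)
qed

end

section \<open>Closure of the spaces of cochains\<close>

definition supported :: "nat \<Rightarrow> 'v::ab_group_add cochain \<Rightarrow> bool" where
  "supported n P \<longleftrightarrow> (\<forall>Xs x. length Xs \<noteq> n \<longrightarrow> P Xs x = 0)"

text \<open>
  Together the conjuncts give total skew-symmetry in the last pair and the final argument.
\<close>

definition alternating :: "'v::ab_group_add cochain \<Rightarrow> bool" where
  "alternating P \<longleftrightarrow>
     (\<forall>As a b Bs x. P (As @ (b, a) # Bs) x = - P (As @ (a, b) # Bs) x) \<and>
     (\<forall>As a b x. P (As @ [(a, x)]) b = - P (As @ [(a, b)]) x)"

lemma alternatingD:
  assumes "alternating P"
  shows "P (As @ (b, a) # Bs) x = - P (As @ (a, b) # Bs) x"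
    "P (As @ [(a, x)]) b = - P (As @ [(a, b)]) x"
  using assms unfolding alternating_def by blast+

lemma alternatingI:
  assumes "\<And>As a b Bs x. P (As @ (b, a) # Bs) x = - P (As @ (a, b) # Bs) x"
    and "\<And>As a b x. P (As @ [(a, x)]) b = - P (As @ [(a, b)]) x"
  shows "alternating P"
  unfolding alternating_def by (intro conjI allI assms)

lemma alternating_add:
  assumes "alternating P" "alternating Q"
  shows "alternating (P + Q)"
proof (rule alternatingI)
  fix As a b Bs x
  show "(P + Q) (As @ (b, a) # Bs) x = - (P + Q) (As @ (a, b) # Bs) x"
    using alternatingD(1)[OF assms(1), of As b a Bs x] alternatingD(1)[OF assms(2), of As b a Bs x]
    by simp
  show "(P + Q) (As @ [(a, x)]) b = - (P + Q) (As @ [(a, b)]) x"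
    using alternatingD(2)[OF assms(1), of As a x b] alternatingD(2)[OF assms(2), of As a x b]
    by simp
qed

lemma alternating_image:
  assumes "alternating P" "\<And>n v. h n (- v) = - h n v"
  shows "alternating (\<lambda>Xs x. h (length Xs) (P Xs x))"
proof (rule alternatingI)
  fix As a b Bs x
  show "h (length (As @ (b, a) # Bs)) (P (As @ (b, a) # Bs) x) =
      - h (length (As @ (a, b) # Bs)) (P (As @ (a, b) # Bs) x)"
    using alternatingD(1)[OF assms(1), of As b a Bs x] assms(2) by simp
  show "h (length (As @ [(a, x)])) (P (As @ [(a, x)]) b) =
      - h (length (As @ [(a, b)])) (P (As @ [(a, b)]) x)"
    using alternatingD(2)[OF assms(1), of As a x b] assms(2) by simp
qed

lemma alternating_minus: "alternating P \<Longrightarrow> alternating (- P)"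
  using alternating_image[of P "\<lambda>n v. - v"] by (simp add: fun_Compl_def)

lemma alternating_twist:
  assumes "alternating P" shows "alternating (twist P)"
proof -
  have "twist P = (\<lambda>Xs x. sg (length Xs) (P Xs x))" by (simp add: twist_def fun_eq_iff sg_apply)
  then show ?thesis using alternating_image[OF assms, of sg] by simp
qed

lemma alternating_zero: "alternating 0"
  by (rule alternatingI) simp_all

lemma supported_parity: "supported n P \<Longrightarrow> parity n P"
  unfolding supported_def parity_def by (metis even_add)

lemma supported_contr: "supported (Suc n) P \<Longrightarrow> supported n (contr X P)"
  by (simp add: supported_def contr_def)

lemma supported_contr_0: "supported 0 P \<Longrightarrow> contr X P = 0"
  by (simp add: supported_def contr_def fun_eq_iff)

lemma supported_twist: "supported n P \<Longrightarrow> supported n (twist P)"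
  by (simp add: supported_def twist_def sg_apply)

lemma alternating_contr:
  assumes "alternating P" shows "alternating (contr X P)"
  unfolding alternating_def
proof (intro conjI allI)
  fix As a b Bs x
  show "contr X P (As @ (b, a) # Bs) x = - contr X P (As @ (a, b) # Bs) x"
    using alternatingD(1)[OF assms, of "X # As" b a Bs x] by (simp add: contr_def)
  show "contr X P (As @ [(a, x)]) b = - contr X P (As @ [(a, b)]) x"
    using alternatingD(2)[OF assms, of "X # As" a x b] by (simp add: contr_def)
qed

context vector_space
begin

lemma multilinear_if_alternating:
  assumes "\<And>Xs. lin scale (P Xs)" "\<And>As b Bs x. lin scale (\<lambda>a. P (As @ (a, b) # Bs) x)"
    and "alternating P"
  shows "multilinear scale P"
proof -
  have "lin scale (\<lambda>b. P (As @ (a, b) # Bs) x)" for As a Bs x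
    unfolding alternatingD(1)[OF assms(3), of As a _ Bs x] by (intro lin_intros assms(2))
  then show ?thesis using assms(1,2) by (simp add: multilinear_def)
qed

lemma supported_pre_lie:
  assumes "multilinear scale P" "supported p P" "supported q Q"
  shows "supported (p + q) (P \<odot> Q)"
  unfolding supported_def
proof (intro allI impI)
  fix Xs :: "('b \<times> 'b) list" and x assume "length Xs \<noteq> p + q"
  with assms show "(P \<odot> Q) Xs x = 0"
  proof (induction Xs arbitrary: P Q p q)
    case Nil
    then show ?case
      using lin_simps(3)[OF multilinearD(1)[OF Nil.prems(1)]]
      by (auto simp: pre_lie_Nil supported_def)
  next
    case (Cons X Xs)
    note ml = Cons.prems(1)
    have 1: "(P \<odot> contr X Q) Xs x = 0"
    proof (cases q)
      case 0
      then show ?thesis using Cons.prems by (simp add: supported_contr_0 pre_lie_zero_right)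
    next
      case (Suc q')
      then show ?thesis
        using Cons.prems Cons.IH[of P p q' "contr X Q"] supported_contr[of q' Q X] by simp
    qed
    have 2: "(contr X P \<odot> twist Q) Xs x = 0"
    proof (cases p)
      case 0
      then show ?thesis using Cons.prems by (simp add: supported_contr_0)
    next
      case (Suc p')
      then show ?thesis using Cons.prems Cons.IH[of "contr X P" p' q "twist Q"] 
        by (simp add: supported_contr supported_twist multilinear_contr)
    qed
    have 3: "P ((Q [] (fst X), snd X) # Xs) x = 0" "P ((fst X, Q [] (snd X)) # Xs) x = 0"
      using Cons.prems(2,3,4) lin_simps(3)[OF multilinearD(4)[OF ml]] lin_simps(3)[OF multilinearD(5)[OF ml]]
      by (cases q; auto simp: supported_def)+
    show ?case by (simp add: pre_lie_Cons 1 2 3)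
  qed
qed

text \<open>
  For the skew-symmetry in the final argument \<open>x\<close>, with a single pair \<open>(a, b)\<close> left: exchanging
  \<open>b\<close> and \<open>x\<close> turns the insertion of \<open>Q\<close> at \<open>b\<close> into minus the one at \<open>x\<close>, and the other two
  summands are skew by themselves.
\<close>

lemma alternating_pre_lie:
  assumes "multilinear scale P" "multilinear scale Q" "alternating P" "alternating Q"
  shows "alternating (P \<odot> Q)"
proof -
  have "(P \<odot> Q) (As @ (b, a) # Bs) x = - (P \<odot> Q) (As @ (a, b) # Bs) x" for As a b Bs x
    using assms
  proof (induction As arbitrary: P Q)
    case Nil
    have "contr (b, a) R = - contr (a, b) R" if "alternating R" for R :: "'b cochain"
      using alternatingD(1)[OF that, of "[]" b a] unfolding contr_def fun_eq_iff by simp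
    note sw = this[OF Nil(3)] this[OF Nil(4)]
    have "P ((u, v) # Bs) x = - P ((v, u) # Bs) x" for u v
      using alternatingD(1)[OF Nil(3), of "[]" u v Bs x] by simp
    note sw' = this[of "Q [] b"] this[of "b"]
    show ?case
      unfolding append_Nil pre_lie_Cons sw pre_lie_minus_left pre_lie_minus_right[OF Nil(1)]
        fst_conv snd_conv sw' by simp
  next
    case (Cons X As)
    have "P (Y # As @ (b, a) # Bs) x = - P (Y # As @ (a, b) # Bs) x" for Y
      using alternatingD(1)[OF Cons.prems(3), of "Y # As" b a Bs x] by simp
    note sw = this[of "(Q [] (fst X), snd X)"] this[of "(fst X, Q [] (snd X))"]
    show ?case
      unfolding append_Cons pre_lie_Cons sw
        Cons.IH[OF Cons.prems(1) multilinear_contr[OF Cons.prems(2)] Cons.prems(3)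
          alternating_contr[OF Cons.prems(4)]]
        Cons.IH[OF multilinear_contr[OF Cons.prems(1)] multilinear_twist[OF Cons.prems(2)]
          alternating_contr[OF Cons.prems(3)] alternating_twist[OF Cons.prems(4)]]
      by simp
  qed
  moreover have "(P \<odot> Q) (As @ [(a, x)]) b = - (P \<odot> Q) (As @ [(a, b)]) x" for As a b x
    using assms
  proof (induction As arbitrary: P Q)
    case Nil
    have swP: "P [(u, v)] w = - P [(u, w)] v" for u v w
      using alternatingD(2)[OF Nil(3), of "[]" u v w] by simp
    have "Q [(a, x)] b = - Q [(a, b)] x"
      using alternatingD(2)[OF Nil(4), of "[]" a x b] by simp
    then show ?case
      using swP[of a "Q [] b" x] swP[of a "Q [] x" b] swP[of "Q [] a" x b]
      by (simp add: pre_lie_Cons pre_lie_Nil contr_def lin_simps[OF multilinearD(1)[OF Nil(1)]])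
  next
    case (Cons X As)
    have "P (Y # As @ [(a, x)]) b = - P (Y # As @ [(a, b)]) x" for Y
      using alternatingD(2)[OF Cons.prems(3), of "Y # As" a x b] by simp
    note sw = this[of "(Q [] (fst X), snd X)"] this[of "(fst X, Q [] (snd X))"]
    show ?case
      unfolding append_Cons pre_lie_Cons sw
        Cons.IH[OF Cons.prems(1) multilinear_contr[OF Cons.prems(2)] Cons.prems(3)
          alternating_contr[OF Cons.prems(4)]]
        Cons.IH[OF multilinear_contr[OF Cons.prems(1)] multilinear_twist[OF Cons.prems(2)]
          alternating_contr[OF Cons.prems(3)] alternating_twist[OF Cons.prems(4)]]
      by simp
  qed
  ultimately show ?thesis unfolding alternating_def by blast
qed

lemma cochains_UNIV_iff:
  "P \<in> \<C> scale n \<longleftrightarrow> multilinear scale P \<and> supported n P \<and> alternating P"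
proof
  assume P: "P \<in> \<C> scale n"
  have z: "length Xs \<noteq> n \<Longrightarrow> P Xs x = 0" for Xs x
    by (rule cochains_wrong_length[OF P])
  have l0: "lin scale (\<lambda>x. 0)" by (rule lin_intros)
  have l1: "lin scale (P Xs)" for Xs
  proof (cases "length Xs = n")
    case True then show ?thesis using P by (simp add: cochains_def)
  next
    case False
    then have "P Xs = (\<lambda>x. 0)" using z by blast
    then show ?thesis using l0 by simp
  qed
  have l2: "lin scale (\<lambda>a. P (As @ (a, b) # Bs) x)" for As b Bs x
  proof (cases "length As + Suc (length Bs) = n")
    case True
    have "\<forall>Xs x i b. length Xs = n \<and> i < n \<longrightarrow> lin scale (\<lambda>a. P (Xs[i := (a, b)]) x)"
      using P unfolding cochains_def mem_Collect_eq cochain_domain_UNIV by blast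
    then have "lin scale (\<lambda>a. P ((As @ (b, b) # Bs)[length As := (a, b)]) x)"
      using True by (metis length_append length_Cons less_add_Suc1 add_Suc_right)
    then show ?thesis by simp
  qed (simp add: z l0)
  have a1: "P (As @ (b, a) # Bs) x = - P (As @ (a, b) # Bs) x" for As a b Bs x
  proof (cases "length As + Suc (length Bs) = n")
    case True
    have "\<forall>Xs x i a b. length Xs = n \<and> i < n \<longrightarrow>
        P (Xs[i := (b, a)]) x = - P (Xs[i := (a, b)]) x"
      using P unfolding cochains_def mem_Collect_eq cochain_domain_UNIV by blast
    then have "P ((As @ (b, b) # Bs)[length As := (b, a)]) x =
        - P ((As @ (b, b) # Bs)[length As := (a, b)]) x"
      using True by (metis length_append length_Cons less_add_Suc1 add_Suc_right)
    then show ?thesis by simp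
  qed (simp add: z)
  have a2: "P (As @ [(a, x)]) b = - P (As @ [(a, b)]) x" for As a b x
  proof (cases "Suc (length As) = n")
    case True
    have "\<forall>Xs a b x. length (Xs @ [(a, b)]) = n \<longrightarrow> P (Xs @ [(a, x)]) b = - P (Xs @ [(a, b)]) x"
      using P unfolding cochains_def mem_Collect_eq cochain_domain_UNIV by blast
    moreover have "length (As @ [(a, b)]) = n" using True by simp
    ultimately show ?thesis by blast
  qed (simp add: z)
  have "alternating P" by (rule alternatingI) (rule a1 a2)+
  then show "multilinear scale P \<and> supported n P \<and> alternating P"
    using multilinear_if_alternating[OF l1 l2] z by (simp add: supported_def)
next
  assume asm: "multilinear scale P \<and> supported n P \<and> alternating P"
  have upd: "Xs[i := X] = take i Xs @ X # drop (Suc i) Xs" if "i < length Xs" for Xs i X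
    using that by (rule upd_conv_take_nth_drop)
  show "P \<in> \<C> scale n"
    unfolding cochains_def mem_Collect_eq cochain_domain_UNIV
  proof (intro conjI allI impI ballI)
    fix Xs :: "('b \<times> 'b) list" and x a b :: 'b and i
    show "P Xs x \<in> UNIV" by simp
    show "length Xs \<noteq> n \<Longrightarrow> P Xs x = 0" using asm by (simp add: supported_def)
    show "lin scale (P Xs)" using asm by (simp add: multilinear_def)
    show "length Xs = n \<and> i < n \<Longrightarrow> lin scale (\<lambda>a. P (Xs[i := (a, b)]) x)"
      using asm by (simp add: multilinear_def upd)
    show "length Xs = n \<and> i < n \<Longrightarrow> P (Xs[i := (b, a)]) x = - P (Xs[i := (a, b)]) x"
      using asm upd[of i Xs] alternatingD(1)[of P "take i Xs" b a "drop (Suc i) Xs" x] by simp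
    show "P (Xs @ [(a, x)]) b = - P (Xs @ [(a, b)]) x"
      using asm alternatingD(2) by blast
  qed
qed

lemma cochains_UNIV_D:
  assumes "P \<in> \<C> scale n"
  shows "multilinear scale P" "supported n P" "alternating P" "parity n P"
  using assms by (auto simp: cochains_UNIV_iff intro: supported_parity)

lemma pre_lie_closed:
  assumes "P \<in> \<C> scale p" "Q \<in> \<C> scale q"
  shows "P \<odot> Q \<in> \<C> scale (p + q)"
  using cochains_UNIV_D[OF assms(1)] cochains_UNIV_D[OF assms(2)]
  by (simp add: cochains_UNIV_iff multilinear_pre_lie supported_pre_lie alternating_pre_lie)

lemma cochains_UNIV_zero: "0 \<in> \<C> scale n"
  by (simp add: cochains_UNIV_iff multilinear_zero supported_def alternating_zero)

lemma cochains_UNIV_add: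
  "P \<in> \<C> scale n \<Longrightarrow> Q \<in> \<C> scale n \<Longrightarrow>
    P + Q \<in> \<C> scale n"
  by (simp add: cochains_UNIV_iff multilinear_add alternating_add supported_def)

lemma cochains_UNIV_minus:
  "P \<in> \<C> scale n \<Longrightarrow> - P \<in> \<C> scale n"
  by (simp add: cochains_UNIV_iff multilinear_minus alternating_minus supported_def)

lemma cochains_UNIV_diff:
  "P \<in> \<C> scale n \<Longrightarrow> Q \<in> \<C> scale n \<Longrightarrow>
    P - Q \<in> \<C> scale n"
  using cochains_UNIV_add[of P n "- Q"] cochains_UNIV_minus[of Q n] by simp

lemma cochains_UNIV_sg:
  "P \<in> \<C> scale n \<Longrightarrow> sg m P \<in> \<C> scale n"
  by (simp add: sg_def cochains_UNIV_minus)

lemma super_bracket_closed: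
  assumes "P \<in> \<C> scale p" "Q \<in> \<C> scale q"
  shows "super_bracket p q P Q \<in> \<C> scale (p + q)"
  unfolding super_bracket_def
  using pre_lie_closed[OF assms] pre_lie_closed[OF assms(2,1)]
  by (intro cochains_UNIV_diff cochains_UNIV_sg) (simp_all add: add.commute)

end

section \<open>Unshuffles and Koszul signs\<close>

text \<open>
  The sum over all ways to split a list into two subsequences, with the Koszul sign of the
  permutation that moves the first subsequence to the front.  Letters enter in their order in
  the list, so a letter that goes to the second part is passed by the letters of \<open>A\<close>.
\<close>

primrec split_sum ::
    "('b \<Rightarrow> nat) \<Rightarrow> 'b list \<Rightarrow> ('b list \<Rightarrow> 'b list \<Rightarrow> 'a) \<Rightarrow> 'a::ab_group_add" where
  "split_sum d [] = (\<lambda>F. F [] [])"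
| "split_sum d (x # xs) = (\<lambda>F. split_sum d xs (\<lambda>A B. F (x # A) B)
     + split_sum d xs (\<lambda>A B. sg (d x * sum_list (map d A)) (F A (x # B))))"

text \<open>
  The Koszul sign is \<open>-1\<close> to this power; an exponent is additive and makes sense in every
  abelian group through \<open>sg\<close>.
\<close>

definition koszul_exponent :: "nat \<Rightarrow> (nat \<Rightarrow> nat) \<Rightarrow> (nat \<Rightarrow> nat) \<Rightarrow> nat" where
  "koszul_exponent n d \<sigma> =
     (\<Sum>(i, j)\<in>{(i, j). 1 \<le> i \<and> i < j \<and> j \<le> n \<and> \<sigma> j < \<sigma> i}. d (\<sigma> i) * d (\<sigma> j))"

text \<open>
  Unshuffles of \<open>n + 1\<close> letters arise from those of \<open>n\<close> letters by shifting all values up and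
  inserting the value \<open>1\<close> at the position \<open>k + 1\<close>.  The value \<open>1\<close> is the first one of its block, so
  only \<open>k = 0\<close> and \<open>k = i\<close> occur for blocks of lengths \<open>i\<close> and \<open>j\<close>.
\<close>

definition insert_one :: "nat \<Rightarrow> (nat \<Rightarrow> nat) \<Rightarrow> nat \<Rightarrow> nat" where
  "insert_one k \<sigma> m =
     (if m = 0 then 0 else if m \<le> k then Suc (\<sigma> m) else if m = Suc k then 1 else Suc (\<sigma> (m - 1)))"

lemma finite_inversions: "finite {(i, j). 1 \<le> i \<and> i < j \<and> j \<le> (n::nat) \<and> \<sigma> j < (\<sigma> i::nat)}"
  by (rule finite_subset[of _ "{..n} \<times> {..n}"]) auto

lemma koszul_exponent_0: "koszul_exponent 0 d \<sigma> = 0"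
  unfolding koszul_exponent_def by (rule sum.neutral) auto

lemma koszul_exponent_cong:
  assumes "\<sigma> permutes {1..n}" "\<And>i. i \<in> {1..n} \<Longrightarrow> d i = d' i"
  shows "koszul_exponent n d \<sigma> = koszul_exponent n d' \<sigma>"
  unfolding koszul_exponent_def
proof (rule sum.cong[OF refl])
  fix p assume "p \<in> {(i, j). 1 \<le> i \<and> i < j \<and> j \<le> n \<and> \<sigma> j < \<sigma> i}"
  then obtain i j where p: "p = (i, j)" "i \<in> {1..n}" "j \<in> {1..n}" by auto
  then have "\<sigma> i \<in> {1..n}" "\<sigma> j \<in> {1..n}" using permutes_in_image[OF assms(1)] by blast+
  then show "(case p of (i, j) \<Rightarrow> d (\<sigma> i) * d (\<sigma> j)) = (case p of (i, j) \<Rightarrow> d' (\<sigma> i) * d' (\<sigma> j))"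
    by (simp add: p assms(2))
qed

text \<open>
  The new inversions are the pairs of the value \<open>1\<close> with the \<open>k\<close> values in front of it.
\<close>

lemma koszul_exponent_insert_one:
  assumes \<sigma>: "\<sigma> permutes {1..n}" and k: "k \<le> n"
  shows "koszul_exponent (Suc n) d (insert_one k \<sigma>) =
    koszul_exponent n (d \<circ> Suc) \<sigma> + d 1 * (\<Sum>m\<leftarrow>[1..<k + 1]. d (Suc (\<sigma> m)))"
proof -
  \<comment> \<open>The position that an old position gets after the insertion.\<close>
  define e where "e m = (if m \<le> k then m else Suc m)" for m
  let ?I = "{(i, j). 1 \<le> i \<and> i < j \<and> j \<le> n \<and> \<sigma> j < \<sigma> i}"
  let ?J = "{(i, j). 1 \<le> i \<and> i < j \<and> j \<le> Suc n \<and> insert_one k \<sigma> j < insert_one k \<sigma> i}"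
  have pos: "1 \<le> m \<Longrightarrow> m \<le> n \<Longrightarrow> 1 \<le> \<sigma> m" for m
    using permutes_in_image[OF \<sigma>, of m] by simp
  have ie: "insert_one k \<sigma> (e m) = Suc (\<sigma> m)" if "1 \<le> m" for m
    using that by (auto simp: insert_one_def e_def)
  have e_less: "e i < e j \<longleftrightarrow> i < j" for i j by (auto simp: e_def)
  have inj: "inj_on (map_prod e e) ?I"
    by (intro inj_onI) (auto simp: e_def split: if_splits)
  have J: "?J = map_prod e e ` ?I \<union> (\<lambda>m. (m, Suc k)) ` {1..k}"
  proof (intro equalityI subsetI)
    fix p assume "p \<in> ?J"
    then obtain i j where p: "p = (i, j)" and ij: "1 \<le> i" "i < j" "j \<le> Suc n"
      "insert_one k \<sigma> j < insert_one k \<sigma> i" by auto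
    have "i \<noteq> Suc k" using ij by (auto simp: insert_one_def split: if_splits)
    show "p \<in> map_prod e e ` ?I \<union> (\<lambda>m. (m, Suc k)) ` {1..k}"
    proof (cases "j = Suc k")
      case True
      then show ?thesis using p ij by auto
    next
      case False
      define i' j' where "i' = (if i \<le> k then i else i - 1)" and "j' = (if j \<le> k then j else j - 1)"
      have eq: "i = e i'" "j = e j'" and ge: "1 \<le> i'" "1 \<le> j'" "j' \<le> n"
        using False \<open>i \<noteq> Suc k\<close> ij k by (auto simp: i'_def j'_def e_def)
      have "i' < j'" "\<sigma> j' < \<sigma> i'"
        using ij ie ge eq e_less by auto
      then have "(i', j') \<in> ?I" using ge by auto
      then show ?thesis using p eq by (intro UnI1 image_eqI[of _ _ "(i', j')"]) auto
    qed
  next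
    fix p assume p: "p \<in> map_prod e e ` ?I \<union> (\<lambda>m. (m, Suc k)) ` {1..k}"
    show "p \<in> ?J"
    proof (cases "p \<in> (\<lambda>m. (m, Suc k)) ` {1..k}")
      case True
      then show ?thesis using k pos by (force simp: insert_one_def)
    next
      case False
      with p obtain i j where "p = (e i, e j)" "1 \<le> i" "i < j" "j \<le> n" "\<sigma> j < \<sigma> i" by auto
      moreover then have "e j \<le> Suc n" "1 \<le> e i" "1 \<le> j" by (auto simp: e_def)
      ultimately show ?thesis using e_less ie by simp
    qed
  qed
  have disj: "map_prod e e ` ?I \<inter> (\<lambda>m. (m, Suc k)) ` {1..k} = {}"
    by (auto simp: e_def split: if_splits)
  let ?f = "\<lambda>(i, j). d (insert_one k \<sigma> i) * d (insert_one k \<sigma> j)"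
  have "koszul_exponent (Suc n) d (insert_one k \<sigma>) =
      sum ?f (map_prod e e ` ?I) + sum ?f ((\<lambda>m. (m, Suc k)) ` {1..k})"
    unfolding koszul_exponent_def J
    by (rule sum.union_disjoint) (use disj finite_inversions in auto)
  also have "sum ?f (map_prod e e ` ?I) = koszul_exponent n (d \<circ> Suc) \<sigma>"
    unfolding koszul_exponent_def sum.reindex[OF inj]
    by (intro sum.cong) (auto simp: ie)
  also have "sum ?f ((\<lambda>m. (m, Suc k)) ` {1..k}) = (\<Sum>m\<in>{1..k}. d (Suc (\<sigma> m)) * d 1)"
    by (subst sum.reindex) (auto simp: inj_on_def insert_one_def)
  also have "\<dots> = d 1 * (\<Sum>m\<leftarrow>[1..<k + 1]. d (Suc (\<sigma> m)))"
    by (simp add: sum_list_distinct_conv_sum_set sum_distrib_left mult.commute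
        atLeastLessThanSuc_atLeastAtMost del: upt_Suc)
  finally show ?thesis .
qed

lemma insert_one_permutes:
  assumes \<sigma>: "\<sigma> permutes {1..n}" and k: "k \<le> n"
  shows "insert_one k \<sigma> permutes {1..Suc n}"
proof (rule inj_imp_permutes)
  define r where "r m = (if m \<le> k then m else m - 1)" for m
  have pos: "\<sigma> m \<in> {1..n}" if "m \<in> {1..n}" for m
    using permutes_in_image[OF \<sigma>] that by blast
  have inj: "\<sigma> a = \<sigma> b \<Longrightarrow> a = b" for a b using permutes_inj[OF \<sigma>] by (auto dest: injD)
  have special: "insert_one k \<sigma> (Suc k) = 1" by (simp add: insert_one_def)
  have other: "insert_one k \<sigma> m = Suc (\<sigma> (r m))" "r m \<in> {1..n}"
    if "m \<in> {1..Suc n}" "m \<noteq> Suc k" for m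
    using that k by (auto simp: insert_one_def r_def)
  have r_inj: "a = b" if "r a = r b" "a \<noteq> Suc k" "b \<noteq> Suc k" for a b
    using that by (simp add: r_def split: if_splits)
  show "inj_on (insert_one k \<sigma>) {1..Suc n}"
  proof (rule inj_onI)
    fix a b assume ab: "a \<in> {1..Suc n}" "b \<in> {1..Suc n}" "insert_one k \<sigma> a = insert_one k \<sigma> b"
    show "a = b"
    proof (cases "a = Suc k \<or> b = Suc k")
      case True
      then show ?thesis using ab other[of a] other[of b] special pos[of "r a"] pos[of "r b"]
        by (cases "a = Suc k"; cases "b = Suc k") simp_all
    next
      case False
      then have "\<sigma> (r a) = \<sigma> (r b)" using ab other(1)[of a] other(1)[of b] by simp
      then show ?thesis using inj[of "r a" "r b"] r_inj[of a b] False by simp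
    qed
  qed
  show "insert_one k \<sigma> m \<in> {1..Suc n}" if "m \<in> {1..Suc n}" for m
    using other[OF that] special pos[of "r m"] by (cases "m = Suc k") auto
  show "insert_one k \<sigma> m = m" if "m \<notin> {1..Suc n}" for m
  proof (cases "m = 0")
    case False
    then have "m > Suc n" using that by simp
    then have "m - 1 \<notin> {1..n}" by auto
    with \<open>m > Suc n\<close> show ?thesis using k permutes_not_in[OF \<sigma>, of "m - 1"] by (simp add: insert_one_def)
  qed (simp add: insert_one_def)
qed simp

lemma insert_one_inj:
  assumes "\<sigma> permutes {1..n}" "\<tau> permutes {1..n}" "insert_one k \<sigma> = insert_one k \<tau>"
  shows "\<sigma> = \<tau>"
proof
  fix m
  consider "m = 0" | "1 \<le> m" "m \<le> k" | "1 \<le> m" "k < m" by linarith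
  then show "\<sigma> m = \<tau> m"
  proof cases
    case 1
    then show ?thesis using permutes_not_in[OF assms(1), of 0] permutes_not_in[OF assms(2), of 0] by simp
  next
    case 2
    then show ?thesis using fun_cong[OF assms(3), of m] by (simp add: insert_one_def)
  next
    case 3
    then show ?thesis using fun_cong[OF assms(3), of "Suc m"] by (simp add: insert_one_def)
  qed
qed

lemma delete_one:
  assumes \<sigma>: "\<sigma> permutes {1..Suc n}" and k: "k \<le> n" and one: "\<sigma> (Suc k) = 1"
  obtains \<tau> where "\<tau> permutes {1..n}" "\<sigma> = insert_one k \<tau>"
proof
  define e where "e m = (if m \<le> k then m else Suc m)" for m
  define \<tau> where "\<tau> m = (if m = 0 then 0 else \<sigma> (e m) - 1)" for m
  have pos: "\<sigma> m \<in> {1..Suc n} \<longleftrightarrow> m \<in> {1..Suc n}" for m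
    using permutes_in_image[OF \<sigma>] by blast
  have inj: "\<sigma> a = \<sigma> b \<longleftrightarrow> a = b" for a b using permutes_inj[OF \<sigma>] by (auto dest: injD)
  have ge2: "2 \<le> \<sigma> m" if "1 \<le> m" "m \<noteq> Suc k" for m
  proof (cases "m \<le> Suc n")
    case True
    then show ?thesis using pos[of m] inj[of m "Suc k"] one that by auto
  next
    case False
    then show ?thesis using permutes_not_in[OF \<sigma>, of m] that by auto
  qed
  have ge2e: "2 \<le> \<sigma> (e m)" if "1 \<le> m" for m
    using ge2[of "e m"] that by (auto simp: e_def)
  show "\<tau> permutes {1..n}"
  proof (rule inj_imp_permutes)
    show "inj_on \<tau> {1..n}"
    proof (rule inj_onI)
      fix a b assume ab: "a \<in> {1..n}" "b \<in> {1..n}" "\<tau> a = \<tau> b"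
      then have "\<sigma> (e a) = \<sigma> (e b)" using ge2e[of a] ge2e[of b] by (auto simp: \<tau>_def)
      then show "a = b" using inj by (auto simp: e_def split: if_splits)
    qed
    show "\<tau> m \<in> {1..n}" if "m \<in> {1..n}" for m
      using that pos[of "e m"] ge2e[of m] by (auto simp: \<tau>_def e_def)
    show "\<tau> m = m" if "m \<notin> {1..n}" for m
      using that k permutes_not_in[OF \<sigma>, of "Suc m"] by (auto simp: \<tau>_def e_def)
  qed simp
  show "\<sigma> = insert_one k \<tau>"
  proof
    fix m
    show "\<sigma> m = insert_one k \<tau> m"
      using ge2[of m] one permutes_not_in[OF \<sigma>, of 0]
      by (auto simp: insert_one_def \<tau>_def e_def)
  qed
qed

lemma strict_mono_on_shift:
  assumes "\<And>m. m \<in> {a..b} \<Longrightarrow> g (Suc m) = Suc (f m)"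
  shows "strict_mono_on {Suc a..Suc b} g \<longleftrightarrow> strict_mono_on {a..b} (f :: nat \<Rightarrow> nat)"
proof
  assume l: "strict_mono_on {Suc a..Suc b} g"
  show "strict_mono_on {a..b} f"
  proof (rule strict_mono_onI)
    fix i j assume ij: "i \<in> {a..b}" "j \<in> {a..b}" "i < j"
    then show "f i < f j" using strict_mono_onD[OF l, of "Suc i" "Suc j"] assms by auto
  qed
next
  assume r: "strict_mono_on {a..b} f"
  show "strict_mono_on {Suc a..Suc b} g"
  proof (rule strict_mono_onI)
    fix i j assume ij: "i \<in> {Suc a..Suc b}" "j \<in> {Suc a..Suc b}" "i < j"
    then obtain i' j' where "i = Suc i'" "j = Suc j'" by (cases i; cases j) auto
    then show "g i < g j" using strict_mono_onD[OF r, of i' j'] assms[of i'] assms[of j'] ij by simp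
  qed
qed

lemma strict_mono_on_head:
  assumes "\<And>m. m \<in> {Suc a..b} \<Longrightarrow> g a < (g m :: nat)"
  shows "strict_mono_on {a..b} g \<longleftrightarrow> strict_mono_on {Suc a..b} g"
proof
  assume "strict_mono_on {a..b} g"
  then show "strict_mono_on {Suc a..b} g" by (simp add: strict_mono_on_def)
next
  assume r: "strict_mono_on {Suc a..b} g"
  show "strict_mono_on {a..b} g"
  proof (rule strict_mono_onI)
    fix i j assume "i \<in> {a..b}" "j \<in> {a..b}" "i < j"
    then show "g i < g j" using strict_mono_onD[OF r, of i j] assms[of j] by (cases "i = a") auto
  qed
qed

lemma insert_one_unshuffle:
  assumes \<sigma>: "\<sigma> permutes {1..n}" and n: "i + j = n"
  shows "insert_one 0 \<sigma> \<in> unshuffles (Suc i) j \<longleftrightarrow> \<sigma> \<in> unshuffles i j"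
    and "insert_one i \<sigma> \<in> unshuffles i (Suc j) \<longleftrightarrow> \<sigma> \<in> unshuffles i j"
proof -
  have pos: "0 < \<sigma> m" if "1 \<le> m" for m
    using permutes_in_image[OF \<sigma>, of m] permutes_not_in[OF \<sigma>, of m] that by (cases "m \<le> n") auto
  have above: "insert_one k \<sigma> (Suc k) < insert_one k \<sigma> m" if "Suc k < m" for k m
    using that pos[of "m - 1"] by (simp add: insert_one_def)
  have shift: "insert_one k \<sigma> (Suc m) = Suc (\<sigma> m)" if "Suc k \<le> m" for k m
    using that by (simp add: insert_one_def)
  have "strict_mono_on {1..Suc i} (insert_one 0 \<sigma>) \<longleftrightarrow> strict_mono_on {1..i} \<sigma>"
    using strict_mono_on_head[of 1 "Suc i" "insert_one 0 \<sigma>"] above[of 0]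
      strict_mono_on_shift[of 1 i "insert_one 0 \<sigma>" \<sigma>] shift[of 0] by simp
  moreover have "strict_mono_on {Suc i + 1..Suc i + j} (insert_one 0 \<sigma>) \<longleftrightarrow> strict_mono_on {i + 1..i + j} \<sigma>"
    using strict_mono_on_shift[of "i + 1" "i + j" "insert_one 0 \<sigma>" \<sigma>] shift[of 0] by simp
  moreover have "strict_mono_on {1..i} (insert_one i \<sigma>) \<longleftrightarrow> strict_mono_on {1..i} \<sigma>"
    by (auto simp: strict_mono_on_def insert_one_def)
  moreover have "strict_mono_on {i + 1..i + Suc j} (insert_one i \<sigma>) \<longleftrightarrow> strict_mono_on {i + 1..i + j} \<sigma>"
    using strict_mono_on_head[of "i + 1" "i + Suc j" "insert_one i \<sigma>"] above[of i]
      strict_mono_on_shift[of "i + 1" "i + j" "insert_one i \<sigma>" \<sigma>] shift[of i] by simp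
  ultimately show "insert_one 0 \<sigma> \<in> unshuffles (Suc i) j \<longleftrightarrow> \<sigma> \<in> unshuffles i j"
    and "insert_one i \<sigma> \<in> unshuffles i (Suc j) \<longleftrightarrow> \<sigma> \<in> unshuffles i j"
    using insert_one_permutes[OF \<sigma>, of 0] insert_one_permutes[OF \<sigma>, of i] \<sigma> n
    by (auto simp: unshuffles_def)
qed

lemma unshuffles_rec:
  assumes "i + j = Suc n"
  shows "unshuffles i j =
    (if i = 0 then {} else insert_one 0 ` unshuffles (i - 1) j) \<union>
    (if j = 0 then {} else insert_one i ` unshuffles i (j - 1))" (is "_ = ?R")
proof (intro equalityI subsetI)
  fix \<sigma> assume \<sigma>u: "\<sigma> \<in> unshuffles i j"
  then have \<sigma>: "\<sigma> permutes {1..Suc n}"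
    and m1: "strict_mono_on {1..i} \<sigma>" and m2: "strict_mono_on {i + 1..i + j} \<sigma>"
    using assms by (auto simp: unshuffles_def)
  define m where "m = inv \<sigma> 1"
  have m: "\<sigma> m = 1" using permutes_inverses(1)[OF \<sigma>] by (simp add: m_def)
  have mr: "m \<in> {1..Suc n}" using permutes_in_image[OF \<sigma>, of m] m by simp
  have pos: "\<sigma> a \<ge> 1" if "a \<in> {1..Suc n}" for a using permutes_in_image[OF \<sigma>, of a] that by simp
  show "\<sigma> \<in> ?R"
  proof (cases "m \<le> i")
    case True
    have "m = 1"
    proof (rule ccontr)
      assume "m \<noteq> 1"
      then have "\<sigma> 1 < \<sigma> m" using strict_mono_onD[OF m1, of 1 m] mr True by auto
      then show False using m pos[of 1] by simp
    qed
    obtain \<tau> where \<tau>: "\<tau> permutes {1..n}" "\<sigma> = insert_one 0 \<tau>"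
      using delete_one[OF \<sigma>, of 0] m \<open>m = 1\<close> by auto
    have i: "i = Suc (i - 1)" using True mr by auto
    then have "\<tau> \<in> unshuffles (i - 1) j"
      using insert_one_unshuffle(1)[OF \<tau>(1), of "i - 1" j] assms \<sigma>u \<tau>(2) by simp
    then show ?thesis using \<tau>(2) i by auto
  next
    case False
    have "m = Suc i"
    proof (rule ccontr)
      assume "m \<noteq> Suc i"
      then have "\<sigma> (Suc i) < \<sigma> m" using strict_mono_onD[OF m2, of "Suc i" m] mr False assms by auto
      then show False using m pos[of "Suc i"] mr False by simp
    qed
    then have ij: "i \<le> n" "j = Suc (j - 1)" using mr assms by auto
    obtain \<tau> where \<tau>: "\<tau> permutes {1..n}" "\<sigma> = insert_one i \<tau>"
      using delete_one[OF \<sigma> ij(1)] m \<open>m = Suc i\<close> by auto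
    have "\<tau> \<in> unshuffles i (j - 1)"
      using insert_one_unshuffle(2)[OF \<tau>(1), of i "j - 1"] assms \<sigma>u \<tau>(2) ij by simp
    then show ?thesis using \<tau>(2) ij by auto
  qed
next
  fix \<sigma> assume "\<sigma> \<in> ?R"
  then consider \<tau> where "i \<noteq> 0" "\<tau> \<in> unshuffles (i - 1) j" "\<sigma> = insert_one 0 \<tau>"
    | \<tau> where "j \<noteq> 0" "\<tau> \<in> unshuffles i (j - 1)" "\<sigma> = insert_one i \<tau>"
    by (auto split: if_splits)
  then show "\<sigma> \<in> unshuffles i j"
  proof cases
    case 1
    then have "\<tau> permutes {1..n}" using assms by (auto simp: unshuffles_def)
    then show ?thesis using insert_one_unshuffle(1)[of \<tau> n "i - 1" j] 1 assms by auto
  next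
    case 2
    then have "\<tau> permutes {1..n}" using assms by (auto simp: unshuffles_def)
    then show ?thesis using insert_one_unshuffle(2)[of \<tau> n i "j - 1"] 2 assms by auto
  qed
qed

lemma unshuffles_permutes: "\<sigma> \<in> unshuffles i j \<Longrightarrow> \<sigma> permutes {1..i + j}"
  by (simp add: unshuffles_def)

lemma finite_unshuffles: "finite (unshuffles i j)"
  by (rule finite_subset[OF _ finite_permutations[of "{1..i + j}"]]) (auto simp: unshuffles_def)

lemma unshuffles_0_0: "unshuffles 0 0 = {id}"
  by (auto simp: unshuffles_def)

lemma sum_unshuffles_rec:
  fixes f :: "(nat \<Rightarrow> nat) \<Rightarrow> 'a::comm_monoid_add"
  assumes "i + j = Suc n"
  shows "(\<Sum>\<sigma>\<in>unshuffles i j. f \<sigma>) =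
    (if i = 0 then 0 else \<Sum>\<sigma>\<in>unshuffles (i - 1) j. f (insert_one 0 \<sigma>)) +
    (if j = 0 then 0 else \<Sum>\<sigma>\<in>unshuffles i (j - 1). f (insert_one i \<sigma>))"
proof -
  let ?A = "if i = 0 then {} else insert_one 0 ` unshuffles (i - 1) j"
  let ?B = "if j = 0 then {} else insert_one i ` unshuffles i (j - 1)"
  have "?A \<inter> ?B = {}"
  proof -
    have False if "insert_one 0 \<sigma> = insert_one i \<tau>" "i \<noteq> 0" "\<tau> \<in> unshuffles i (j - 1)" for \<sigma> \<tau>
      using fun_cong[OF that(1), of 1] that(2) permutes_in_image[OF unshuffles_permutes[OF that(3)], of 1]
      by (simp add: insert_one_def)
    then show ?thesis by (auto split: if_splits)
  qed
  then have "(\<Sum>\<sigma>\<in>unshuffles i j. f \<sigma>) = sum f ?A + sum f ?B"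
    unfolding unshuffles_rec[OF assms] by (intro sum.union_disjoint) (auto simp: finite_unshuffles)
  also have "sum f ?A = (if i = 0 then 0 else \<Sum>\<sigma>\<in>unshuffles (i - 1) j. f (insert_one 0 \<sigma>))"
    using insert_one_inj[OF unshuffles_permutes unshuffles_permutes]
    by (auto simp: sum.reindex inj_on_def)
  also have "sum f ?B = (if j = 0 then 0 else \<Sum>\<sigma>\<in>unshuffles i (j - 1). f (insert_one i \<sigma>))"
    using insert_one_inj[OF unshuffles_permutes unshuffles_permutes]
    by (auto simp: sum.reindex inj_on_def)
  finally show ?thesis .
qed

text \<open>
  For \<open>k = 0\<close> the permutation is merely transported along the shift; moving the value \<open>1\<close> one
  position further to the right is a composition with a transposition.
\<close>

lemma sign_insert_one:
  assumes \<sigma>: "\<sigma> permutes {1..n}" and "k \<le> n"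
  shows "sign (insert_one k \<sigma>) = (-1) ^ k * sign \<sigma>"
  using assms(2)
proof (induction k)
  case 0
  have "insert_one 0 \<sigma> m = map_permutation {1..n} Suc \<sigma> m" for m
  proof (cases "m \<in> Suc ` {1..n}")
    case True
    then obtain a where "m = Suc a" "a \<in> {1..n}" by blast
    then show ?thesis by (simp add: map_permutation_def restrict_id_def insert_one_def)
  next
    case False
    then have "m = 0 \<or> m = 1 \<or> m > Suc n" by (cases m) (auto simp: image_iff)
    moreover have "\<sigma> (m - 1) = m - 1" if "m > Suc n"
      by (rule permutes_not_in[OF \<sigma>]) (use that in auto)
    ultimately show ?thesis using False
      by (auto simp: map_permutation_def restrict_id_def insert_one_def)
  qed
  then have "insert_one 0 \<sigma> = map_permutation {1..n} Suc \<sigma>" by blast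
  then show ?case using sign_map_permutation[of Suc "{1..n}" \<sigma>] \<sigma> by simp
next
  case (Suc k)
  have "insert_one (Suc k) \<sigma> = insert_one k \<sigma> \<circ> Transposition.transpose (Suc k) (Suc (Suc k))"
    by (rule ext) (auto simp: insert_one_def Transposition.transpose_def)
  moreover have "permutation (insert_one k \<sigma>)"
    using insert_one_permutes[OF \<sigma>, of k] Suc by (auto intro: permutes_imp_permutation)
  ultimately have "sign (insert_one (Suc k) \<sigma>) = - sign (insert_one k \<sigma>)"
    by (simp only: sign_compose permutation_swap_id sign_swap_id) simp
  then show ?case using Suc by simp
qed

lemma sign_unshuffle:
  "\<sigma> \<in> unshuffles i j \<Longrightarrow> sign \<sigma> = (-1) ^ koszul_exponent (i + j) (\<lambda>_. 1) \<sigma>"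
proof (induction "i + j" arbitrary: i j \<sigma>)
  case 0
  then show ?case by (simp add: unshuffles_0_0 koszul_exponent_0)
next
  case (Suc n)
  have step: "sign (insert_one k \<tau>) = (-1) ^ koszul_exponent (i + j) (\<lambda>_. 1) (insert_one k \<tau>)"
    if \<tau>: "\<tau> permutes {1..n}" and k: "k \<le> n"
      and IH: "sign \<tau> = (-1) ^ koszul_exponent n (\<lambda>_. 1) \<tau>" for k \<tau>
    using koszul_exponent_insert_one[OF \<tau> k, of "\<lambda>_. 1"] sign_insert_one[OF \<tau> k] IH Suc(2)
    by (simp add: power_add comp_def sum_list_triv mult.commute del: upt_Suc)
  from Suc.prems consider
      \<tau> where "i \<noteq> 0" "\<tau> \<in> unshuffles (i - 1) j" "\<sigma> = insert_one 0 \<tau>"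
    | \<tau> where "j \<noteq> 0" "\<tau> \<in> unshuffles i (j - 1)" "\<sigma> = insert_one i \<tau>"
    unfolding unshuffles_rec[OF Suc.hyps(2)[symmetric]] by (auto split: if_splits)
  then show ?case
  proof cases
    case 1
    then have n: "n = i - 1 + j" using Suc(2) by simp
    show ?thesis
      unfolding 1(3) using step[of \<tau> 0] Suc(1)[OF n 1(2)] unshuffles_permutes[OF 1(2)] n by simp
  next
    case 2
    then have n: "n = i + (j - 1)" using Suc(2) by simp
    show ?thesis
      unfolding 2(3) using step[of \<tau> i] Suc(1)[OF n 2(2)] unshuffles_permutes[OF 2(2)] n by simp
  qed
qed

lemma map_upt_shift: "map f [Suc a..<Suc b] = map (\<lambda>m. f (Suc m)) [a..<b]"
  by (intro nth_equalityI) (simp_all del: upt_Suc)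

lemma split_sum_zero: "split_sum d xs (\<lambda>A B. 0) = 0"
  by (induction xs) auto

lemma split_sum_cong:
  assumes "\<And>A B. length A + length B = length xs \<Longrightarrow> set A \<subseteq> set xs \<Longrightarrow> set B \<subseteq> set xs \<Longrightarrow>
    F A B = G A B"
  shows "split_sum d xs F = split_sum d xs G"
  using assms
proof (induction xs arbitrary: F G)
  case (Cons x xs)
  have "split_sum d xs (\<lambda>A B. F (x # A) B) = split_sum d xs (\<lambda>A B. G (x # A) B)"
    by (rule Cons.IH) (auto intro!: Cons.prems)
  moreover have "split_sum d xs (\<lambda>A B. sg (d x * sum_list (map d A)) (F A (x # B))) =
      split_sum d xs (\<lambda>A B. sg (d x * sum_list (map d A)) (G A (x # B)))"
    by (rule Cons.IH) (auto intro!: Cons.prems arg_cong[of _ _ "sg _"])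
  ultimately show ?case by simp
qed simp

abbreviation slice :: "'b list \<Rightarrow> (nat \<Rightarrow> nat) \<Rightarrow> nat \<Rightarrow> nat \<Rightarrow> 'b list" where
  "slice xs \<sigma> a b \<equiv> map (\<lambda>m. xs ! (\<sigma> m - 1)) [a..<b]"

text \<open>
  Induction over the list: the first letter is the value \<open>1\<close> of the unshuffle, and the two summands
  of \<open>sum_unshuffles_rec\<close> are those in the recursion for \<open>split_sum\<close>.
\<close>

lemma sum_unshuffles_eq_split_sum:
  fixes F :: "'b list \<Rightarrow> 'b list \<Rightarrow> 'a::ab_group_add"
  assumes "length xs = i + j"
  shows "(\<Sum>\<sigma>\<in>unshuffles i j. sg (koszul_exponent (i + j) (\<lambda>m. d (xs ! (m - 1))) \<sigma>)
      (F (slice xs \<sigma> 1 (i + 1)) (slice xs \<sigma> (i + 1) (i + j + 1)))) =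
    split_sum d xs (\<lambda>A B. if length A = i then F A B else 0)"
  using assms
proof (induction xs arbitrary: i j F)
  case Nil
  then show ?case by (simp add: unshuffles_0_0 koszul_exponent_0)
next
  case (Cons y ys)
  let ?n = "length ys"
  have ij: "i + j = Suc ?n" using Cons.prems by simp
  have pos: "\<sigma> m \<ge> 1" if "\<sigma> permutes {1..?n}" "1 \<le> m" for \<sigma> m
    using permutes_in_image[OF that(1), of m] permutes_not_in[OF that(1), of m] that(2)
    by (cases "m \<le> ?n") auto
  let ?t = "\<lambda>\<sigma>. sg (koszul_exponent (i + j) (\<lambda>m. d ((y # ys) ! (m - 1))) \<sigma>)
      (F (slice (y # ys) \<sigma> 1 (i + 1))
         (slice (y # ys) \<sigma> (i + 1) (i + j + 1)))"
  have kos: "koszul_exponent (i + j) (\<lambda>m. d ((y # ys) ! (m - 1))) (insert_one k \<sigma>) =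
      koszul_exponent ?n (\<lambda>m. d (ys ! (m - 1))) \<sigma>
      + d y * sum_list (map d (slice ys \<sigma> 1 (k + 1)))"
    if \<sigma>: "\<sigma> permutes {1..?n}" and k: "k \<le> ?n" for k \<sigma>
  proof -
    have "koszul_exponent ?n ((\<lambda>m. d ((y # ys) ! (m - 1))) \<circ> Suc) \<sigma> =
        koszul_exponent ?n (\<lambda>m. d (ys ! (m - 1))) \<sigma>"
      by (rule koszul_exponent_cong[OF \<sigma>]) (simp add: nth_Cons')
    moreover have "(\<Sum>m\<leftarrow>[1..<k + 1]. d ((y # ys) ! (Suc (\<sigma> m) - 1))) =
        sum_list (map d (slice ys \<sigma> 1 (k + 1)))"
      unfolding map_map
    proof (intro arg_cong[of _ _ sum_list] map_cong refl)
      fix m assume "m \<in> set [1..<k + 1]"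
      then have "1 \<le> \<sigma> m" using pos[OF \<sigma>, of m] by (auto simp del: upt_Suc)
      then show "d ((y # ys) ! (Suc (\<sigma> m) - 1)) = (d \<circ> (\<lambda>m. ys ! (\<sigma> m - 1))) m"
        by (simp add: nth_Cons')
    qed
    ultimately show ?thesis
      unfolding ij koszul_exponent_insert_one[OF \<sigma> k] by simp
  qed
  have 1: "?t (insert_one 0 \<sigma>) = sg (koszul_exponent (i - 1 + j) (\<lambda>m. d (ys ! (m - 1))) \<sigma>)
      (F (y # slice ys \<sigma> 1 (i - 1 + 1))
         (slice ys \<sigma> (i - 1 + 1) (i - 1 + j + 1)))"
    if \<sigma>u: "\<sigma> \<in> unshuffles (i - 1) j" and i: "i \<noteq> 0" for \<sigma>
  proof -
    have n: "?n = i - 1 + j" using ij i by simp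
    have \<sigma>: "\<sigma> permutes {1..?n}" using unshuffles_permutes[OF \<sigma>u] n by simp
    let ?f = "\<lambda>m. (y # ys) ! (insert_one 0 \<sigma> m - 1)"
    have f1: "?f 1 = y" by (simp add: insert_one_def)
    have fS: "?f (Suc m) = ys ! (\<sigma> m - 1)" if "1 \<le> m" for m
      using that pos[OF \<sigma> that] by (simp add: insert_one_def nth_Cons')
    have "[1..<i + 1] = 1 # [Suc 1..<Suc i]" using i by (simp add: upt_conv_Cons del: upt_Suc)
    then have "map ?f [1..<i + 1] = ?f 1 # map ?f [Suc 1..<Suc i]" by (simp only: list.map)
    also have "map ?f [Suc 1..<Suc i] = slice ys \<sigma> 1 i"
      unfolding map_upt_shift by (intro map_cong refl fS) simp
    finally have "map ?f [1..<i + 1] = y # slice ys \<sigma> 1 (i - 1 + 1)"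
      unfolding f1 using i by simp
    moreover have "map ?f [i + 1..<i + j + 1] =
        slice ys \<sigma> (i - 1 + 1) (i - 1 + j + 1)"
    proof -
      have eq: "i - 1 + 1 = i" "i - 1 + j + 1 = i + j" using i by simp_all
      show ?thesis
        unfolding eq unfolding Suc_eq_plus1[symmetric] map_upt_shift
        by (intro map_cong refl fS) (use i in simp)
    qed
    ultimately show ?thesis unfolding kos[OF \<sigma> le0] by (simp add: n del: upt_Suc)
  qed
  have 2: "?t (insert_one i \<sigma>) = sg (koszul_exponent (i + (j - 1)) (\<lambda>m. d (ys ! (m - 1))) \<sigma>)
      (sg (d y * sum_list (map d (slice ys \<sigma> 1 (i + 1))))
        (F (slice ys \<sigma> 1 (i + 1))
           (y # slice ys \<sigma> (i + 1) (i + (j - 1) + 1))))"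
    if \<sigma>u: "\<sigma> \<in> unshuffles i (j - 1)" and j: "j \<noteq> 0" for \<sigma>
  proof -
    have n: "?n = i + (j - 1)" using ij j by simp
    have \<sigma>: "\<sigma> permutes {1..?n}" using unshuffles_permutes[OF \<sigma>u] n by simp
    let ?f = "\<lambda>m. (y # ys) ! (insert_one i \<sigma> m - 1)"
    have f1: "?f (i + 1) = y" by (simp add: insert_one_def)
    have fS: "?f (Suc m) = ys ! (\<sigma> m - 1)" if "i + 1 \<le> m" for m
      using that pos[OF \<sigma>, of m] by (simp add: insert_one_def nth_Cons')
    have fm: "?f m = ys ! (\<sigma> m - 1)" if "1 \<le> m" "m \<le> i" for m
      using that pos[OF \<sigma>, of m] by (simp add: insert_one_def nth_Cons')
    have "map ?f [1..<i + 1] = slice ys \<sigma> 1 (i + 1)"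
      by (intro map_cong refl fm) (auto simp del: upt_Suc)
    moreover have "map ?f [i + 1..<i + j + 1] =
        y # slice ys \<sigma> (i + 1) (i + (j - 1) + 1)"
    proof -
      have "[i + 1..<i + j + 1] = (i + 1) # [Suc (i + 1)..<Suc (i + j)]"
        using j by (simp add: upt_conv_Cons del: upt_Suc)
      then have "map ?f [i + 1..<i + j + 1] = ?f (i + 1) # map ?f [Suc (i + 1)..<Suc (i + j)]"
        by (simp only: list.map)
      also have "map ?f [Suc (i + 1)..<Suc (i + j)] = slice ys \<sigma> (i + 1) (i + j)"
        unfolding map_upt_shift by (intro map_cong refl fS) simp
      finally show ?thesis unfolding f1 using j by simp
    qed
    moreover have "i \<le> ?n" using n by simp
    ultimately show ?thesis unfolding kos[OF \<sigma> \<open>i \<le> ?n\<close>] by (simp only: n sg_simps)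
  qed
  have A: "(if i = 0 then 0 else \<Sum>\<sigma>\<in>unshuffles (i - 1) j. ?t (insert_one 0 \<sigma>)) =
      split_sum d ys (\<lambda>A B. if length (y # A) = i then F (y # A) B else 0)"
  proof (cases "i = 0")
    case False
    have "split_sum d ys (\<lambda>A B. if length (y # A) = i then F (y # A) B else 0) =
        split_sum d ys (\<lambda>A B. if length A = i - 1 then F (y # A) B else 0)"
      using False by (intro split_sum_cong) auto
    then show ?thesis
      using False Cons.IH[of "i - 1" j "\<lambda>A B. F (y # A) B"] ij 1
      by (simp cong: sum.cong del: upt_Suc)
  qed (simp add: split_sum_zero)
  have B: "(if j = 0 then 0 else \<Sum>\<sigma>\<in>unshuffles i (j - 1). ?t (insert_one i \<sigma>)) =
      split_sum d ys (\<lambda>A B. sg (d y * sum_list (map d A)) (if length A = i then F A (y # B) else 0))"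
  proof (cases "j = 0")
    case True
    have "split_sum d ys (\<lambda>A B. sg (d y * sum_list (map d A)) (if length A = i then F A (y # B) else 0))
        = split_sum d ys (\<lambda>A B. 0)"
      using True ij by (intro split_sum_cong) auto
    then show ?thesis using True by (simp add: split_sum_zero)
  next
    case False
    have "split_sum d ys (\<lambda>A B. sg (d y * sum_list (map d A)) (if length A = i then F A (y # B) else 0))
       = split_sum d ys (\<lambda>A B. if length A = i then sg (d y * sum_list (map d A)) (F A (y # B)) else 0)"
      by (intro split_sum_cong) auto
    then show ?thesis
      using False Cons.IH[of i "j - 1" "\<lambda>A B. sg (d y * sum_list (map d A)) (F A (y # B))"] ij 2
      by (simp cong: sum.cong del: upt_Suc sg_simps)
  qed
  show ?case
    unfolding sum_unshuffles_rec[OF ij] A B by simp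
qed

section \<open>The shuffle formula as a pre-Lie product\<close>

lemma split_sum_add:
  "split_sum d xs (\<lambda>A B. F A B + G A B) = split_sum d xs F + split_sum d xs G"
proof (induction xs arbitrary: F G)
  case (Cons x xs)
  show ?case by (simp add: sg_add Cons.IH[symmetric] add_ac)
qed simp

text \<open>
  All letters are odd, and the sign is that of the arrangement in which \<open>B\<close> precedes \<open>A\<close>.  This is
  the sign \<open>(-1)\<^bsup>(k-1)q\<^esup> (-1)\<^sup>\<sigma>\<close> in the formula for \<open>P \<circ> Q\<close>: the \<open>q\<close> arguments of \<open>Q\<close> are moved to
  the front, together with \<open>Q\<close>.
\<close>

definition koszul_sum :: "'b list \<Rightarrow> ('b list \<Rightarrow> 'b list \<Rightarrow> 'a::ab_group_add) \<Rightarrow> 'a" where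
  "koszul_sum Xs F = split_sum (\<lambda>_. 1) Xs (\<lambda>A B. sg (length A * length B) (F A B))"

lemma koszul_sum_Nil: "koszul_sum [] F = F [] []"
  by (simp add: koszul_sum_def)

lemma koszul_sum_Cons:
  "koszul_sum (X # Xs) F =
     koszul_sum Xs (\<lambda>A B. F A (X # B)) + koszul_sum Xs (\<lambda>A B. sg (length B) (F (X # A) B))"
proof -
  have "split_sum (\<lambda>_. 1) Xs (\<lambda>A B. sg (1 * sum_list (map (\<lambda>_. 1) A))
          (sg (length A * length (X # B)) (F A (X # B)))) =
      split_sum (\<lambda>_. 1) Xs (\<lambda>A B. sg (length A * length B) (F A (X # B)))"
    by (intro split_sum_cong) (simp add: sum_list_triv, rule sg_cong, auto)
  moreover have "split_sum (\<lambda>_. 1) Xs (\<lambda>A B. sg (length (X # A) * length B) (F (X # A) B)) =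
      split_sum (\<lambda>_. 1) Xs (\<lambda>A B. sg (length A * length B) (sg (length B) (F (X # A) B)))"
    by (intro split_sum_cong) (simp add: add.commute)
  ultimately show ?thesis by (simp add: koszul_sum_def)
qed

lemma koszul_sum_cong:
  assumes "\<And>A B. length A + length B = length xs \<Longrightarrow> F A B = G A B"
  shows "koszul_sum xs F = koszul_sum xs G"
  unfolding koszul_sum_def by (intro split_sum_cong arg_cong[of _ _ "sg _"] assms)

lemma koszul_sum_zero: "koszul_sum xs (\<lambda>A B. 0) = 0"
  by (simp add: koszul_sum_def split_sum_zero)

context vector_space
begin

text \<open>
  The index \<open>t\<close> is the position of the pair into which \<open>Q\<close> is inserted; the pairs before it are
  distributed to \<open>P\<close> and \<open>Q\<close>, those behind it belong to \<open>P\<close>.  The last summand is the insertion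
  of \<open>Q\<close> into the final argument.
\<close>

lemma pre_lie_unroll:
  assumes "multilinear scale P"
  shows "(P \<odot> Q) Xs x =
    (\<Sum>t<length Xs. koszul_sum (take t Xs) (\<lambda>A B.
       P (A @ (Q B (fst (Xs ! t)), snd (Xs ! t)) # drop (Suc t) Xs) x
       + P (A @ (fst (Xs ! t), Q B (snd (Xs ! t))) # drop (Suc t) Xs) x))
    + koszul_sum Xs (\<lambda>A B. P A (Q B x))"
  using assms
proof (induction Xs arbitrary: P Q)
  case Nil
  then show ?case by (simp add: pre_lie_Nil koszul_sum_Nil)
next
  case (Cons X Xs)
  define T where "T P Q t As = koszul_sum As (\<lambda>A B.
       P (A @ (Q B (fst (Xs ! t)), snd (Xs ! t)) # drop (Suc t) Xs) x
       + P (A @ (fst (Xs ! t), Q B (snd (Xs ! t))) # drop (Suc t) Xs) x)" for P Q :: "'b cochain" and t As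
  have IH: "(P \<odot> Q) Xs x = (\<Sum>t<length Xs. T P Q t (take t Xs)) + koszul_sum Xs (\<lambda>A B. P A (Q B x))"
    if "multilinear scale P" for P Q
    using Cons.IH[OF that] by (simp add: T_def)
  have sgin: "sg n (P (A @ (a, b) # Bs) x) = P (A @ (sg n a, b) # Bs) x"
     "sg n (P (A @ (a, b) # Bs) x) = P (A @ (a, sg n b) # Bs) x"
     "sg n (P A a) = P A (sg n a)" for n A a b Bs
    using lin_simps(6)[OF multilinearD(2)[OF Cons.prems]]
      lin_simps(6)[OF multilinearD(3)[OF Cons.prems]] lin_simps(6)[OF multilinearD(1)[OF Cons.prems]]
    by simp_all
  have step: "koszul_sum (take (Suc t) (X # Xs)) (\<lambda>A B.
       P (A @ (Q B (fst ((X # Xs) ! Suc t)), snd ((X # Xs) ! Suc t)) # drop (Suc (Suc t)) (X # Xs)) x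
       + P (A @ (fst ((X # Xs) ! Suc t), Q B (snd ((X # Xs) ! Suc t))) # drop (Suc (Suc t)) (X # Xs)) x)
     = T P (contr X Q) t (take t Xs) + T (contr X P) (twist Q) t (take t Xs)" for t
    using sgin[of _ "X # A" for A]
    by (simp add: koszul_sum_Cons T_def contr_def twist_def sg_apply sg_add)
  have last: "koszul_sum (X # Xs) (\<lambda>A B. P A (Q B x)) =
      koszul_sum Xs (\<lambda>A B. P A (contr X Q B x)) + koszul_sum Xs (\<lambda>A B. contr X P A (twist Q B x))"
    by (simp add: koszul_sum_Cons contr_def twist_def sg_apply sgin(3))
  show ?case
    unfolding pre_lie_Cons IH[OF Cons.prems] IH[OF multilinear_contr[OF Cons.prems]] last
      list.size(4) add.right_neutral add_Suc_right sum.lessThan_Suc_shift step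
    by (simp add: koszul_sum_Nil sum.distrib add_ac)
qed

lemma scale_sign:
  "scale ((-1) ^ m * of_int ((-1) ^ n)) v = sg (m + n) v"
  by (simp only: of_int_power of_int_minus of_int_1 power_add[symmetric] scale_power_minus_one)

lemma unshuffles_koszul_sum:
  assumes "length Xs = i + q"
  shows "(\<Sum>\<sigma>\<in>unshuffles i q. scale ((-1) ^ (i * q) * of_int (sign \<sigma>))
      (F (slice Xs \<sigma> 1 (i + 1)) (slice Xs \<sigma> (i + 1) (i + q + 1)))) =
    koszul_sum Xs (\<lambda>A B. if length A = i then F A B else 0)"
proof -
  have "koszul_sum Xs (\<lambda>A B. if length A = i then F A B else 0) =
     split_sum (\<lambda>_. 1) Xs (\<lambda>A B. if length A = i then sg (i * q) (F A B) else 0)"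
    unfolding koszul_sum_def using assms by (intro split_sum_cong) auto
  also have "\<dots> = (\<Sum>\<sigma>\<in>unshuffles i q. sg (koszul_exponent (i + q) (\<lambda>_. 1) \<sigma>) (sg (i * q)
      (F (slice Xs \<sigma> 1 (i + 1)) (slice Xs \<sigma> (i + 1) (i + q + 1)))))"
    using sum_unshuffles_eq_split_sum[OF assms, of "\<lambda>_. 1" "\<lambda>A B. sg (i * q) (F A B)"]
    by (simp del: upt_Suc sg_simps)
  also have "\<dots> = (\<Sum>\<sigma>\<in>unshuffles i q. scale ((-1) ^ (i * q) * of_int (sign \<sigma>))
      (F (slice Xs \<sigma> 1 (i + 1)) (slice Xs \<sigma> (i + 1) (i + q + 1))))"
    by (intro sum.cong refl) (simp only: sign_unshuffle scale_sign sg_simps add.commute)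
  finally show ?thesis by simp
qed

text \<open>
  For cochains of fixed degrees, only the positions \<open>t = k - 1 + q\<close> with \<open>1 \<le> k \<le> p\<close> and the
  splittings with \<open>k - 1\<close> and \<open>q\<close> letters contribute to \<open>pre_lie_unroll\<close>.
\<close>

lemma circ_eq_pre_lie:
  assumes ml: "multilinear scale P" and P: "supported p P" and Q: "supported q Q"
    and len: "length Xs = p + q"
  shows "circ scale p q P Q Xs x = (P \<odot> Q) Xs x"
proof -
  have PS: "length As \<noteq> p \<Longrightarrow> P As y = 0" for As y using P by (simp add: supported_def)
  have QS: "length As \<noteq> q \<Longrightarrow> Q As y = 0" for As y using Q by (simp add: supported_def)
  have unit: "(\<Sum>\<sigma>\<in>unshuffles (k - 1) q. scale ((-1) ^ ((k - 1) * q) * of_int (sign \<sigma>))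
        (F (map ((\<lambda>i. Xs ! (i - 1)) \<circ> \<sigma>) [1..<k]) (map ((\<lambda>i. Xs ! (i - 1)) \<circ> \<sigma>) [k..<k + q]))) =
      koszul_sum (take (k - 1 + q) Xs) (\<lambda>A B. if length A = k - 1 then F A B else 0)"
    if k: "k \<in> {1..p + 1}" for k and F :: "('b \<times> 'b) list \<Rightarrow> ('b \<times> 'b) list \<Rightarrow> 'b"
  proof -
    let ?Y = "take (k - 1 + q) Xs"
    have l: "length ?Y = k - 1 + q" using k len by auto
    have *: "map ((\<lambda>i. Xs ! (i - 1)) \<circ> \<sigma>) [a..<b] = slice ?Y \<sigma> a b"
      if "\<sigma> \<in> unshuffles (k - 1) q" "1 \<le> a" "b \<le> k + q" for \<sigma> a b
    proof (intro map_cong refl)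
      fix m assume "m \<in> set [a..<b]"
      then have "m \<in> {1..k - 1 + q}" using that k by auto
      then have "\<sigma> m \<in> {1..k - 1 + q}"
        using permutes_in_image[OF unshuffles_permutes[OF that(1)]] by blast
      then show "((\<lambda>i. Xs ! (i - 1)) \<circ> \<sigma>) m = ?Y ! (\<sigma> m - 1)" by auto
    qed
    have e: "k - 1 + 1 = k" "k - 1 + q + 1 = k + q" using k by auto
    show ?thesis
      unfolding unshuffles_koszul_sum[OF l, of F, unfolded e, symmetric]
      using k by (intro sum.cong refl) (simp only: * le_refl atLeastAtMost_iff le_add1)
  qed
  let ?X = "\<lambda>i. Xs ! (i - 1)"
  let ?G = "\<lambda>t A B. P (A @ (Q B (fst (Xs ! t)), snd (Xs ! t)) # drop (Suc t) Xs) x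
       + P (A @ (fst (Xs ! t), Q B (snd (Xs ! t))) # drop (Suc t) Xs) x"
  let ?S1 = "\<lambda>k. \<Sum>\<sigma>\<in>unshuffles (k - 1) q. scale ((-1) ^ ((k - 1) * q) * of_int (sign \<sigma>))
          (P (map (?X \<circ> \<sigma>) [1..<k]
              @ [(Q (map (?X \<circ> \<sigma>) [k..<k + q]) (fst (?X (k + q))), snd (?X (k + q)))]
              @ map ?X [k + q + 1..<p + q + 1]) x)"
  let ?S2 = "\<lambda>k. \<Sum>\<sigma>\<in>unshuffles (k - 1) q. scale ((-1) ^ ((k - 1) * q) * of_int (sign \<sigma>))
          (P (map (?X \<circ> \<sigma>) [1..<k]
              @ [(fst (?X (k + q)), Q (map (?X \<circ> \<sigma>) [k..<k + q]) (snd (?X (k + q))))]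
              @ map ?X [k + q + 1..<p + q + 1]) x)"
  have summand: "?S1 k + ?S2 k = koszul_sum (take (k - 1 + q) Xs) (?G (k - 1 + q))" if k: "k \<in> {1..p}" for k
  proof -
    have kq: "k + q - 1 = k - 1 + q" "Suc (k - 1 + q) = k + q" using k by auto
    have dr: "map ?X [k + q + 1..<p + q + 1] = drop (Suc (k - 1 + q)) Xs"
      using len k by (intro nth_equalityI) (auto simp del: upt_Suc)
    have "koszul_sum (take (k - 1 + q) Xs) (?G (k - 1 + q)) =
        koszul_sum (take (k - 1 + q) Xs) (\<lambda>A B. if length A = k - 1 then ?G (k - 1 + q) A B else 0)"
    proof (rule koszul_sum_cong)
      fix A B :: "('b \<times> 'b) list" assume "length A + length B = length (take (k - 1 + q) Xs)"
      then show "?G (k - 1 + q) A B = (if length A = k - 1 then ?G (k - 1 + q) A B else 0)"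
      proof (cases "length A = k - 1")
        case False
        then have "length (A @ X # drop (Suc (k - 1 + q)) Xs) \<noteq> p" for X
          using len k by auto
        from PS[OF this] show ?thesis using False by (simp only: if_False add.right_neutral)
      qed simp
    qed
    also have "\<dots> = (\<Sum>\<sigma>\<in>unshuffles (k - 1) q. scale ((-1) ^ ((k - 1) * q) * of_int (sign \<sigma>))
        (?G (k - 1 + q) (map (?X \<circ> \<sigma>) [1..<k]) (map (?X \<circ> \<sigma>) [k..<k + q])))"
      by (rule unit[symmetric]) (use k in auto)
    finally show ?thesis
      unfolding sum.distrib[symmetric] scale_right_distrib[symmetric] dr kq(1) by simp
  qed
  have lastt: "(\<Sum>\<sigma>\<in>unshuffles p q. scale ((-1) ^ (p * q) * of_int (sign \<sigma>))
          (P (map (?X \<circ> \<sigma>) [1..<p + 1]) (Q (map (?X \<circ> \<sigma>) [p + 1..<p + q + 1]) x)))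
     = koszul_sum Xs (\<lambda>A B. P A (Q B x))"
  proof -
    have "koszul_sum Xs (\<lambda>A B. if length A = p then P A (Q B x) else 0) =
        koszul_sum Xs (\<lambda>A B. P A (Q B x))"
      by (rule koszul_sum_cong) (simp add: PS)
    then show ?thesis
      using unit[of "p + 1" "\<lambda>A B. P A (Q B x)"] len by (simp add: add_ac del: upt_Suc)
  qed
  have zero: "koszul_sum (take t Xs) (?G t) = 0" if "t < q" for t
  proof -
    have "koszul_sum (take t Xs) (?G t) = koszul_sum (take t Xs) (\<lambda>A B. 0)"
    proof (rule koszul_sum_cong)
      fix A B :: "('b \<times> 'b) list" assume "length A + length B = length (take t Xs)"
      then have "length B \<noteq> q" using that by auto
      then show "?G t A B = 0"
        by (simp add: QS lin_simps(3)[OF multilinearD(2)[OF ml]] lin_simps(3)[OF multilinearD(3)[OF ml]])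
    qed
    then show ?thesis by (simp add: koszul_sum_zero)
  qed
  have "(\<Sum>t<length Xs. koszul_sum (take t Xs) (?G t)) = (\<Sum>t\<in>{q..<p + q}. koszul_sum (take t Xs) (?G t))"
    using zero len by (intro sum.mono_neutral_right) auto
  also have "\<dots> = (\<Sum>k=1..p. koszul_sum (take (k - 1 + q) Xs) (?G (k - 1 + q)))"
    by (intro sum.reindex_bij_witness[of _ "\<lambda>k. k - 1 + q" "\<lambda>t. t - q + 1"]) auto
  also have "\<dots> = (\<Sum>k=1..p. ?S1 k) + (\<Sum>k=1..p. ?S2 k)"
    unfolding sum.distrib[of ?S1 ?S2, symmetric] by (rule sum.cong[OF refl summand[symmetric]])
  finally show ?thesis
    unfolding pre_lie_unroll[OF ml] circ_def Let_def lastt by (simp only:)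
qed

end

definition degree_part :: "nat \<Rightarrow> 'v::ab_group_add cochain \<Rightarrow> 'v cochain" where
  "degree_part n P = (\<lambda>Xs x. if length Xs = n then P Xs x else 0)"

lemma degree_part_add: "degree_part n (P + Q) = degree_part n P + degree_part n Q"
  by (simp add: degree_part_def fun_eq_iff)

lemma supported_degree_part: "supported n (degree_part n P)"
  by (simp add: supported_def degree_part_def)

context vector_space
begin

lemma degree_part_scale:
  "degree_part n (cochain_scale scale c P) = cochain_scale scale c (degree_part n P)"
  by (simp add: degree_part_def cochain_scale_def fun_eq_iff)

lemma multilinear_degree_part:
  assumes "multilinear scale P"
  shows "multilinear scale (degree_part n P)"
  unfolding multilinear_def
proof (intro conjI allI)
  fix Xs As Bs a b x
  show "lin scale (degree_part n P Xs)"
    using multilinearD(1)[OF assms, of Xs] lin_intros(1)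
    by (cases "length Xs = n") (simp_all add: degree_part_def[abs_def])
  show "lin scale (\<lambda>a. degree_part n P (As @ (a, b) # Bs) x)"
    using multilinearD(2)[OF assms, of As b Bs x] lin_intros(1)
    by (cases "length As + Suc (length Bs) = n") (simp_all add: degree_part_def)
  show "lin scale (\<lambda>b. degree_part n P (As @ (a, b) # Bs) x)"
    using multilinearD(3)[OF assms, of As a Bs x] lin_intros(1)
    by (cases "length As + Suc (length Bs) = n") (simp_all add: degree_part_def)
qed

lemma circ_degree_parts:
  "circ scale p q P Q Xs x = circ scale p q (degree_part p P) (degree_part q Q) Xs x"
proof -
  have Q: "degree_part q Q (map f [k..<k + q]) y = Q (map f [k..<k + q]) y" for f k y
    by (simp add: degree_part_def)
  have Q': "degree_part q Q (map f [p + 1..<p + q + 1]) y = Q (map f [p + 1..<p + q + 1]) y" for f y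
    by (simp add: degree_part_def del: upt_Suc)
  have P: "degree_part p P (map f [1..<k] @ [X] @ map g [k + q + 1..<p + q + 1]) y
      = P (map f [1..<k] @ [X] @ map g [k + q + 1..<p + q + 1]) y"
    if "k \<in> {1..p}" for f g k X y
    using that by (simp add: degree_part_def del: upt_Suc)
  have P': "degree_part p P (map f [1..<p + 1]) y = P (map f [1..<p + 1]) y" for f y
    by (simp add: degree_part_def del: upt_Suc)
  show ?thesis
    unfolding circ_def Let_def Q Q' P'
    by (intro arg_cong2[of _ _ _ _ "(+)"] sum.cong refl arg_cong[of _ _ "scale _"] P[symmetric])
qed

lemma super_bracket_add:
  assumes "multilinear scale P" "multilinear scale Q"
  shows "super_bracket p q (P + P') Q = super_bracket p q P Q + super_bracket p q P' Q"
    and "super_bracket p q P (Q + Q') = super_bracket p q P Q + super_bracket p q P Q'"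
  using assms
  by (simp_all add: super_bracket_def pre_lie_add_left pre_lie_add_right sg_add algebra_simps
      del: plus_fun_apply)

lemma super_bracket_scale:
  assumes "multilinear scale P" "multilinear scale Q"
  shows "super_bracket p q (cochain_scale scale c P) Q = cochain_scale scale c (super_bracket p q P Q)"
    and "super_bracket p q P (cochain_scale scale c Q) = cochain_scale scale c (super_bracket p q P Q)"
  using assms
  unfolding super_bracket_def pre_lie_scale_left pre_lie_scale_right[OF assms(1)]
    pre_lie_scale_right[OF assms(2)]
  by (simp_all add: fun_eq_iff sg_apply cochain_scale_def scale_right_diff_distrib scale_sg)

lemma multilinear_super_bracket:
  "multilinear scale P \<Longrightarrow> multilinear scale Q \<Longrightarrow> multilinear scale (super_bracket p q P Q)"
  unfolding super_bracket_def by (intro multilinear_diff multilinear_sg multilinear_pre_lie)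

text \<open>
  The \<open>L\<^sub>\<infinity>\<close> operations are defined on sums of cochains of different degrees, too; their
  bilinearity there is inherited from \<open>super_bracket\<close> through this formula.
\<close>

lemma gbracket_expand:
  assumes P: "multilinear scale P" and Q: "multilinear scale Q"
  shows "gbracket scale P Q Xs =
    (\<Sum>(p, q)\<in>{(p, q). p + q = length Xs}. super_bracket p q (degree_part p P) (degree_part q Q)) Xs"
proof
  fix x
  have sum_apply: "(\<Sum>i\<in>I. f i) Xs x = (\<Sum>i\<in>I. f i Xs x)"
    for f :: "nat \<times> nat \<Rightarrow> 'b cochain" and I
    by (induction I rule: infinite_finite_induct) simp_all
  show "gbracket scale P Q Xs x =
    (\<Sum>(p, q)\<in>{(p, q). p + q = length Xs}. super_bracket p q (degree_part p P) (degree_part q Q)) Xs x"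
    unfolding gbracket_def sum_apply
  proof (rule sum.cong[OF refl])
    fix z assume "z \<in> {(p, q). p + q = length Xs}"
    then obtain p q where z: "z = (p, q)" "length Xs = p + q" by auto
    have "circ scale p q P Q Xs x = (degree_part p P \<odot> degree_part q Q) Xs x"
      unfolding circ_degree_parts[of p q P Q]
      by (rule circ_eq_pre_lie) (simp_all add: multilinear_degree_part P supported_degree_part z)
    moreover have "circ scale q p Q P Xs x = (degree_part q Q \<odot> degree_part p P) Xs x"
      unfolding circ_degree_parts[of q p Q P]
      by (rule circ_eq_pre_lie) (simp_all add: multilinear_degree_part Q supported_degree_part z)
    ultimately show "(case z of (p, q) \<Rightarrow> circ scale p q P Q Xs x
          - scale ((- 1) ^ (p * q)) (circ scale q p Q P Xs x)) =
        (case z of (p, q) \<Rightarrow> super_bracket p q (degree_part p P) (degree_part q Q)) Xs x"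
      by (simp add: z super_bracket_def sg_apply scale_power_minus_one)
  qed
qed

lemma multilinear_gbracket:
  assumes P: "multilinear scale P" and Q: "multilinear scale Q"
  shows "multilinear scale (gbracket scale P Q)"
proof -
  define R where "R n = (\<Sum>(p, q)\<in>{(p, q). p + q = n}.
    super_bracket p q (degree_part p P) (degree_part q Q))" for n
  have R: "multilinear scale (R n)" for n
    unfolding R_def
    by (rule multilinear_sum) (auto intro!: multilinear_super_bracket multilinear_degree_part P Q)
  have eq: "gbracket scale P Q Xs = R (length Xs) Xs" for Xs
    using gbracket_expand[OF P Q] by (simp add: R_def)
  show ?thesis
    unfolding multilinear_def eq
    using multilinearD(1,2,3)[OF R] by simp
qed

lemma gbracket_add:
  assumes "multilinear scale P" "multilinear scale P'" "multilinear scale Q" "multilinear scale Q'"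
  shows "gbracket scale (P + P') Q = gbracket scale P Q + gbracket scale P' Q"
    and "gbracket scale P (Q + Q') = gbracket scale P Q + gbracket scale P Q'"
  using assms
  by (auto simp: fun_eq_iff[of "gbracket scale _ _"] gbracket_expand multilinear_add
      degree_part_add super_bracket_add multilinear_degree_part split_beta sum.distrib)

lemma gbracket_scale:
  assumes "multilinear scale P" "multilinear scale Q"
  shows "gbracket scale (cochain_scale scale c P) Q = cochain_scale scale c (gbracket scale P Q)"
    and "gbracket scale P (cochain_scale scale c Q) = cochain_scale scale c (gbracket scale P Q)"
proof -
  have sum: "(\<Sum>i\<in>I. cochain_scale scale c (f i)) Xs = cochain_scale scale c (\<Sum>i\<in>I. f i) Xs"
    for f :: "nat \<times> nat \<Rightarrow> 'b cochain" and I Xs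
    by (induction I rule: infinite_finite_induct)
       (simp_all add: cochain_scale_def fun_eq_iff scale_right_distrib)
  have eq: "cochain_scale scale c G Xs = (\<lambda>x. scale c (G Xs x))" for G Xs
    by (simp add: cochain_scale_def)
  show "gbracket scale (cochain_scale scale c P) Q = cochain_scale scale c (gbracket scale P Q)"
    "gbracket scale P (cochain_scale scale c Q) = cochain_scale scale c (gbracket scale P Q)"
    using assms
    by (auto simp: fun_eq_iff[of "gbracket scale _ _"] gbracket_expand multilinear_cochain_scale
        degree_part_scale super_bracket_scale multilinear_degree_part split_beta sum eq)
qed

lemma gbracket_zero:
  assumes "multilinear scale P"
  shows "gbracket scale 0 P = 0" "gbracket scale P 0 = 0"
  using gbracket_add(1)[OF multilinear_zero multilinear_zero assms assms]
    gbracket_add(2)[OF assms assms multilinear_zero multilinear_zero]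
  by simp_all

lemma gbracket_eq_super_bracket:
  assumes P: "P \<in> \<C> scale p" and Q: "Q \<in> \<C> scale q"
  shows "gbracket scale P Q = super_bracket p q P Q"
proof (intro ext)
  fix Xs x
  show "gbracket scale P Q Xs x = super_bracket p q P Q Xs x"
  proof (cases "length Xs = p + q")
    case True
    then show ?thesis
      unfolding gbracket_homogeneous[OF P Q]
      using circ_eq_pre_lie[OF cochains_UNIV_D(1,2)[OF P] cochains_UNIV_D(2)[OF Q] True]
        circ_eq_pre_lie[OF cochains_UNIV_D(1,2)[OF Q] cochains_UNIV_D(2)[OF P], of Xs x]
      by (simp add: super_bracket_def sg_apply scale_power_minus_one add.commute)
  next
    case False
    then show ?thesis
      unfolding gbracket_homogeneous[OF P Q]
      using cochains_wrong_length[OF super_bracket_closed[OF P Q] False] by simp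
  qed
qed

end

section \<open>The grading of the ambient space\<close>

text \<open>
  The ambient space as a graded vector space.  With \<open>g1\<close> above \<open>g2\<close>, lifts are the cochains of
  highest degree.
\<close>

definition piece :: "'v::ab_group_add set \<Rightarrow> 'v set \<Rightarrow> int \<Rightarrow> 'v set" where
  "piece g1 g2 d = (if d = 0 then g2 else if d = 1 then g1 else {0})"

text \<open>
  Lists of pairs with homogeneous entries, with their total degree.  The zero vector lies in every
  piece; admitting the degrees \<open>0\<close> and \<open>1\<close> only keeps total degrees nonnegative.
\<close>

inductive pure :: "'v::ab_group_add set \<Rightarrow> 'v set \<Rightarrow> ('v \<times> 'v) list \<Rightarrow> int \<Rightarrow> bool"
  for g1 g2 where
  pure_Nil: "pure g1 g2 [] 0"
| pure_Cons: "i \<in> {0, 1} \<Longrightarrow> j \<in> {0, 1} \<Longrightarrow> a \<in> piece g1 g2 i \<Longrightarrow> b \<in> piece g1 g2 j \<Longrightarrow>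
    pure g1 g2 Xs n \<Longrightarrow> pure g1 g2 ((a, b) # Xs) (i + j + n)"

definition homogeneous ::
    "'v::ab_group_add set \<Rightarrow> 'v set \<Rightarrow> int \<Rightarrow> 'v cochain \<Rightarrow> bool" where
  "homogeneous g1 g2 e P \<longleftrightarrow> (\<forall>Xs n x. \<forall>d\<in>{0, 1}.
     pure g1 g2 Xs n \<longrightarrow> x \<in> piece g1 g2 d \<longrightarrow> P Xs x \<in> piece g1 g2 (n + d + e))"

text \<open>
  Indexed by the number of arguments of the operation \<open>l\<^sub>k\<close> that is derived from it.
\<close>

definition structure_map ::
    "('v::ab_group_add \<Rightarrow> 'v \<Rightarrow> 'v \<Rightarrow> 'v) \<Rightarrow> 'v set \<Rightarrow> 'v set \<Rightarrow> nat \<Rightarrow> 'v cochain" where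
  "structure_map br g1 g2 k = (if k = 1 then mu2_hat br g1 g2 else if k = 2 then psi_hat br g1 g2
     else if k = 3 then mu1_hat br g1 g2 else 0)"

lemma pure_nonneg: "pure g1 g2 Xs n \<Longrightarrow> 0 \<le> n"
  by (induction rule: pure.induct) auto

lemma homogeneousD:
  "homogeneous g1 g2 e P \<Longrightarrow> pure g1 g2 Xs n \<Longrightarrow> x \<in> piece g1 g2 d \<Longrightarrow> d \<in> {0, 1} \<Longrightarrow>
    P Xs x \<in> piece g1 g2 (n + d + e)"
  unfolding homogeneous_def by blast

context twilled_three_Lie_algebra
begin

abbreviation (input) "\<Omega> k \<equiv> structure_map br g1 g2 k"
abbreviation (input) "\<H> \<equiv> piece g1 g2"
abbreviation (input) "homog \<equiv> homogeneous g1 g2"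
abbreviation (input) "bracket \<equiv> gbracket scale"
abbreviation (input) "p1 \<equiv> component g1 g2"
abbreviation (input) "p2 \<equiv> component g2 g1"

lemma p1_simps: "p1 (a + b) = p1 a + p1 b" "p1 (scale c a) = scale c (p1 a)"
  and p2_simps: "p2 (a + b) = p2 a + p2 b" "p2 (scale c a) = scale c (p2 a)"
proof -
  obtain x u where a: "x \<in> g1" "u \<in> g2" "a = x + u" by (rule decompose)
  obtain y v where b: "y \<in> g1" "v \<in> g2" "b = y + v" by (rule decompose)
  have ab: "a + b = (x + y) + (u + v)" and "x + y \<in> g1" "u + v \<in> g2"
    using a b subspace_add[OF subspace_g1] subspace_add[OF subspace_g2] by (auto simp: add_ac)
  then show "p1 (a + b) = p1 a + p1 b" "p2 (a + b) = p2 a + p2 b"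
    unfolding ab using a b by (simp_all only: component_g1_eq component_g2_eq)
  have "scale c a = scale c x + scale c u" "scale c x \<in> g1" "scale c u \<in> g2"
    using a subspace_scale[OF subspace_g1] subspace_scale[OF subspace_g2]
    by (auto simp: scale_right_distrib)
  then show "p1 (scale c a) = scale c (p1 a)" "p2 (scale c a) = scale c (p2 a)"
    using a by (simp_all add: component_g1_eq component_g2_eq)
qed

lemma lin_p1: "lin scale p1" and lin_p2: "lin scale p2"
  by (simp_all add: linear_on_def p1_simps p2_simps)

lemma p1_in: "p1 a \<in> g1" and p2_in: "p2 a \<in> g2"
proof -
  obtain x u where a: "x \<in> g1" "u \<in> g2" "a = x + u" by (rule decompose)
  show "p1 a \<in> g1" "p2 a \<in> g2" using a by (simp_all add: component_g1_eq component_g2_eq)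
qed

lemma p1_g2: "u \<in> g2 \<Longrightarrow> p1 u = 0" and p2_g1: "x \<in> g1 \<Longrightarrow> p2 x = 0"
  using component_g1_eq[of 0 u] component_g2_eq[of x 0]
  by (simp_all add: subspace_0 subspace_g1 subspace_g2)

lemma piece_simps [simp]: "\<H> 0 = g2" "\<H> 1 = g1"
  by (simp_all add: piece_def)

lemma piece_trivial: "d \<noteq> 0 \<Longrightarrow> d \<noteq> 1 \<Longrightarrow> a \<in> \<H> d \<Longrightarrow> a = 0"
  by (simp add: piece_def)

lemma subspace_piece: "subspace (\<H> d)"
  by (simp add: piece_def subspace_g1 subspace_g2 subspace_single_0)

lemma piece_zero: "0 \<in> \<H> d"
  by (rule subspace_0[OF subspace_piece])

lemma homogeneous_arg:
  assumes "multilinear scale P" "homog e P" "pure g1 g2 Xs n" "x \<in> \<H> d"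
  shows "P Xs x \<in> \<H> (n + d + e)"
proof (cases "d \<in> {0, 1}")
  case False
  then have "x = 0" using piece_trivial assms(4) by blast
  then show ?thesis using lin_simps(3)[OF multilinearD(1)[OF assms(1)]] piece_zero by simp
qed (rule homogeneousD[OF assms(2-4)])

lemma homogeneous_pair:
  assumes P: "multilinear scale P" "homog e P" and Xs: "pure g1 g2 Xs n"
    and "a \<in> \<H> i" "b \<in> \<H> j" "x \<in> \<H> d"
  shows "P ((a, b) # Xs) x \<in> \<H> (i + j + n + d + e)"
proof (cases "i \<in> {0, 1} \<and> j \<in> {0, 1}")
  case True
  then show ?thesis using assms by (intro homogeneous_arg[OF P] pure_Cons) auto
next
  case False
  then have "a = 0 \<or> b = 0" using piece_trivial assms(4,5) by blast
  then have "P ((a, b) # Xs) x = 0"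
    using lin_simps(3)[OF multilinearD(4)[OF P(1)]] lin_simps(3)[OF multilinearD(5)[OF P(1)]] by auto
  then show ?thesis using piece_zero by simp
qed

lemma homogeneous_contr:
  assumes "multilinear scale P" "homog e P" "a \<in> \<H> i" "b \<in> \<H> j"
  shows "homog (i + j + e) (contr (a, b) P)"
  unfolding homogeneous_def contr_def
proof (intro allI ballI impI)
  fix Xs n x d assume "d \<in> {0::int, 1}" "pure g1 g2 Xs n" "x \<in> \<H> d"
  then have "P ((a, b) # Xs) x \<in> \<H> (i + j + n + d + e)"
    using homogeneous_pair[OF assms(1,2) _ assms(3,4)] by blast
  then show "P ((a, b) # Xs) x \<in> \<H> (n + d + (i + j + e))" by (simp add: add_ac)
qed

lemma homogeneous_zero: "homog e 0"
  by (simp add: homogeneous_def piece_zero)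

lemma homogeneous_add:
  "homog e P \<Longrightarrow> homog e Q \<Longrightarrow> homog e (P + Q)"
  by (simp add: homogeneous_def subspace_add[OF subspace_piece])

lemma homogeneous_minus: "homog e P \<Longrightarrow> homog e (- P)"
  by (simp add: homogeneous_def subspace_neg[OF subspace_piece])

lemma homogeneous_sg: "homog e P \<Longrightarrow> homog e (sg n P)"
  by (simp add: sg_def homogeneous_minus)

lemma homogeneous_diff:
  "homog e P \<Longrightarrow> homog e Q \<Longrightarrow> homog e (P - Q)"
  by (simp add: homogeneous_def subspace_diff[OF subspace_piece])

lemma homogeneous_sum:
  "(\<And>i. i \<in> I \<Longrightarrow> homog e (f i)) \<Longrightarrow> homog e (\<Sum>i\<in>I. f i)"
  by (induction I rule: infinite_finite_induct) (simp_all add: homogeneous_zero homogeneous_add)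

lemma homogeneous_twist: "homog e P \<Longrightarrow> homog e (twist P)"
  by (simp add: homogeneous_def twist_def sg_def subspace_neg[OF subspace_piece])

text \<open>
  In the recursion for the product the image \<open>Q [] a\<close> may have a degree other than \<open>0\<close> and \<open>1\<close>;
  then it is zero, and \<open>homogeneous_pair\<close> applies nevertheless.
\<close>

lemma homogeneous_pre_lie:
  assumes "multilinear scale P" "multilinear scale Q"
    and "homog e P" "homog f Q"
  shows "homog (e + f) (P \<odot> Q)"
  unfolding homogeneous_def
proof (intro allI ballI impI)
  fix Xs n x d
  assume d: "d \<in> {0::int, 1}" and "pure g1 g2 Xs n" and x: "x \<in> \<H> d"
  from this(2) assms show "(P \<odot> Q) Xs x \<in> \<H> (n + d + (e + f))"
  proof (induction arbitrary: P Q e f rule: pure.induct)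
    case pure_Nil
    have "Q [] x \<in> \<H> (d + f)"
      using homogeneousD[OF pure_Nil(4) pure.pure_Nil x d] by simp
    from homogeneous_arg[OF pure_Nil(1,3) pure.pure_Nil this]
    show ?case by (simp add: pre_lie_Nil add_ac)
  next
    case (pure_Cons i j a b Xs n)
    note prems = pure_Cons.prems
    have "(P \<odot> contr (a, b) Q) Xs x \<in> \<H> (n + d + (e + (i + j + f)))"
      using pure_Cons by (intro pure_Cons.IH multilinear_contr homogeneous_contr) auto
    moreover have "(contr (a, b) P \<odot> twist Q) Xs x \<in> \<H> (n + d + ((i + j + e) + f))"
      using pure_Cons
      by (intro pure_Cons.IH multilinear_contr multilinear_twist homogeneous_contr homogeneous_twist) auto
    moreover have "Q [] a \<in> \<H> (0 + i + f)" "Q [] b \<in> \<H> (0 + j + f)"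
      by (rule homogeneous_arg[OF prems(2,4) pure.pure_Nil], rule pure_Cons.hyps)+
    then have "P ((Q [] a, b) # Xs) x \<in> \<H> ((0 + i + f) + j + n + d + e)"
      "P ((a, Q [] b) # Xs) x \<in> \<H> (i + (0 + j + f) + n + d + e)"
      using pure_Cons x by (auto intro!: homogeneous_pair[OF prems(1,3)])
    ultimately show ?case
      unfolding pre_lie_Cons fst_conv snd_conv
      by (intro subspace_add[OF subspace_piece]) (simp_all add: add_ac)
  qed
qed

lemma homogeneous_super_bracket:
  assumes "multilinear scale P" "multilinear scale Q"
    and "homog e P" "homog f Q"
  shows "homog (e + f) (super_bracket p q P Q)"
  using homogeneous_pre_lie[OF assms] homogeneous_pre_lie[OF assms(2,1,4,3)]
  by (simp add: super_bracket_def homogeneous_diff homogeneous_sg add.commute)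

text \<open>
  Every entry is the sum of its two components, one entry after the other.
\<close>

lemma zero_if_zero_on_pure:
  assumes "multilinear scale P"
    and "\<And>Xs n x d. pure g1 g2 Xs n \<Longrightarrow> d \<in> {0, 1} \<Longrightarrow> x \<in> \<H> d \<Longrightarrow> P Xs x = 0"
  shows "P = 0"
proof -
  have "P Xs x = 0" for Xs x
    using assms
  proof (induction Xs arbitrary: P)
    case Nil
    have "P [] (p1 x) = 0" "P [] (p2 x) = 0"
      using Nil(2)[OF pure_Nil, of 1] Nil(2)[OF pure_Nil, of 0] p1_in p2_in by simp_all
    then have "P [] (p1 x + p2 x) = 0" by (simp add: lin_simps(1)[OF multilinearD(1)[OF Nil(1)]])
    then show ?case by (simp only: component_sum)
  next
    case (Cons X Xs)
    obtain a b where X: "X = (a, b)" by (cases X)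
    have pieces: "P ((a', b') # Xs) x = 0"
      if "i \<in> {0, 1}" "j \<in> {0, 1}" "a' \<in> \<H> i" "b' \<in> \<H> j" for a' b' i j
    proof -
      have "contr (a', b') P Xs x = 0"
      proof (rule Cons.IH)
        show "multilinear scale (contr (a', b') P)" by (rule multilinear_contr[OF Cons.prems(1)])
        fix Xs n x d assume "pure g1 g2 Xs n" "d \<in> {0::int, 1}" "x \<in> \<H> d"
        then show "contr (a', b') P Xs x = 0"
          unfolding contr_def using that by (intro Cons.prems(2)[OF pure_Cons]) auto
      qed
      then show ?thesis by (simp add: contr_def)
    qed
    have "P ((p1 a + p2 a, p1 b + p2 b) # Xs) x = 0"
      unfolding lin_simps(1)[OF multilinearD(4)[OF Cons.prems(1)]]
        lin_simps(1)[OF multilinearD(5)[OF Cons.prems(1)]]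
      using pieces[of 0 0] pieces[of 0 1] pieces[of 1 0] pieces[of 1 1] p1_in p2_in by simp
    then show ?case by (simp only: component_sum X)
  qed
  then show ?thesis by (simp add: fun_eq_iff)
qed

lemma homogeneous_ge_2_zero:
  assumes "multilinear scale P" "homog e P" "e \<ge> 2"
  shows "P = 0"
proof (rule zero_if_zero_on_pure[OF assms(1)])
  fix Xs n x d assume *: "pure g1 g2 Xs n" "d \<in> {0::int, 1}" "x \<in> \<H> d"
  have "P Xs x \<in> \<H> (n + d + e)"
    by (rule homogeneousD[OF assms(2) *(1,3,2)])
  moreover have "n + d + e \<ge> 2" using pure_nonneg[OF *(1)] * assms(3) by auto
  ultimately show "P Xs x = 0" using piece_trivial[of "n + d + e"] by auto
qed

lemma multilinear_lift:
  assumes "multilinear scale P"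
  shows "multilinear scale (lift g1 g2 P)"
  unfolding multilinear_def lift_def
  using lin_comp[OF multilinearD(1)[OF assms] lin_p2] lin_comp[OF multilinearD(2)[OF assms] lin_p2]
    lin_comp[OF multilinearD(3)[OF assms] lin_p2]
  by simp

lemma zero_if_projected_pure:
  assumes "pure g1 g2 Xs n" "n \<ge> 1" "multilinear scale P"
  shows "P (map (map_prod p2 p2) Xs) x = 0"
  using assms
proof (induction arbitrary: P rule: pure.induct)
  case (pure_Cons i j a b Xs n)
  show ?case
  proof (cases "i = 1 \<or> j = 1")
    case True
    then have "p2 a = 0 \<or> p2 b = 0" using pure_Cons by (auto simp: p2_g1)
    then show ?thesis
      using lin_simps(3)[OF multilinearD(4)[OF pure_Cons.prems(2)]]
        lin_simps(3)[OF multilinearD(5)[OF pure_Cons.prems(2)]] by auto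
  next
    case False
    then have "n \<ge> 1" using pure_Cons by auto
    then show ?thesis
      using pure_Cons.IH[OF _ multilinear_contr[OF pure_Cons.prems(2)], of "(p2 a, p2 b)"]
      by (simp add: contr_def)
  qed
qed simp

lemma pure_0_projected: "pure g1 g2 Xs n \<Longrightarrow> n = 0 \<Longrightarrow> map (map_prod p2 p2) Xs = Xs"
proof (induction rule: pure.induct)
  case (pure_Cons i j a b Xs n)
  then have "i = 0" "j = 0" "n = 0" using pure_nonneg[of g1 g2 Xs n] by auto
  then show ?case using pure_Cons by (simp add: component_g2_self)
qed simp

text \<open>
  An argument from \<open>g1\<close> raises the degree of the value above \<open>1\<close>, where only zero is left; so
  the value depends on the \<open>g2\<close>-components only.
\<close>

lemma homogeneous_1_is_lift:
  assumes "multilinear scale P" "homog 1 P"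
  shows "lift g1 g2 P = P"
proof -
  have "lift g1 g2 P - P = 0"
  proof (rule zero_if_zero_on_pure)
    show "multilinear scale (lift g1 g2 P - P)"
      by (intro multilinear_diff multilinear_lift assms)
    fix Xs n x d assume *: "pure g1 g2 Xs n" "d \<in> {0::int, 1}" "x \<in> \<H> d"
    have P: "P Xs x \<in> \<H> (n + d + 1)"
      by (rule homogeneousD[OF assms(2) *(1,3,2)])
    show "(lift g1 g2 P - P) Xs x = 0"
    proof (cases "n = 0 \<and> d = 0")
      case True
      then show ?thesis using * by (simp add: lift_def pure_0_projected component_g2_self)
    next
      case False
      then have ge: "n + d + 1 \<ge> 2" using pure_nonneg[OF *(1)] * by auto
      then have "P Xs x = 0" using piece_trivial[of "n + d + 1"] P by auto
      moreover have "lift g1 g2 P Xs x = 0"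
      proof (cases "n \<ge> 1")
        case True
        then show ?thesis unfolding lift_def by (intro zero_if_projected_pure[OF *(1) _ assms(1)])
      next
        case False
        then have "d = 1" using ge * by auto
        then show ?thesis using * lin_simps(3)[OF multilinearD(1)[OF assms(1)]]
          by (simp add: lift_def p2_g1)
      qed
      ultimately show ?thesis by simp
    qed
  qed
  then show ?thesis by simp
qed

lemma homogeneous_1_in_g1:
  assumes "multilinear scale P" "homog 1 P"
  shows "P Xs x \<in> g1"
proof -
  have "(\<lambda>Xs x. p2 (P Xs x)) = 0"
  proof (rule zero_if_zero_on_pure)
    show "multilinear scale (\<lambda>Xs x. p2 (P Xs x))"
      unfolding multilinear_def
      using lin_comp[OF lin_p2 multilinearD(1)[OF assms(1)]] lin_comp[OF lin_p2 multilinearD(2)[OF assms(1)]]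
        lin_comp[OF lin_p2 multilinearD(3)[OF assms(1)]]
      by simp
    fix Xs n x d assume *: "pure g1 g2 Xs n" "d \<in> {0::int, 1}" "x \<in> \<H> d"
    have P: "P Xs x \<in> \<H> (n + d + 1)"
      by (rule homogeneousD[OF assms(2) *(1,3,2)])
    have "n + d + 1 \<ge> 1" using pure_nonneg[OF *(1)] * by auto
    then have "P Xs x \<in> g1"
      using P piece_trivial[of "n + d + 1" "P Xs x"] subspace_0[OF subspace_g1]
      by (cases "n + d + 1 = 1") (auto simp del: piece_simps simp: piece_def)
    then show "p2 (P Xs x) = 0" by (rule p2_g1)
  qed
  then have "p2 (P Xs x) = 0" by (simp add: fun_eq_iff)
  then show ?thesis using component_sum[of "P Xs x"] p1_in[of "P Xs x"] by simp
qed

text \<open>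
  On arguments of fixed degrees the values of the \<open>f n\<close> lie in different pieces of a direct sum.
\<close>

lemma homogeneous_sum_zero:
  assumes fin: "finite N"
    and ml: "\<And>n. n \<in> N \<Longrightarrow> multilinear scale (f n)"
    and hom: "\<And>n. n \<in> N \<Longrightarrow> homog (c - int n) (f n)"
    and zero: "(\<Sum>n\<in>N. f n) = 0" and n: "n \<in> N"
  shows "f n = 0"
proof (rule zero_if_zero_on_pure[OF ml[OF n]])
  fix Xs t x d assume *: "pure g1 g2 Xs t" "d \<in> {0::int, 1}" "x \<in> \<H> d"
  have H: "f m Xs x \<in> \<H> (t + d + (c - int m))" if "m \<in> N" for m
    by (rule homogeneousD[OF hom[OF that] *(1,3,2)])
  have sum0: "(\<Sum>m\<in>N. f m Xs x) = 0"
  proof -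
    have "(\<Sum>m\<in>N. f m) Xs x = (\<Sum>m\<in>N. f m Xs x)"
      using fin by (induction N rule: finite_induct) simp_all
    then show ?thesis using zero by simp
  qed
  have psum: "(\<Sum>m\<in>N. h (f m Xs x)) = 0" if "lin scale h" for h
  proof -
    have "h (\<Sum>m\<in>N. f m Xs x) = (\<Sum>m\<in>N. h (f m Xs x))"
      using fin by (induction N rule: finite_induct) (simp_all add: lin_simps[OF that])
    then show ?thesis using sum0 lin_simps(3)[OF that] by simp
  qed
  consider "t + d + (c - int n) = 0" | "t + d + (c - int n) = 1"
    | "t + d + (c - int n) \<noteq> 0" "t + d + (c - int n) \<noteq> 1" by blast
  then show "f n Xs x = 0"
  proof cases
    case 1
    have "p2 (f m Xs x) = 0" if "m \<in> N" "m \<noteq> n" for m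
      using H[OF that(1)] that(2) 1 p2_g1 lin_simps(3)[OF lin_p2]
      by (auto simp: piece_def split: if_splits)
    then have "(\<Sum>m\<in>N. p2 (f m Xs x)) = p2 (f n Xs x)"
      using fin n by (subst sum.remove[of _ n]) auto
    then show ?thesis using psum[OF lin_p2] H[OF n] 1 by (simp add: component_g2_self)
  next
    case 2
    have "p1 (f m Xs x) = 0" if "m \<in> N" "m \<noteq> n" for m
      using H[OF that(1)] that(2) 2 p1_g2 lin_simps(3)[OF lin_p1]
      by (auto simp: piece_def split: if_splits)
    then have "(\<Sum>m\<in>N. p1 (f m Xs x)) = p1 (f n Xs x)"
      using fin n by (subst sum.remove[of _ n]) auto
    then show ?thesis using psum[OF lin_p1] H[OF n] 2 by (simp add: component_g1_self)
  next
    case 3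
    then show ?thesis using piece_trivial H[OF n] by blast
  qed
qed

section \<open>The homogeneous components of the bracket\<close>

lemma br_lin: "lin scale (\<lambda>x. br x y z)" "lin scale (\<lambda>y. br x y z)" "lin scale (\<lambda>z. br x y z)"
  using br_linear1 br_linear2 br_linear3
  unfolding linear_on_def Vector_Spaces.linear_def module_hom_def module_hom_axioms_def by auto

lemmas br_simps = br_lin[THEN lin_simps(1)] br_lin[THEN lin_simps(2)] br_lin[THEN lin_simps(3)]
  br_lin[THEN lin_simps(4)]

lemma cochain_of_map_closed:
  assumes lin: "\<And>y z. lin scale (\<lambda>x. t x y z)" "\<And>x y. lin scale (\<lambda>z. t x y z)"
    and skew12: "\<And>x y z. t y x z = - t x y z" and skew23: "\<And>x y z. t x z y = - t x y z"
  shows "cochain_of_map t \<in> \<C> scale 1"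
proof -
  have single: "cochain_of_map t [(x, y)] z = t x y z" for x y z by (simp add: cochain_of_map_def)
  have other: "cochain_of_map t Xs z = 0" if "length Xs \<noteq> 1" for Xs z
  proof (cases Xs)
    case (Cons X Ys)
    then show ?thesis using that by (cases Ys) (auto simp: cochain_of_map_def)
  qed (simp add: cochain_of_map_def)
  have cases1: "As @ X # Bs = [X] \<or> length (As @ X # Bs) \<noteq> 1" for As Bs and X :: "'v \<times> 'v"
    by (cases As; cases Bs) auto
  have alt: "alternating (cochain_of_map t)"
  proof (rule alternatingI)
    fix As Bs :: "('v \<times> 'v) list" and a b x
    show "cochain_of_map t (As @ (b, a) # Bs) x = - cochain_of_map t (As @ (a, b) # Bs) x"
    proof (cases "As = [] \<and> Bs = []")
      case True
      then show ?thesis using skew12[of b a x] by (simp add: single)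
    next
      case False
      then have "cochain_of_map t (As @ X # Bs) x = 0" for X by (intro other) auto
      then show ?thesis by simp
    qed
    show "cochain_of_map t (As @ [(a, x)]) b = - cochain_of_map t (As @ [(a, b)]) x"
    proof (cases "As = []")
      case True
      then show ?thesis using skew23[of a x b] by (simp add: single)
    next
      case False
      then have "cochain_of_map t (As @ [X]) y = 0" for X y by (intro other) auto
      then show ?thesis by simp
    qed
  qed
  have "multilinear scale (cochain_of_map t)"
  proof (rule multilinear_if_alternating[OF _ _ alt])
    fix Xs
    show "lin scale (cochain_of_map t Xs)"
    proof (cases "length Xs = 1")
      case True
      then obtain x y where "Xs = [(x, y)]" by (auto simp: length_Suc_conv)
      then have "cochain_of_map t Xs = (\<lambda>z. t x y z)" using single by blast
      then show ?thesis using lin(2) by simp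
    next
      case False
      then have "cochain_of_map t Xs = (\<lambda>z. 0)" using other by blast
      then show ?thesis using lin_intros(1) by simp
    qed
  next
    fix As Bs :: "('v \<times> 'v) list" and b x
    show "lin scale (\<lambda>a. cochain_of_map t (As @ (a, b) # Bs) x)"
    proof (cases "As = [] \<and> Bs = []")
      case True
      then show ?thesis using lin(1) by (simp add: single)
    next
      case False
      then have "cochain_of_map t (As @ (a, b) # Bs) x = 0" for a by (intro other) auto
      then show ?thesis using lin_intros(1) by simp
    qed
  qed
  moreover have "supported 1 (cochain_of_map t)" using other by (simp add: supported_def)
  ultimately show ?thesis using alt by (simp add: cochains_UNIV_iff)
qed

lemma component_maps_closed:
  "cochain_of_map (mu1_map br g1 g2) \<in> \<C> scale 1"
  "cochain_of_map (psi_map br g1 g2) \<in> \<C> scale 1"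
  "cochain_of_map (mu2_map br g1 g2) \<in> \<C> scale 1"
proof -
  have c: "lin scale (\<lambda>a. h (br (k a) y z))" "lin scale (\<lambda>a. h (br y (k a) z))"
    "lin scale (\<lambda>a. h (br y z (k a)))" if "lin scale h" "lin scale k" for h k y z
    by (rule lin_comp[OF that(1) lin_comp[OF br_lin(1) that(2)]],
        rule lin_comp[OF that(1) lin_comp[OF br_lin(2) that(2)]],
        rule lin_comp[OF that(1) lin_comp[OF br_lin(3) that(2)]])
  have s12: "h (br (k b) (l a) z) = - h (br (l a) (k b) z)" if "lin scale h" for h k l a b z
    using br_skew12[of "k b" "l a" z] lin_simps(4)[OF that] by simp
  have s23: "h (br z (k b) (l a)) = - h (br z (l a) (k b))" if "lin scale h" for h k l a b z
    using br_skew23[of z "k b" "l a"] lin_simps(4)[OF that] by simp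
  note lins = lin_intros(2) c lin_p1 lin_p2
  note defs = mu1_map_def psi_map_def mu2_map_def Let_def
  have "cochain_of_map t \<in> \<C> scale 1"
    if "t = mu1_map br g1 g2 \<or> t = psi_map br g1 g2 \<or> t = mu2_map br g1 g2" for t
  proof (rule cochain_of_map_closed)
    fix a b c
    show "lin scale (\<lambda>a. t a b c)" "lin scale (\<lambda>a. t b c a)"
      using that by (elim disjE; simp only: defs; intro lins)+
    show "t b a c = - t a b c"
      using that
      by (elim disjE; simp only:;
          unfold defs s12[OF lin_p1, of _ b _ a] s12[OF lin_p2, of _ b _ a]; simp)
    show "t a c b = - t a b c"
      using that
      by (elim disjE; simp only:;
          unfold defs s23[OF lin_p1, of _ _ c _ b] s23[OF lin_p2, of _ _ c _ b]; simp)
  qed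
  then show "cochain_of_map (mu1_map br g1 g2) \<in> \<C> scale 1"
    "cochain_of_map (psi_map br g1 g2) \<in> \<C> scale 1"
    "cochain_of_map (mu2_map br g1 g2) \<in> \<C> scale 1"
    by blast+
qed

lemma structure_map_closed: "\<Omega> k \<in> \<C> scale 1"
  using component_maps_closed
  by (simp add: structure_map_def mu1_hat_def mu2_hat_def psi_hat_def cochains_UNIV_zero)

lemma homogeneous_cochain_of_map:
  assumes "\<And>i j k a b c. i \<in> {0, 1} \<Longrightarrow> j \<in> {0, 1} \<Longrightarrow> k \<in> {0, 1} \<Longrightarrow>
    a \<in> \<H> i \<Longrightarrow> b \<in> \<H> j \<Longrightarrow> c \<in> \<H> k \<Longrightarrow>
    t a b c \<in> \<H> (i + j + k + e)"
  shows "homog e (cochain_of_map t)"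
  unfolding homogeneous_def
proof (intro allI ballI impI)
  fix Xs n x d assume d: "d \<in> {0::int, 1}" and Xs: "pure g1 g2 Xs n" and x: "x \<in> \<H> d"
  from Xs show "cochain_of_map t Xs x \<in> \<H> (n + d + e)"
  proof cases
    case pure_Nil
    then show ?thesis by (simp add: cochain_of_map_def piece_zero)
  next
    case (pure_Cons i j a b Ys m)
    show ?thesis
    proof (cases "Ys = []")
      case True
      then have "m = 0" using pure_Cons(7) by (auto elim: pure.cases)
      then show ?thesis using assms[OF pure_Cons(3,4) d pure_Cons(5,6) x] pure_Cons True
        by (simp add: cochain_of_map_def)
    next
      case False
      then show ?thesis using pure_Cons by (cases Ys) (simp_all add: cochain_of_map_def piece_zero)
    qed
  qed
qed

lemma homogeneous_structure_map: "homog (1 - int k) (\<Omega> k)"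
proof -
  note comps = component_g1_self component_g2_self p1_g2 p2_g1 br_simps p1_in p2_in
    subspace_0[OF subspace_g1] subspace_0[OF subspace_g2]
    lin_simps(3)[OF lin_p1] lin_simps(3)[OF lin_p2]
  have "homog (- 2) (mu1_hat br g1 g2)"
    unfolding mu1_hat_def
    by (rule homogeneous_cochain_of_map)
       (auto simp: mu1_map_def Let_def comps piece_def[of g1 g2 "-2"] piece_def[of g1 g2 "-1"])
  moreover have "homog (- 1) (psi_hat br g1 g2)"
    unfolding psi_hat_def
    by (rule homogeneous_cochain_of_map)
       (auto simp: psi_map_def Let_def comps piece_def[of g1 g2 2] piece_def[of g1 g2 "-1"])
  moreover have "homog 0 (mu2_hat br g1 g2)"
    unfolding mu2_hat_def
    by (rule homogeneous_cochain_of_map)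
       (auto simp: mu2_map_def Let_def comps piece_def[of g1 g2 2] piece_def[of g1 g2 3])
  ultimately show ?thesis by (auto simp: structure_map_def homogeneous_zero)
qed

text \<open>
  On two pairs this is the fundamental identity.
\<close>

lemma br_square_zero: "cochain_of_map br \<odot> cochain_of_map br = 0"
proof (intro ext)
  fix Xs x
  have closed: "cochain_of_map br \<in> \<C> scale 1"
    by (rule cochain_of_map_closed) (rule br_lin br_skew12 br_skew23)+
  show "(cochain_of_map br \<odot> cochain_of_map br) Xs x = 0 Xs x"
  proof (cases "length Xs = 2")
    case True
    then obtain a b c d where Xs: "Xs = [(a, b), (c, d)]"
      by (auto simp: length_Suc_conv numeral_2_eq_2)
    show ?thesis
      using fundamental_identity[of a b c d x]
      by (simp add: Xs pre_lie_Cons pre_lie_Nil contr_def twist_def cochain_of_map_def br_simps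
          sg_apply)
  next
    case False
    then show ?thesis
      using cochains_wrong_length[OF pre_lie_closed[OF closed closed]] by simp
  qed
qed

text \<open>
  The sum on the left is the part of degree \<open>2 - n\<close> of the product of the full bracket with
  itself.
\<close>

lemma structure_equation:
  "(\<Sum>i\<le>n. \<Omega> i \<odot> \<Omega> (n - i)) = 0"
proof -
  define D where "D n = (\<Sum>i\<le>n. \<Omega> i \<odot> \<Omega> (n - i))" for n
  note ml = cochains_UNIV_D(1)[OF structure_map_closed]
  have z: "\<Omega> i = 0" if "i = 0 \<or> i > 3" for i using that by (auto simp: structure_map_def)
  have "cochain_of_map br = \<Omega> 1 + \<Omega> 2 + \<Omega> 3"
  proof (intro ext)
    fix Xs x
    show "cochain_of_map br Xs x = (\<Omega> 1 + \<Omega> 2 + \<Omega> 3) Xs x"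
    proof (cases "\<exists>a b. Xs = [(a, b)]")
      case True
      then show ?thesis
        by (auto simp: structure_map_def mu1_hat_def mu2_hat_def psi_hat_def cochain_of_map_def
            br_decomposition[of _ _ x])
    next
      case False
      then show ?thesis
        by (auto simp: structure_map_def mu1_hat_def mu2_hat_def psi_hat_def cochain_of_map_def
            split: list.split)
    qed
  qed
  then have 0: "(\<Omega> 1 + \<Omega> 2 + \<Omega> 3) \<odot> (\<Omega> 1 + \<Omega> 2 + \<Omega> 3) = 0"
    using br_square_zero by simp
  \<comment> \<open>All other products in the sums vanish because one factor does.\<close>
  have D: "D 0 = 0" "D 1 = 0" "D 2 = \<Omega> 1 \<odot> \<Omega> 1" "D 3 = \<Omega> 1 \<odot> \<Omega> 2 + \<Omega> 2 \<odot> \<Omega> 1"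
    "D 4 = \<Omega> 1 \<odot> \<Omega> 3 + \<Omega> 2 \<odot> \<Omega> 2 + \<Omega> 3 \<odot> \<Omega> 1"
    "D 5 = \<Omega> 2 \<odot> \<Omega> 3 + \<Omega> 3 \<odot> \<Omega> 2" "D 6 = \<Omega> 3 \<odot> \<Omega> 3"
    by (simp_all add: D_def eval_nat_numeral z pre_lie_zero_right ml)
  have "(\<Sum>n\<le>6. D n) = D 0 + D 1 + D 2 + D 3 + D 4 + D 5 + D 6"
    by (simp add: eval_nat_numeral)
  also have "\<dots> = (\<Omega> 1 + \<Omega> 2 + \<Omega> 3) \<odot> (\<Omega> 1 + \<Omega> 2 + \<Omega> 3)"
    unfolding D pre_lie_add_left pre_lie_add_right[OF ml] by (simp add: add_ac del: plus_fun_apply)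
  finally have sum0: "(\<Sum>n\<le>6. D n) = 0" using 0 by simp
  have D0: "D n = 0"
  proof (cases "n \<le> 6")
    case True
    show ?thesis
    proof (rule homogeneous_sum_zero[of "{..6}" D 2 n])
      fix k
      show "multilinear scale (D k)" unfolding D_def
        by (intro multilinear_sum multilinear_pre_lie ml)
      show "homog (2 - int k) (D k)"
        unfolding D_def
      proof (rule homogeneous_sum)
        fix i assume "i \<in> {..k}"
        then have "2 - int k = (1 - int i) + (1 - int (k - i))" by simp
        then show "homog (2 - int k) (\<Omega> i \<odot> \<Omega> (k - i))"
          by (simp only: homogeneous_pre_lie[OF ml ml homogeneous_structure_map
                homogeneous_structure_map])
      qed
    qed (use sum0 True in auto)
  next
    case False
    have "\<Omega> i \<odot> \<Omega> (n - i) = 0" for i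
      using False z[of i] z[of "n - i"] by (cases "i > 3") (auto simp: pre_lie_zero_right ml)
    then show ?thesis unfolding D_def by simp
  qed
  then show ?thesis by (simp add: D_def)
qed

section \<open>Cochains on \<open>g2\<close> with values in \<open>g1\<close>\<close>

text \<open>
  Conversely to \<open>homogeneous_1_is_lift\<close>, lifts have degree \<open>1\<close>: they vanish as soon as an
  argument lies in \<open>g1\<close>.
\<close>

lemma lift_closed:
  assumes g: "g \<in> cochains scale g2 g1 m"
  shows "lift g1 g2 g \<in> \<C> scale m"
    and "homog 1 (lift g1 g2 g)"
proof -
  let ?M = "map (map_prod p2 p2)"
  have dom: "(?M Xs, p2 x) \<in> cochain_domain g2 m \<longleftrightarrow> length Xs = m" for Xs x
    using p2_in by (auto simp: cochain_domain_def)
  have set: "set (?M Xs) \<subseteq> g2 \<times> g2" for Xs using p2_in by auto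
  have supp: "length Xs \<noteq> m \<Longrightarrow> lift g1 g2 g Xs x = 0" for Xs x
    using g dom[of Xs x] by (simp add: cochains_def lift_def)
  have l0: "lin scale (\<lambda>x. 0)" by (rule lin_intros)
  have alt: "lift g1 g2 g (As @ (b, a) # Bs) x = - lift g1 g2 g (As @ (a, b) # Bs) x" for As a b Bs x
  proof (cases "length (As @ (a, b) # Bs) = m")
    case True
    have "\<forall>Xs x i. \<forall>a\<in>g2. \<forall>b\<in>g2. (Xs, x) \<in> cochain_domain g2 m \<and> i < m \<longrightarrow>
        g (Xs[i := (b, a)]) x = - g (Xs[i := (a, b)]) x"
      using g unfolding cochains_def mem_Collect_eq by blast
    moreover have "(?M (As @ (a, b) # Bs), p2 x) \<in> cochain_domain g2 m" "length As < m"
      using dom[of "As @ (a, b) # Bs" x] True by auto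
    ultimately have "g ((?M (As @ (a, b) # Bs))[length As := (p2 b, p2 a)]) (p2 x)
        = - g ((?M (As @ (a, b) # Bs))[length As := (p2 a, p2 b)]) (p2 x)"
      using p2_in by blast
    then show ?thesis by (simp add: lift_def list_update_append)
  next
    case False
    then show ?thesis by (simp add: supp)
  qed
  have alt2: "lift g1 g2 g (As @ [(a, x)]) b = - lift g1 g2 g (As @ [(a, b)]) x" for As a b x
  proof (cases "length (As @ [(a, b)]) = m")
    case True
    have "\<forall>Xs a b x. (Xs @ [(a, b)], x) \<in> cochain_domain g2 m \<longrightarrow>
        g (Xs @ [(a, x)]) b = - g (Xs @ [(a, b)]) x"
      using g unfolding cochains_def mem_Collect_eq by blast
    moreover have "(?M As @ [(p2 a, p2 b)], p2 x) \<in> cochain_domain g2 m"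
      using dom[of "As @ [(a, b)]" x] True by simp
    ultimately have "g (?M As @ [(p2 a, p2 x)]) (p2 b) = - g (?M As @ [(p2 a, p2 b)]) (p2 x)"
      by blast
    then show ?thesis by (simp add: lift_def)
  next
    case False
    then show ?thesis by (simp add: supp)
  qed
  have lin1: "lin scale (lift g1 g2 g Xs)" for Xs
  proof (cases "length Xs = m")
    case True
    then have "linear_on scale g2 (g (?M Xs))" using g set by (simp add: cochains_def)
    then show ?thesis by (simp add: linear_on_def lift_def p2_in p2_simps)
  next
    case False
    then have "lift g1 g2 g Xs = (\<lambda>x. 0)" using supp by blast
    then show ?thesis using l0 by simp
  qed
  have lin2: "lin scale (\<lambda>a. lift g1 g2 g (As @ (a, b) # Bs) x)" for As b Bs x
  proof (cases "length (As @ (b, b) # Bs) = m")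
    case True
    have "\<forall>Xs x i. \<forall>b\<in>g2. (Xs, x) \<in> cochain_domain g2 m \<and> i < m \<longrightarrow>
        linear_on scale g2 (\<lambda>a. g (Xs[i := (a, b)]) x)"
      using g unfolding cochains_def mem_Collect_eq by blast
    moreover have "(?M (As @ (b, b) # Bs), p2 x) \<in> cochain_domain g2 m" "length As < m"
      using dom[of "As @ (b, b) # Bs" x] True by auto
    ultimately have "linear_on scale g2 (\<lambda>a. g ((?M (As @ (b, b) # Bs))[length As := (a, p2 b)]) (p2 x))"
      using p2_in by blast
    then show ?thesis
      by (simp add: linear_on_def lift_def p2_in p2_simps list_update_append)
  next
    case False
    then have "lift g1 g2 g (As @ (a, b) # Bs) x = 0" for a by (intro supp) simp
    then show ?thesis using l0 by simp
  qed
  have alternating: "alternating (lift g1 g2 g)" by (rule alternatingI) (rule alt alt2)+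
  then have ml: "multilinear scale (lift g1 g2 g)"
    by (rule multilinear_if_alternating[OF lin1 lin2])
  moreover have "supported m (lift g1 g2 g)" using supp by (simp add: supported_def)
  ultimately show "lift g1 g2 g \<in> \<C> scale m"
    using alternating by (simp add: cochains_UNIV_iff)
  have ing1: "lift g1 g2 g Xs x \<in> g1" for Xs x
    using g dom[of Xs x] subspace_0[OF subspace_g1]
    by (cases "length Xs = m") (auto simp: cochains_def lift_def)
  have idem: "lift g1 g2 g (?M Xs) (p2 x) = lift g1 g2 g Xs x" for Xs x
  proof -
    have "?M (?M Xs) = ?M Xs" by (auto simp: component_g2_self p2_in)
    then show ?thesis unfolding lift_def by (simp only: component_g2_self[OF p2_in])
  qed
  show "homog 1 (lift g1 g2 g)"
    unfolding homogeneous_def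
  proof (intro allI ballI impI)
    fix Xs n x d assume d: "d \<in> {0::int, 1}" and Xs: "pure g1 g2 Xs n" and x: "x \<in> \<H> d"
    consider "n \<ge> 1" | "n = 0" "d = 1" | "n = 0" "d = 0" using pure_nonneg[OF Xs] d by fastforce
    then show "lift g1 g2 g Xs x \<in> \<H> (n + d + 1)"
    proof cases
      case 1
      then have "lift g1 g2 g (?M Xs) (p2 x) = 0" by (rule zero_if_projected_pure[OF Xs _ ml])
      then show ?thesis by (simp add: idem piece_zero)
    next
      case 2
      then have "lift g1 g2 g Xs (p2 x) = 0"
        using x by (simp add: p2_g1 lin_simps(3)[OF multilinearD(1)[OF ml]])
      then have "lift g1 g2 g Xs x = 0"
        by (simp add: lift_def component_g2_self p2_in)
      then show ?thesis by (simp add: piece_zero)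
    next
      case 3
      then show ?thesis using ing1 by simp
    qed
  qed
qed

lemma unlift_closed:
  assumes P: "P \<in> \<C> scale m" and hom: "homog 1 P"
  shows "unlift g2 P \<in> cochains scale g2 g1 m" and "lift g1 g2 (unlift g2 P) = P"
proof -
  note ml = cochains_UNIV_D(1)[OF P]
  have upd: "Xs[i := X] = take i Xs @ X # drop (Suc i) Xs" if "i < length Xs"
    for Xs i and X :: "'v \<times> 'v"
    using that by (rule upd_conv_take_nth_drop)
  have unl: "unlift g2 P Xs x = P Xs x" if "set Xs \<subseteq> g2 \<times> g2" "x \<in> g2" for Xs x
    using that by (simp add: unlift_def)
  have lin_restrict: "linear_on scale g2 f" if "lin scale h" "\<And>a. a \<in> g2 \<Longrightarrow> f a = h a" for f h
    using that subspace_add[OF subspace_g2] subspace_scale[OF subspace_g2]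
    by (simp add: linear_on_def)
  have set_upd: "set (Xs[i := (a, b)]) \<subseteq> g2 \<times> g2" if "set Xs \<subseteq> g2 \<times> g2" "a \<in> g2" "b \<in> g2"
    for Xs i a b
    using that by (intro set_update_subsetI) auto
  show "unlift g2 P \<in> cochains scale g2 g1 m"
    unfolding cochains_def mem_Collect_eq
  proof (intro conjI allI impI ballI)
    fix Xs x
    show "unlift g2 P Xs x \<in> g1"
      using homogeneous_1_in_g1[OF ml hom] subspace_0[OF subspace_g1] by (simp add: unlift_def)
    show "unlift g2 P Xs x = 0" if "(Xs, x) \<notin> cochain_domain g2 m"
      using that cochains_wrong_length[OF P, of Xs x] by (auto simp: cochain_domain_def unlift_def)
  next
    fix Xs assume "length Xs = m \<and> set Xs \<subseteq> g2 \<times> g2"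
    then show "linear_on scale g2 (unlift g2 P Xs)"
      by (intro lin_restrict[OF multilinearD(1)[OF ml, of Xs]] unl) auto
  next
    fix Xs x i b assume *: "b \<in> g2" "(Xs, x) \<in> cochain_domain g2 m \<and> i < m"
    show "linear_on scale g2 (\<lambda>a. unlift g2 P (Xs[i := (a, b)]) x)"
    proof (rule lin_restrict)
      show "lin scale (\<lambda>a. P (Xs[i := (a, b)]) x)"
        using * multilinearD(2)[OF ml, of "take i Xs" b "drop (Suc i) Xs" x]
        by (simp add: cochain_domain_def upd)
      show "unlift g2 P (Xs[i := (a, b)]) x = P (Xs[i := (a, b)]) x" if "a \<in> g2" for a
        using * that by (intro unl set_upd) (auto simp: cochain_domain_def)
    qed
  next
    fix Xs x i a b assume *: "a \<in> g2" "b \<in> g2" "(Xs, x) \<in> cochain_domain g2 m \<and> i < m"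
    have "unlift g2 P (Xs[i := (b, a)]) x = P (Xs[i := (b, a)]) x"
      "unlift g2 P (Xs[i := (a, b)]) x = P (Xs[i := (a, b)]) x"
      using * by (simp_all add: unl set_upd cochain_domain_def)
    moreover have "P (Xs[i := (b, a)]) x = - P (Xs[i := (a, b)]) x"
      using alternatingD(1)[OF cochains_UNIV_D(3)[OF P], of "take i Xs" b a "drop (Suc i) Xs" x] *
      by (simp add: upd cochain_domain_def)
    ultimately show "unlift g2 P (Xs[i := (b, a)]) x = - unlift g2 P (Xs[i := (a, b)]) x"
      by simp
  next
    fix Xs a b x assume *: "(Xs @ [(a, b)], x) \<in> cochain_domain g2 m"
    have "unlift g2 P (Xs @ [(a, x)]) b = P (Xs @ [(a, x)]) b"
      "unlift g2 P (Xs @ [(a, b)]) x = P (Xs @ [(a, b)]) x"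
      using * by (auto intro!: unl simp: cochain_domain_def)
    moreover have "P (Xs @ [(a, x)]) b = - P (Xs @ [(a, b)]) x"
      by (rule alternatingD(2)[OF cochains_UNIV_D(3)[OF P]])
    ultimately show "unlift g2 P (Xs @ [(a, x)]) b = - unlift g2 P (Xs @ [(a, b)]) x"
      by simp
  qed
  have "lift g1 g2 (unlift g2 P) = lift g1 g2 P"
    using p2_in by (auto simp: lift_def unlift_def fun_eq_iff)
  then show "lift g1 g2 (unlift g2 P) = P" using homogeneous_1_is_lift[OF ml hom] by simp
qed

end

section \<open>Iterated brackets\<close>

text \<open>
  Exchanging the two parts costs the sign for moving one past the other.
\<close>

lemma split_sum_swap:
  "split_sum d xs F =
     split_sum d xs (\<lambda>A B. sg (sum_list (map d A) * sum_list (map d B)) (F B A))"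
proof (induction xs arbitrary: F)
  case (Cons x xs)
  have 1: "split_sum d xs (\<lambda>A B. F (x # A) B) =
      split_sum d xs (\<lambda>A B. sg (d x * sum_list (map d A))
        (sg (sum_list (map d A) * sum_list (map d (x # B))) (F (x # B) A)))"
    unfolding Cons.IH[of "\<lambda>A B. F (x # A) B"]
    by (intro split_sum_cong) (simp, rule sg_cong, auto)
  have 2: "split_sum d xs (\<lambda>A B. sg (d x * sum_list (map d A)) (F A (x # B))) =
      split_sum d xs (\<lambda>A B. sg (sum_list (map d (x # A)) * sum_list (map d B)) (F B (x # A)))"
    unfolding Cons.IH[of "\<lambda>A B. sg (d x * sum_list (map d A)) (F A (x # B))"]
    by (intro split_sum_cong) (simp, rule sg_cong, auto)
  show ?case by (simp only: split_sum.simps 1 2 add.commute)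
qed simp

lemma split_sum_sum:
  "split_sum d xs (\<lambda>A B. \<Sum>i\<in>I. F i A B) = (\<Sum>i\<in>I. split_sum d xs (F i))"
  by (induction I rule: infinite_finite_induct) (simp_all add: split_sum_zero split_sum_add)

text \<open>
  The iterated bracket \<open>[\<dots>[F, x\<^sub>1], \<dots>, x\<^sub>k]\<close>.  The second entry of each pair is the degree of the
  first one; it enters the signs below but not the value.
\<close>

definition nested ::
    "('k::field \<Rightarrow> 'v \<Rightarrow> 'v) \<Rightarrow> 'v::ab_group_add cochain \<Rightarrow> ('v cochain \<times> nat) list \<Rightarrow> 'v cochain" where
  "nested scale F xs = foldl (\<lambda>F x. gbracket scale F (fst x)) F xs"

abbreviation total_degree :: "('a \<times> nat) list \<Rightarrow> nat" where
  "total_degree xs \<equiv> sum_list (map snd xs)"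

lemma nested_simps [simp]:
  "nested scale F [] = F"
  "nested scale F (x # xs) = nested scale (gbracket scale F (fst x)) xs"
  by (simp_all add: nested_def)

context vector_space
begin

lemma gbracket_closed:
  "P \<in> \<C> scale p \<Longrightarrow> Q \<in> \<C> scale q \<Longrightarrow>
    gbracket scale P Q \<in> \<C> scale (p + q)"
  by (simp add: gbracket_eq_super_bracket super_bracket_closed)

lemma gbracket_antisymmetric:
  "P \<in> \<C> scale p \<Longrightarrow> Q \<in> \<C> scale q \<Longrightarrow>
    gbracket scale P Q = - sg (p * q) (gbracket scale Q P)"
  by (simp add: gbracket_eq_super_bracket super_bracket_antisymmetric[of p q])

lemma gbracket_jacobi:
  assumes F: "F \<in> \<C> scale f" and A: "A \<in> \<C> scale a"
    and B: "B \<in> \<C> scale b"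
  shows "gbracket scale (gbracket scale F A) B =
    gbracket scale F (gbracket scale A B) + sg (a * b) (gbracket scale (gbracket scale F B) A)"
  using super_bracket_jacobi[OF cochains_UNIV_D(1,4)[OF F] cochains_UNIV_D(1,4)[OF A]
      cochains_UNIV_D(1,4)[OF B]]
  by (simp add: gbracket_eq_super_bracket[OF F A] gbracket_eq_super_bracket[OF F B]
      gbracket_eq_super_bracket[OF A B]
      gbracket_eq_super_bracket[OF super_bracket_closed[OF F A] B]
      gbracket_eq_super_bracket[OF F super_bracket_closed[OF A B]]
      gbracket_eq_super_bracket[OF super_bracket_closed[OF F B] A])

lemma gbracket_sg:
  assumes "multilinear scale P" "multilinear scale Q"
  shows "gbracket scale (sg n P) Q = sg n (gbracket scale P Q)"
    and "gbracket scale P (sg n Q) = sg n (gbracket scale P Q)"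
proof -
  have "sg n R = cochain_scale scale ((-1) ^ n) R" for R
    by (simp add: cochain_scale_def scale_power_minus_one fun_eq_iff sg_apply)
  then show "gbracket scale (sg n P) Q = sg n (gbracket scale P Q)"
    "gbracket scale P (sg n Q) = sg n (gbracket scale P Q)"
    by (simp_all only: gbracket_scale[OF assms])
qed

lemma nested_multilinear:
  assumes "multilinear scale F" "\<forall>x\<in>set xs. multilinear scale (fst x)"
  shows "multilinear scale (nested scale F xs)"
  using assms by (induction xs arbitrary: F) (auto simp: multilinear_gbracket)

lemma nested_add:
  assumes "multilinear scale F" "multilinear scale G" "\<forall>x\<in>set xs. multilinear scale (fst x)"
  shows "nested scale (F + G) xs = nested scale F xs + nested scale G xs"
  using assms
  by (induction xs arbitrary: F G) (simp_all add: gbracket_add multilinear_gbracket)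

lemma nested_sg:
  assumes "multilinear scale F" "\<forall>x\<in>set xs. multilinear scale (fst x)"
  shows "nested scale (sg n F) xs = sg n (nested scale F xs)"
  using assms
  by (induction xs arbitrary: F) (simp_all add: gbracket_sg multilinear_gbracket)

lemma nested_zero:
  assumes "\<forall>x\<in>set xs. multilinear scale (fst x)"
  shows "nested scale 0 xs = 0"
  using assms by (induction xs) (simp_all add: gbracket_zero)

lemma nested_sum:
  assumes "\<And>i. i \<in> I \<Longrightarrow> multilinear scale (f i)" "\<forall>x\<in>set xs. multilinear scale (fst x)"
  shows "nested scale (\<Sum>i\<in>I. f i) xs = (\<Sum>i\<in>I. nested scale (f i) xs)"
  using assms
  by (induction I rule: infinite_finite_induct)
     (simp_all add: nested_zero nested_add multilinear_sum)

lemma nested_closed: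
  assumes "F \<in> \<C> scale f" "\<forall>(a, m)\<in>set xs. a \<in> \<C> scale m"
  shows "nested scale F xs \<in> \<C> scale (f + total_degree xs)"
  using assms
proof (induction xs arbitrary: F f)
  case (Cons x xs)
  have "nested scale (gbracket scale F (fst x)) xs
      \<in> \<C> scale (f + snd x + total_degree xs)"
    using Cons.prems by (intro Cons.IH gbracket_closed) auto
  then show ?case by (simp add: add_ac)
qed simp

text \<open>
  \<open>[\<cdot>, a]\<close> is a graded derivation, so each \<open>a\<close> goes either to \<open>F\<close> or to \<open>G\<close>.  The order \<open>A\<close>
  before \<open>B\<close> is the one in the generalized Jacobi identity; the additional sign moves \<open>B\<close> back
  in front of \<open>G\<close> and \<open>A\<close>.
\<close>

lemma nested_derivation:
  assumes "F \<in> \<C> scale f" "G \<in> \<C> scale g"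
    and "\<forall>(a, m)\<in>set xs. a \<in> \<C> scale m"
  shows "nested scale (gbracket scale F G) xs =
    split_sum snd xs (\<lambda>A B. sg ((g + total_degree A) * total_degree B)
      (gbracket scale (nested scale F B) (nested scale G A)))"
  using assms
proof (induction xs arbitrary: F f G g)
  case (Cons x xs)
  obtain a m where x: "x = (a, m)" by (cases x)
  note F = Cons.prems(1) and G = Cons.prems(2)
  have a: "a \<in> \<C> scale m"
    and xs: "\<forall>(a, m)\<in>set xs. a \<in> \<C> scale m" using Cons.prems x by auto
  have mlxs: "\<forall>x\<in>set xs. multilinear scale (fst x)" using xs cochains_UNIV_D(1) by fastforce
  note FG = gbracket_closed[OF F G] and Ga = gbracket_closed[OF G a] and Fa = gbracket_closed[OF F a]
  have "nested scale (gbracket scale F G) (x # xs) =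
      nested scale (gbracket scale F (gbracket scale G a)) xs
      + sg (g * m) (nested scale (gbracket scale (gbracket scale F a) G) xs)"
    unfolding nested_simps x fst_conv gbracket_jacobi[OF F G a]
    using gbracket_closed[OF F Ga] gbracket_closed[OF Fa G] mlxs
    by (simp add: nested_add nested_sg cochains_UNIV_D multilinear_sg)
  also have "nested scale (gbracket scale F (gbracket scale G a)) xs =
      split_sum snd xs (\<lambda>A B. sg ((g + total_degree (x # A)) * total_degree B)
        (gbracket scale (nested scale F B) (nested scale G (x # A))))"
    unfolding Cons.IH[OF F Ga xs] by (simp add: x add.assoc)
  also have "sg (g * m) (nested scale (gbracket scale (gbracket scale F a) G) xs) =
      split_sum snd xs (\<lambda>A B. sg (snd x * total_degree A)
        (sg ((g + total_degree A) * total_degree (x # B))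
          (gbracket scale (nested scale F (x # B)) (nested scale G A))))"
  proof -
    have sgs: "sg k (split_sum snd xs \<Phi>) = split_sum snd xs (\<lambda>A B. sg k (\<Phi> A B))"
      for k and xs :: "('b cochain \<times> nat) list" and \<Phi> :: "_ \<Rightarrow> _ \<Rightarrow> 'b cochain"
      by (induction xs arbitrary: \<Phi>) (simp_all add: sg_add add.commute)
    show ?thesis
      unfolding Cons.IH[OF Fa G xs] sgs x
      by (intro split_sum_cong) (simp, rule sg_cong, auto)
  qed
  finally show ?case by simp
qed simp

end

section \<open>The generalized Jacobi identity\<close>

context twilled_three_Lie_algebra
begin

lemma homogeneous_gbracket:
  assumes "P \<in> \<C> scale p" "Q \<in> \<C> scale q"
    and "homog e P" "homog f Q"
  shows "homog (e + f) (bracket P Q)"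
  unfolding gbracket_eq_super_bracket[OF assms(1,2)]
  using assms by (intro homogeneous_super_bracket cochains_UNIV_D(1))

text \<open>
  By \<open>homogeneous_1_is_lift\<close> these are lifts of cochains on \<open>g2\<close> with values in \<open>g1\<close>, paired with
  their cochain degrees.
\<close>

definition lifted :: "'v cochain \<times> nat \<Rightarrow> bool" where
  "lifted x \<longleftrightarrow> fst x \<in> \<C> scale (snd x) \<and> homog 1 (fst x)"

lemma liftedD:
  assumes "lifted x"
  shows "fst x \<in> \<C> scale (snd x)" "homog 1 (fst x)"
    "multilinear scale (fst x)"
  using assms by (auto simp: lifted_def intro: cochains_UNIV_D)

text \<open>
  The bracket has degree \<open>2\<close>.
\<close>

lemma lifted_commute:
  assumes "lifted x" "lifted y"
  shows "bracket (fst x) (fst y) = 0"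
proof (rule homogeneous_ge_2_zero)
  show "homog (1 + 1) (bracket (fst x) (fst y))"
    by (rule homogeneous_gbracket[OF liftedD(1)[OF assms(1)] liftedD(1)[OF assms(2)]
          liftedD(2)[OF assms(1)] liftedD(2)[OF assms(2)]])
  show "multilinear scale (bracket (fst x) (fst y))"
    by (intro multilinear_gbracket liftedD assms)
qed simp

lemma lifted_swap:
  assumes F: "F \<in> \<C> scale f" and x: "lifted x" and y: "lifted y"
  shows "bracket (bracket F (fst x)) (fst y) =
    sg (snd x * snd y) (bracket (bracket F (fst y)) (fst x))"
  using gbracket_jacobi[OF F liftedD(1)[OF x] liftedD(1)[OF y]] lifted_commute[OF x y]
    gbracket_zero(2)[OF cochains_UNIV_D(1)[OF F]] by simp

lemma nested_homogeneous:
  assumes "F \<in> \<C> scale f" "homog e F" "\<forall>x\<in>set xs. lifted x"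
  shows "homog (e + int (length xs)) (nested scale F xs)"
  using assms
proof (induction xs arbitrary: F e f)
  case (Cons x xs)
  have x: "lifted x" using Cons.prems by simp
  have "homog (e + 1 + int (length xs)) (nested scale (bracket F (fst x)) xs)"
    by (rule Cons.IH[OF gbracket_closed[OF Cons.prems(1) liftedD(1)[OF x]]
          homogeneous_gbracket[OF Cons.prems(1) liftedD(1)[OF x] Cons.prems(2) liftedD(2)[OF x]]])
       (use Cons.prems in auto)
  then show ?case by (simp add: add_ac)
qed simp

lemma nested_move_last:
  assumes "F \<in> \<C> scale f" "lifted y" "\<forall>x\<in>set xs. lifted x"
  shows "nested scale (bracket F (fst y)) xs =
    sg (snd y * total_degree xs) (bracket (nested scale F xs) (fst y))"
  using assms
proof (induction xs arbitrary: F f)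
  case (Cons x xs)
  have x: "lifted x" using Cons.prems by simp
  note y = Cons.prems(2)
  have ml: "\<forall>x\<in>set xs. multilinear scale (fst x)" using Cons.prems liftedD(3) by auto
  have Fx: "bracket F (fst x) \<in> \<C> scale (f + snd x)"
    by (rule gbracket_closed[OF Cons.prems(1) liftedD(1)[OF x]])
  have "nested scale (bracket F (fst y)) (x # xs) =
      nested scale (sg (snd y * snd x) (bracket (bracket F (fst x)) (fst y))) xs"
    using lifted_swap[OF Cons.prems(1) y x] by simp
  also have "\<dots> = sg (snd y * snd x) (nested scale (bracket (bracket F (fst x)) (fst y)) xs)"
    by (intro nested_sg ml multilinear_gbracket cochains_UNIV_D(1)[OF Fx] liftedD(3)[OF y])
  also have "nested scale (bracket (bracket F (fst x)) (fst y)) xs =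
      sg (snd y * total_degree xs) (bracket (nested scale F (x # xs)) (fst y))"
    using Cons.IH[OF Fx y] Cons.prems by simp
  finally show ?case by (simp add: distrib_left)
qed simp

text \<open>
  The degree is \<open>1 - k + k\<close> for \<open>k\<close> arguments.
\<close>

lemma nested_structure_lifted:
  assumes "\<forall>x\<in>set xs. lifted x"
  shows "lifted (nested scale (\<Omega> (length xs)) xs, Suc (total_degree xs))"
proof -
  have "\<forall>(a, m)\<in>set xs. a \<in> \<C> scale m" using assms liftedD(1) by fastforce
  then show ?thesis
    using nested_closed[OF structure_map_closed, of xs "length xs"]
      nested_homogeneous[OF structure_map_closed homogeneous_structure_map assms, of "length xs"]
    by (simp add: lifted_def)
qed

lemma nested_structure_zero:
  assumes "\<forall>x\<in>set xs. lifted x" "k < length xs"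
  shows "nested scale (\<Omega> k) xs = 0"
proof (rule homogeneous_ge_2_zero)
  show "multilinear scale (nested scale (\<Omega> k) xs)"
    using assms liftedD(3) by (intro nested_multilinear cochains_UNIV_D(1)[OF structure_map_closed]) auto
  show "homog (1 - int k + int (length xs)) (nested scale (\<Omega> k) xs)"
    by (rule nested_homogeneous[OF structure_map_closed homogeneous_structure_map assms(1)])
qed (use assms(2) in simp)

text \<open>
  The characteristic is not \<open>2\<close>.
\<close>

lemma double_zero:
  fixes v :: 'v assumes "v + v = 0" shows "v = 0"
proof -
  have "scale 2 v = 0" using assms scale_left_distrib[of 1 1 v] by simp
  then show ?thesis by simp
qed

text \<open>
  The lift of \<open>l (l A, B)\<close>, a summand of the generalized Jacobi identity.
\<close>

definition composite :: "('v cochain \<times> nat) list \<Rightarrow> ('v cochain \<times> nat) list \<Rightarrow> 'v cochain" where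
  "composite A B = nested scale (bracket (\<Omega> (Suc (length B)))
     (nested scale (\<Omega> (length A)) A)) B"

text \<open>
  With \<open>T i j A B\<close> the summand of \<open>nested_derivation\<close> for \<open>[\<Omega> j, \<Omega> i]\<close>, the sum of all \<open>T\<close> over
  \<open>i + j = n + 1\<close> vanishes by \<open>structure_equation\<close>.  For a given splitting, \<open>T\<close> is zero by degree
  unless \<open>(i, j)\<close> is \<open>(|A|, |B| + 1)\<close> or \<open>(|A| + 1, |B|)\<close>.  The first choice gives the sum in
  question, and the second one the same sum with \<open>A\<close> and \<open>B\<close> exchanged.
\<close>

lemma generalized_jacobi:
  assumes xs: "\<forall>x\<in>set xs. lifted x"
  shows "split_sum snd xs composite = 0"
proof -
  let ?n = "length xs"
  note mc = structure_map_closed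
  have cl: "\<forall>(a, m)\<in>set xs. a \<in> \<C> scale m" using xs liftedD(1) by fastforce
  have ml: "\<forall>x\<in>set xs. multilinear scale (fst x)" using xs liftedD(3) by auto
  define T where "T i j A B = sg ((1 + total_degree A) * total_degree B)
      (bracket (nested scale (\<Omega> j) B) (nested scale (\<Omega> i) A))" for i j A B
  define J where "J = split_sum snd xs (\<lambda>A B. T (length A) (Suc (length B)) A B)"
  \<comment> \<open>The value of \<open>l\<close> in the first place can be moved behind the arguments in \<open>B\<close>.\<close>
  have J: "split_sum snd xs composite = J"
    unfolding J_def T_def
  proof (rule split_sum_cong)
    fix A B assume "set A \<subseteq> set xs" "set B \<subseteq> set xs"
    then have A: "\<forall>x\<in>set A. lifted x" and B: "\<forall>x\<in>set B. lifted x" using xs by auto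
    show "composite A B = sg ((1 + total_degree A) * total_degree B)
        (bracket (nested scale (\<Omega> (Suc (length B))) B) (nested scale (\<Omega> (length A)) A))"
      using nested_move_last[OF mc nested_structure_lifted[OF A] B] by (simp add: composite_def)
  qed
  have "(\<Sum>i\<le>Suc ?n. bracket (\<Omega> (Suc ?n - i)) (\<Omega> i)) =
      (\<Sum>i\<le>Suc ?n. \<Omega> (Suc ?n - i) \<odot> \<Omega> i) + (\<Sum>i\<le>Suc ?n. \<Omega> i \<odot> \<Omega> (Suc ?n - i))"
    by (simp add: gbracket_eq_super_bracket[OF mc mc] super_bracket_def sum.distrib
        del: sum.atMost_Suc)
  also have "(\<Sum>i\<le>Suc ?n. \<Omega> (Suc ?n - i) \<odot> \<Omega> i) = (\<Sum>i\<le>Suc ?n. \<Omega> i \<odot> \<Omega> (Suc ?n - i))"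
    by (rule sum.reindex_bij_witness[of _ "\<lambda>i. Suc ?n - i" "\<lambda>i. Suc ?n - i"]) auto
  finally have "(\<Sum>i\<le>Suc ?n. bracket (\<Omega> (Suc ?n - i)) (\<Omega> i)) = 0"
    by (simp only: structure_equation add_0_right)
  then have "0 = nested scale (\<Sum>i\<le>Suc ?n. bracket (\<Omega> (Suc ?n - i)) (\<Omega> i)) xs"
    using nested_zero[OF ml] by (simp only:)
  also have "\<dots> = (\<Sum>i\<le>Suc ?n. nested scale (bracket (\<Omega> (Suc ?n - i)) (\<Omega> i)) xs)"
    by (intro nested_sum ml multilinear_gbracket cochains_UNIV_D(1)[OF mc])
  also have "\<dots> = split_sum snd xs (\<lambda>A B. \<Sum>i\<le>Suc ?n. T i (Suc ?n - i) A B)"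
    unfolding split_sum_sum nested_derivation[OF mc mc cl] T_def ..
  also have "\<dots> = split_sum snd xs (\<lambda>A B. T (length A) (Suc (length B)) A B
      + T (Suc (length A)) (length B) A B)"
  proof (rule split_sum_cong)
    fix A B assume len: "length A + length B = ?n" and "set A \<subseteq> set xs" "set B \<subseteq> set xs"
    then have A: "\<forall>x\<in>set A. lifted x" and B: "\<forall>x\<in>set B. lifted x" using xs by auto
    have mlA: "multilinear scale (nested scale (\<Omega> i) A)" and mlB: "multilinear scale (nested scale (\<Omega> i) B)" for i
      using A B liftedD(3) by (auto intro!: nested_multilinear cochains_UNIV_D(1)[OF mc])
    \<comment> \<open>One of the two nested brackets has degree at least \<open>2\<close>.\<close>
    have "T i (Suc ?n - i) A B = 0" if "i \<le> Suc ?n" "i \<noteq> length A" "i \<noteq> Suc (length A)" for i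
    proof (cases "i < length A")
      case True
      then show ?thesis using nested_structure_zero[OF A] gbracket_zero(2)[OF mlB] by (simp add: T_def)
    next
      case False
      then have "Suc ?n - i < length B" using that len by simp
      then show ?thesis using nested_structure_zero[OF B] gbracket_zero(1)[OF mlA] by (simp add: T_def)
    qed
    then have "(\<Sum>i\<le>Suc ?n. T i (Suc ?n - i) A B) =
        (\<Sum>i\<in>{length A, Suc (length A)}. T i (Suc ?n - i) A B)"
      using len by (intro sum.mono_neutral_right) auto
    also have "\<dots> = T (length A) (Suc (length B)) A B + T (Suc (length A)) (length B) A B"
    proof -
      have "Suc ?n - length A = Suc (length B)" "Suc ?n - Suc (length A) = length B"
        using len by simp_all
      then show ?thesis by simp
    qed
    finally show "(\<Sum>i\<le>Suc ?n. T i (Suc ?n - i) A B) =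
      T (length A) (Suc (length B)) A B + T (Suc (length A)) (length B) A B" .
  qed
  also have "\<dots> = J + split_sum snd xs (\<lambda>A B. T (Suc (length A)) (length B) A B)"
    unfolding J_def by (rule split_sum_add)
  also have "split_sum snd xs (\<lambda>A B. T (Suc (length A)) (length B) A B) = J"
    unfolding split_sum_swap[of snd xs "\<lambda>A B. T (Suc (length A)) (length B) A B"] J_def
  proof (rule split_sum_cong)
    fix A B assume "set A \<subseteq> set xs" "set B \<subseteq> set xs"
    then have "\<forall>(a, m)\<in>set A. a \<in> \<C> scale m"
      "\<forall>(a, m)\<in>set B. a \<in> \<C> scale m" using cl by auto
    note c = nested_closed[OF mc this(1)] nested_closed[OF mc this(2)]
    show "sg (total_degree A * total_degree B) (T (Suc (length B)) (length A) B A) =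
        T (length A) (Suc (length B)) A B"
      unfolding T_def gbracket_antisymmetric[OF c(1,2)]
      by (simp only: sg_simps) (auto simp: sg_def)
  qed
  finally have "J + J = 0" by (rule sym)
  have "J = 0"
  proof (intro ext)
    fix Xs x
    have "J Xs x + J Xs x = 0" using fun_cong[OF fun_cong[OF \<open>J + J = 0\<close>, of Xs], of x] by simp
    from double_zero[OF this] show "J Xs x = 0 Xs x" by simp
  qed
  then show ?thesis using J by simp
qed

end

section \<open>The L-infinity algebra\<close>

text \<open>
  The absolute value does not change parity; it allows for negative degrees, in which the
  grading of cochains is zero.
\<close>

lemma koszul_sign_exponent:
  "koszul_sign n d \<sigma> = (-1) ^ koszul_exponent n (\<lambda>i. nat \<bar>d i\<bar>) \<sigma>"
proof -
  have "(if odd (d (\<sigma> i) * d (\<sigma> j)) then -1 else 1) =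
      (-1 :: int) ^ (nat \<bar>d (\<sigma> i)\<bar> * nat \<bar>d (\<sigma> j)\<bar>)" for i j
    by (simp add: even_nat_iff)
  then show ?thesis
    unfolding koszul_sign_def koszul_exponent_def
    by (simp add: power_sum split_beta)
qed

context twilled_three_Lie_algebra
begin

abbreviation (input) "l \<equiv> twilled_l scale br g1 g2"
abbreviation (input) "C m \<equiv> cochains scale g2 g1 m"
abbreviation (input) "cs \<equiv> cochain_scale scale"

lemma twilled_l_long: "length xs \<ge> 4 \<Longrightarrow> l xs = 0"
  by (cases xs rule: twilled_l.cases[of "(scale, br, g1, g2, xs)" for xs, simplified]; force)

lemma lift_zero: "lift g1 g2 0 = 0"
  by (simp add: lift_def fun_eq_iff)

lemma unlift_zero: "unlift g2 0 = 0"
  by (simp add: unlift_def fun_eq_iff)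

lemma lift_add: "lift g1 g2 (P + Q) = lift g1 g2 P + lift g1 g2 Q"
  by (simp add: lift_def fun_eq_iff)

lemma lift_scale: "lift g1 g2 (cs c P) = cs c (lift g1 g2 P)"
  by (simp add: lift_def cochain_scale_def fun_eq_iff)

lemma unlift_add: "unlift g2 (P + Q) = unlift g2 P + unlift g2 Q"
  by (simp add: unlift_def fun_eq_iff)

lemma unlift_scale: "unlift g2 (cs c P) = cs c (unlift g2 P)"
  by (simp add: unlift_def cochain_scale_def fun_eq_iff)

lemma unlift_sg: "unlift g2 (sg n P) = sg n (unlift g2 P)"
  by (simp add: unlift_def fun_eq_iff sg_def)

lemma cs_sign: "cs ((-1) ^ n) P = sg n P"
  by (simp add: cochain_scale_def fun_eq_iff scale_power_minus_one sg_apply)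

definition lifts :: "('v cochain \<times> nat) list \<Rightarrow> ('v cochain \<times> nat) list" where
  "lifts xs = map (\<lambda>(a, m). (lift g1 g2 a, m)) xs"

definition graded :: "('v cochain \<times> nat) list \<Rightarrow> bool" where
  "graded xs \<longleftrightarrow> (\<forall>(a, m)\<in>set xs. a \<in> cochains scale g2 g1 m)"

lemma graded_lifted: "graded xs \<Longrightarrow> \<forall>x\<in>set (lifts xs). lifted x"
  using lift_closed by (auto simp: graded_def lifts_def lifted_def)

lemma lifts_simps: "length (lifts xs) = length xs" "map snd (lifts xs) = map snd xs"
  by (simp_all add: lifts_def split_beta comp_def)

text \<open>
  From four arguments on, both sides are zero, since \<open>\<Omega> k\<close> is.
\<close>

lemma twilled_l_nested:
  assumes "\<forall>x\<in>set (lifts xs). multilinear scale (fst x)"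
  shows "l (map fst xs) = unlift g2 (nested scale (\<Omega> (length xs)) (lifts xs))"
proof -
  consider "xs = []" | a where "xs = [a]" | a b where "xs = [a, b]"
    | a b c where "xs = [a, b, c]" | "length xs \<ge> 4"
  proof -
    have "length xs = 0 \<or> length xs = 1 \<or> length xs = 2 \<or> length xs = 3 \<or> length xs \<ge> 4" by linarith
    then show ?thesis using that by (auto simp: length_Suc_conv eval_nat_numeral)
  qed
  then show ?thesis
  proof cases
    case 5
    then have "\<Omega> (length xs) = 0" by (simp add: structure_map_def)
    then show ?thesis using nested_zero[OF assms] 5 by (simp add: twilled_l_long unlift_zero)
  qed (simp_all add: structure_map_def lifts_def split_beta unlift_zero)
qed

lemma graded_multilinear: "graded xs \<Longrightarrow> \<forall>x\<in>set (lifts xs). multilinear scale (fst x)"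
  using graded_lifted liftedD(3) by blast

lemma twilled_l_graded:
  assumes "graded xs"
  shows "l (map fst xs) \<in> C (Suc (total_degree xs))"
    and "lift g1 g2 (l (map fst xs)) =
      nested scale (\<Omega> (length xs)) (lifts xs)"
  using unlift_closed[OF liftedD(1,2)[OF nested_structure_lifted[OF graded_lifted[OF assms]]]]
  unfolding twilled_l_nested[OF graded_multilinear[OF assms]] by (simp_all add: lifts_simps)

lemma twilled_l_swap:
  assumes "graded (xs @ x # y # zs)"
  shows "l (map fst (xs @ x # y # zs)) = sg (snd x * snd y) (l (map fst (xs @ y # x # zs)))"
proof -
  have g': "graded (xs @ y # x # zs)" using assms by (auto simp: graded_def)
  let ?L = "\<lambda>(a, m). (lift g1 g2 a, m :: nat)"
  have L: "lifted (?L x)" "lifted (?L y)" and zs: "\<forall>z\<in>set (lifts zs). multilinear scale (fst z)"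
    using graded_lifted[OF assms] liftedD(3) by (auto simp: lifts_def)
  have xs: "\<forall>(a, m)\<in>set (lifts xs). a \<in> \<C> scale m"
    using graded_lifted[OF assms] liftedD(1) by (fastforce simp: lifts_def)
  define F where "F = nested scale (\<Omega> (length (xs @ x # y # zs))) (lifts xs)"
  have F: "F \<in> \<C> scale (1 + total_degree (lifts xs))"
    unfolding F_def by (rule nested_closed[OF structure_map_closed xs])
  have nested_append: "nested scale G (as @ bs) = nested scale (nested scale G as) bs" for G as bs
    by (simp add: nested_def)
  have "nested scale (\<Omega> (length (xs @ x # y # zs))) (lifts (xs @ x # y # zs))
      = nested scale (bracket (bracket F (fst (?L x))) (fst (?L y))) (lifts zs)"
    by (simp add: lifts_def nested_append F_def)
  also have "\<dots> = nested scale (sg (snd x * snd y)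
      (bracket (bracket F (fst (?L y))) (fst (?L x)))) (lifts zs)"
    using lifted_swap[OF F L] by (simp add: split_beta)
  also have "\<dots> = sg (snd x * snd y)
      (nested scale (bracket (bracket F (fst (?L y))) (fst (?L x))) (lifts zs))"
    by (intro nested_sg zs multilinear_gbracket liftedD(3)[OF L(1)] liftedD(3)[OF L(2)]
        cochains_UNIV_D(1)[OF F])
  also have "nested scale (bracket (bracket F (fst (?L y))) (fst (?L x))) (lifts zs)
      = nested scale (\<Omega> (length (xs @ y # x # zs))) (lifts (xs @ y # x # zs))"
    by (simp add: lifts_def nested_append F_def)
  finally show ?thesis
    unfolding twilled_l_nested[OF graded_multilinear[OF assms]] twilled_l_nested[OF graded_multilinear[OF g']] unlift_sg[symmetric] by simp
qed

text \<open>
  The inner \<open>l\<close> is a lift again by \<open>twilled_l_graded\<close>, so that the lift of a composite is a nested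
  bracket and \<open>generalized_jacobi\<close> applies.  The splittings with empty \<open>A\<close>, which are absent on the
  left, contribute nothing as \<open>\<Omega> 0 = 0\<close>.
\<close>

lemma twilled_l_jacobi:
  assumes xs: "graded xs"
  shows "(\<Sum>i=1..length xs. split_sum snd xs (\<lambda>A B. if length A = i
    then l (l (map fst A) # map fst B) else 0)) = 0"
proof -
  have sub: "graded A" if "set A \<subseteq> set xs" for A using that xs by (auto simp: graded_def)
  have "(\<Sum>i=1..length xs. split_sum snd xs (\<lambda>A B. if length A = i
        then l (l (map fst A) # map fst B) else 0)) =
      split_sum snd xs (\<lambda>A B. \<Sum>i=1..length xs. if length A = i
        then l (l (map fst A) # map fst B) else 0)"
    by (rule split_sum_sum[symmetric])
  also have "\<dots> = split_sum snd xs (\<lambda>A B. unlift g2 (composite (lifts A) (lifts B)))"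
  proof (rule split_sum_cong)
    fix A B assume len: "length A + length B = length xs" and "set A \<subseteq> set xs" "set B \<subseteq> set xs"
    then have A: "graded A" and B: "graded B" using sub by auto
    have AB: "graded ((l (map fst A), Suc (total_degree A)) # B)"
      using twilled_l_graded(1)[OF A] B by (simp add: graded_def)
    have "l (l (map fst A) # map fst B) = unlift g2 (composite (lifts A) (lifts B))"
      using twilled_l_nested[OF graded_multilinear[OF AB]] twilled_l_graded(2)[OF A]
      by (simp add: lifts_def composite_def)
    moreover have "composite (lifts A) (lifts B) = 0" if "A = []"
    proof -
      have "\<Omega> 0 = 0" by (simp add: structure_map_def)
      moreover have "\<forall>x\<in>set (lifts B). multilinear scale (fst x)"
        using graded_lifted[OF B] liftedD(3) by blast
      ultimately show ?thesis
        using that by (simp add: composite_def lifts_def nested_zero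
            gbracket_zero(2)[OF cochains_UNIV_D(1)[OF structure_map_closed]])
    qed
    ultimately show "(\<Sum>i=1..length xs. if length A = i then l (l (map fst A) # map fst B) else 0) =
      unlift g2 (composite (lifts A) (lifts B))"
      using len by (cases "A = []") (auto simp: unlift_zero Suc_le_eq)
  qed
  also have "\<dots> = unlift g2 (split_sum snd (lifts xs) composite)"
  proof -
    have "split_sum snd ys (\<lambda>A B. unlift g2 (\<Phi> (lifts A) (lifts B))) =
        unlift g2 (split_sum snd (lifts ys) \<Phi>)" for ys and \<Phi> :: "_ \<Rightarrow> _ \<Rightarrow> 'v cochain"
    proof (induction ys arbitrary: \<Phi>)
      case (Cons y ys)
      have lc: "lifts (y # A) = (lift g1 g2 (fst y), snd y) # lifts A" for A
        by (simp add: lifts_def split_beta)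
      show ?case
        unfolding split_sum.simps lc unlift_add Cons.IH[symmetric] lifts_simps unlift_sg by simp
    qed (simp add: lifts_def)
    from this[of xs composite] show ?thesis .
  qed
  finally show ?thesis
    unfolding generalized_jacobi[OF graded_lifted[OF xs]] unlift_zero .
qed

abbreviation (input) "G \<equiv> cochain_grading scale g2 g1"

lemma cochain_vector_space: "vector_space cs"
  by unfold_locales (simp_all add: cochain_scale_def fun_eq_iff scale_right_distrib scale_left_distrib)

lemma homogeneous_scale:
  "homog e P \<Longrightarrow> homog e (cs c P)"
  by (simp add: homogeneous_def cochain_scale_def subspace_scale[OF subspace_piece])

lemma cochains_UNIV_scale:
  assumes "P \<in> \<C> scale n"
  shows "cs c P \<in> \<C> scale n"
proof -
  note P = cochains_UNIV_D[OF assms]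
  have "alternating (cs c P)"
    using alternating_image[OF P(3), of "\<lambda>n. scale c"] by (simp add: cochain_scale_def)
  moreover have "supported n (cs c P)" using P(2) by (simp add: supported_def cochain_scale_def)
  ultimately show ?thesis using P(1) by (simp add: cochains_UNIV_iff multilinear_cochain_scale)
qed

lemma cochains_zero: "0 \<in> C m"
  using unlift_closed(1)[OF cochains_UNIV_zero homogeneous_zero] by (simp add: unlift_zero)

lemma cochains_add:
  assumes "a \<in> C m" "b \<in> C m"
  shows "a + b \<in> C m"
proof -
  have "unlift g2 (lift g1 g2 a + lift g1 g2 b) \<in> C m"
    by (intro unlift_closed cochains_UNIV_add homogeneous_add lift_closed[OF assms(1)]
        lift_closed[OF assms(2)])
  then show ?thesis by (simp add: unlift_add unlift_lift[OF assms(1)] unlift_lift[OF assms(2)])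
qed

lemma cochains_scale:
  assumes "a \<in> C m"
  shows "cs c a \<in> C m"
proof -
  have "unlift g2 (cs c (lift g1 g2 a)) \<in> C m"
    by (intro unlift_closed cochains_UNIV_scale homogeneous_scale lift_closed[OF assms])
  then show ?thesis by (simp add: unlift_scale unlift_lift[OF assms])
qed

text \<open>
  In negative degrees there is only zero, which is a cochain of every degree; the exponent
  \<open>nat \<bar>d\<bar>\<close> keeps the parity of \<open>d\<close>.
\<close>

lemma grading_nat: "a \<in> G d \<Longrightarrow> a \<in> C (nat \<bar>d\<bar>)"
  by (auto simp: cochain_grading_def cochains_zero split: if_splits)

lemma grading_wrong_length:
  assumes "a \<in> G d" "int (length Xs) \<noteq> d"
  shows "a Xs x = 0"
proof (cases "d \<ge> 0")
  case True
  then have "a \<in> C (nat d)" using assms by (simp add: cochain_grading_def)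
  moreover have "(Xs, x) \<notin> cochain_domain g2 (nat d)"
    using assms(2) True by (auto simp: cochain_domain_def)
  ultimately show ?thesis unfolding cochains_def by blast
next
  case False
  then show ?thesis using assms by (simp add: cochain_grading_def)
qed

lemma cochain_graded_vector_space: "graded_vector_space cs G"
proof -
  interpret V: vector_space cs by (rule cochain_vector_space)
  show ?thesis
  proof unfold_locales
    fix d
    show "V.subspace (G d)"
      by (auto simp: V.subspace_def cochain_grading_def cochains_zero cochains_add cochains_scale)
  next
    fix D :: "int set" and y d
    assume fin: "finite D" and y: "\<And>d. d \<in> D \<Longrightarrow> y d \<in> G d"
      and zero: "(\<Sum>d\<in>D. y d) = 0" and d: "d \<in> D"
    show "y d = 0"
    proof (intro ext)
      fix Xs x
      have "(\<Sum>e\<in>D. y e) Xs x = (\<Sum>e\<in>D. y e Xs x)"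
        using fin by (induction D rule: finite_induct) simp_all
      then have 0: "(\<Sum>e\<in>D. y e Xs x) = 0" using zero by simp
      show "y d Xs x = 0 Xs x"
      proof (cases "int (length Xs) = d")
        case True
        have "(\<Sum>e\<in>D. y e Xs x) = y d Xs x"
          using fin d True grading_wrong_length[OF y] by (subst sum.remove[of _ d]) auto
        then show ?thesis using 0 by simp
      next
        case False
        then show ?thesis using grading_wrong_length[OF y[OF d]] by simp
      qed
    qed
  qed
qed

lemma total_multilinear:
  assumes "a \<in> graded_vector_space.total cs G"
  shows "multilinear scale (lift g1 g2 a)"
proof -
  interpret GV: graded_vector_space cs G by (rule cochain_graded_vector_space)
  have "a \<in> GV.span (\<Union>d. G d)" using assms by (simp add: GV.total_def)
  then show ?thesis
  proof (induction rule: GV.span_induct)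
    case base
    show ?case
      by (auto simp: GV.subspace_def lift_zero lift_add lift_scale multilinear_intros)
  next
    case (step a)
    then obtain d where "a \<in> G d" by blast
    then have "a \<in> C (nat \<bar>d\<bar>)" by (rule grading_nat)
    then show ?case using lift_closed(1) cochains_UNIV_D(1) by blast
  qed
qed

lemma nested_scale:
  assumes "multilinear scale F" "\<forall>x\<in>set xs. multilinear scale (fst x)"
  shows "nested scale (cs c F) xs = cs c (nested scale F xs)"
  using assms
  by (induction xs arbitrary: F) (simp_all add: gbracket_scale multilinear_gbracket)

lemma nested_append: "nested scale F (as @ bs) = nested scale (nested scale F as) bs"
  by (simp add: nested_def)

lemma twilled_l_multilinear:
  assumes xs: "set xs \<subseteq> graded_vector_space.total cs G" and i: "i < length xs"
  shows "linear_on cs (graded_vector_space.total cs G) (\<lambda>y. l (xs[i := y]))"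
proof -
  interpret GV: graded_vector_space cs G by (rule cochain_graded_vector_space)
  let ?P = "map (\<lambda>a. (a, 0::nat))"
  define as bs where "as = lifts (?P (take i xs))" and "bs = lifts (?P (drop (Suc i) xs))"
  define F where "F = nested scale (\<Omega> (length xs)) as"
  have as: "\<forall>x\<in>set as. multilinear scale (fst x)" and bs: "\<forall>x\<in>set bs. multilinear scale (fst x)"
    using xs by (auto simp: as_def bs_def lifts_def dest!: in_set_takeD in_set_dropD intro!: total_multilinear)
  have F: "multilinear scale F"
    unfolding F_def by (rule nested_multilinear[OF cochains_UNIV_D(1)[OF structure_map_closed] as])
  have eq: "l (xs[i := y]) = unlift g2 (nested scale (bracket F (lift g1 g2 y)) bs)"
    if y: "y \<in> GV.total" for y
  proof -
    have upd: "xs[i := y] = map fst (?P (take i xs) @ (y, 0) # ?P (drop (Suc i) xs))"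
      using i by (simp add: upd_conv_take_nth_drop comp_def)
    have lf: "lifts (?P (take i xs) @ (y, 0) # ?P (drop (Suc i) xs)) = as @ (lift g1 g2 y, 0) # bs"
      by (simp add: lifts_def as_def bs_def)
    have len: "length (?P (take i xs) @ (y, 0) # ?P (drop (Suc i) xs)) = length xs"
      using i by simp
    have "\<forall>x\<in>set (lifts (?P (take i xs) @ (y, 0) # ?P (drop (Suc i) xs))). multilinear scale (fst x)"
      unfolding lf using as bs total_multilinear[OF y] by auto
    from twilled_l_nested[OF this] show ?thesis
      unfolding upd lf len by (simp add: nested_append F_def)
  qed
  have add: "y + z \<in> GV.total" and scl: "cs c y \<in> GV.total"
    if "y \<in> GV.total" "z \<in> GV.total" for y z c
    using that by (auto simp: GV.total_def GV.span_add GV.span_scale)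
  show ?thesis
    unfolding linear_on_def
  proof (intro conjI allI ballI)
    fix y z assume y: "y \<in> GV.total" and z: "z \<in> GV.total"
    note my = total_multilinear[OF y] and mz = total_multilinear[OF z]
    show "l (xs[i := y + z]) = l (xs[i := y]) + l (xs[i := z])"
      unfolding eq[OF y] eq[OF z] eq[OF add[OF y z]] lift_add gbracket_add(2)[OF F F my mz]
      by (subst nested_add)
         (use F my mz bs in \<open>auto simp: multilinear_gbracket unlift_add\<close>)
  next
    fix c y assume y: "y \<in> GV.total"
    note my = total_multilinear[OF y]
    show "l (xs[i := cs c y]) = cs c (l (xs[i := y]))"
      unfolding eq[OF y] eq[OF scl[OF y y]] lift_scale gbracket_scale(2)[OF F my]
      by (subst nested_scale) (use F my bs in \<open>auto simp: multilinear_gbracket unlift_scale\<close>)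
  qed
qed

lemma twilled_l_zero_entry:
  assumes xs: "set xs \<subseteq> graded_vector_space.total cs G" and i: "i < length xs"
  shows "l (xs[i := 0]) = 0"
proof -
  interpret GV: graded_vector_space cs G by (rule cochain_graded_vector_space)
  have "0 \<in> GV.total" by (simp add: GV.total_def GV.span_zero)
  then have "l (xs[i := cs 0 0]) = cs 0 (l (xs[i := 0]))"
    using twilled_l_multilinear[OF assms] unfolding linear_on_def by blast
  then show ?thesis by (simp only: GV.scale_zero_left)
qed

lemma twilled_l_degree:
  assumes "list_all2 (\<lambda>x d. x \<in> G d) xs ds"
  shows "l xs \<in> G (sum_list ds + 1)"
proof -
  interpret GV: graded_vector_space cs G by (rule cochain_graded_vector_space)
  show ?thesis
  proof (cases "\<forall>d\<in>set ds. d \<ge> 0")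
    case True
    define zs where "zs = zip xs (map nat ds)"
    have len: "length xs = length ds" using assms by (rule list_all2_lengthD)
    have "graded zs"
      using assms True unfolding graded_def zs_def list_all2_conv_all_nth
      by (auto simp: set_zip cochain_grading_def)
    from twilled_l_graded(1)[OF this] have "l xs \<in> C (Suc (total_degree zs))"
      by (simp add: zs_def len)
    moreover have "int (total_degree zs) = sum_list ds"
    proof -
      have "int (sum_list (map nat ds)) = sum_list ds"
        using True by (induction ds) auto
      then show ?thesis by (simp add: zs_def len)
    qed
    then have "sum_list ds + 1 = int (Suc (total_degree zs))" by simp
    ultimately show ?thesis by (simp only: cochain_grading_def nat_int) simp
  next
    case False
    then obtain i where i: "i < length ds" "ds ! i < 0" by (auto simp: in_set_conv_nth)
    have len: "length xs = length ds" and el: "\<And>i. i < length ds \<Longrightarrow> xs ! i \<in> G (ds ! i)"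
      using assms by (auto simp: list_all2_conv_all_nth)
    have tot: "set xs \<subseteq> GV.total"
    proof
      fix a assume "a \<in> set xs"
      then obtain j where "j < length ds" "a = xs ! j" using len by (auto simp: in_set_conv_nth)
      then have "a \<in> (\<Union>d. G d)" using el by blast
      then show "a \<in> GV.total" unfolding GV.total_def by (rule GV.span_base)
    qed
    have "xs ! i = 0" using el[OF i(1)] i(2) by (simp add: cochain_grading_def)
    then have "l xs = 0"
      using twilled_l_zero_entry[OF tot, of i] i len by (metis list_update_id)
    then show ?thesis using GV.subspace_0[OF GV.subspace_G] by simp
  qed
qed

text \<open>
  By multilinearity it suffices to consider homogeneous arguments; they are made homogeneous one
  after the other, \<open>k\<close> being the number of arguments not yet treated.
\<close>

lemma twilled_l_closed:
  assumes "xs \<noteq> []" "set xs \<subseteq> graded_vector_space.total cs G"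
  shows "l xs \<in> graded_vector_space.total cs G"
proof -
  interpret GV: graded_vector_space cs G by (rule cochain_graded_vector_space)
  have base: "a \<in> GV.total" if "a \<in> G d" for a d
    using that by (auto simp: GV.total_def intro: GV.span_base)
  have "l xs \<in> GV.total"
    if "xs \<noteq> []" "set (take k xs) \<subseteq> GV.total" "set (drop k xs) \<subseteq> (\<Union>d. G d)" for k xs
    using that
  proof (induction k arbitrary: xs)
    case 0
    then have "\<forall>i<length xs. \<exists>d. xs ! i \<in> G d" by (auto simp: set_conv_nth)
    then obtain d where d: "\<And>i. i < length xs \<Longrightarrow> xs ! i \<in> G (d i)" by metis
    have "list_all2 (\<lambda>x d. x \<in> G d) xs (map d [0..<length xs])"
      using d by (simp add: list_all2_conv_all_nth)
    then show ?case using twilled_l_degree base by blast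
  next
    case (Suc k)
    show ?case
    proof (cases "k < length xs")
      case False
      then show ?thesis using Suc by simp
    next
      case True
      have tot: "set xs \<subseteq> GV.total"
      proof -
        have "set xs = set (take (Suc k) xs) \<union> set (drop (Suc k) xs)"
          by (metis append_take_drop_id set_append)
        then show ?thesis using Suc.prems(2,3) base by blast
      qed
      note lin = twilled_l_multilinear[OF tot True]
      have "xs ! k \<in> GV.span (\<Union>d. G d)" using tot True by (auto simp: GV.total_def)
      then have "xs ! k \<in> GV.total \<and> l (xs[k := xs ! k]) \<in> GV.total"
      proof (induction rule: GV.span_induct)
        case base
        note twilled_l_zero_entry[OF tot True]
        then show ?case
          using lin unfolding GV.subspace_def linear_on_def
          by (auto simp: GV.total_def GV.span_zero GV.span_add GV.span_scale)
      next
        case (step a)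
        have "l (xs[k := a]) \<in> GV.total"
        proof (rule Suc.IH)
          show "xs[k := a] \<noteq> []" using True by auto
          show "set (take k (xs[k := a])) \<subseteq> GV.total"
            using tot by (auto dest: in_set_takeD)
          have "drop k (xs[k := a]) = a # drop (Suc k) xs"
            using True by (simp add: upd_conv_take_nth_drop)
          then show "set (drop k (xs[k := a])) \<subseteq> (\<Union>d. G d)" using step Suc.prems(3) by auto
        qed
        then show ?case using step base by blast
      qed
      then show ?thesis by simp
    qed
  qed
  from this[of xs "length xs"] show ?thesis using assms by simp
qed

lemma koszul_exponent_triangle:
  "koszul_exponent n d \<sigma> =
    (\<Sum>j\<in>{1..n}. \<Sum>i\<in>{1..<j}. if \<sigma> j < \<sigma> i then d (\<sigma> i) * d (\<sigma> j) else 0)"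
proof -
  let ?f = "\<lambda>(j, i). if \<sigma> j < \<sigma> i then d (\<sigma> i) * d (\<sigma> j) else 0"
  have "(\<Sum>j\<in>{1..n}. \<Sum>i\<in>{1..<j}. if \<sigma> j < \<sigma> i then d (\<sigma> i) * d (\<sigma> j) else 0) =
      sum ?f (SIGMA j:{1..n}. {1..<j})"
    by (rule sum.Sigma) auto
  also have "\<dots> = sum (\<lambda>(j, i). d (\<sigma> i) * d (\<sigma> j)) {(j, i). 1 \<le> i \<and> i < j \<and> j \<le> n \<and> \<sigma> j < \<sigma> i}"
    by (rule sum.mono_neutral_cong_right) (auto split: if_splits)
  also have "\<dots> = koszul_exponent n d \<sigma>"
    unfolding koszul_exponent_def
    by (rule sum.reindex_bij_witness[of _ "\<lambda>(i, j). (j, i)" "\<lambda>(i, j). (j, i)"]) auto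
  finally show ?thesis by simp
qed

text \<open>
  From four arguments on, there is nothing to prove; the permutations of at most three arguments
  are products of the adjacent transpositions in \<open>twilled_l_swap\<close>.
\<close>

lemma twilled_l_symmetric:
  assumes n: "n \<ge> 1" and x: "\<And>i. i \<in> {1..n} \<Longrightarrow> x i \<in> C (e i)" and \<sigma>: "\<sigma> permutes {1..n}"
  shows "l (map (x \<circ> \<sigma>) [1..<n + 1]) = sg (koszul_exponent n e \<sigma>) (l (map x [1..<n + 1]))"
proof (cases "n \<ge> 4")
  case True
  then show ?thesis by (simp add: twilled_l_long del: upt_Suc)
next
  case False
  define z where "z i = (x i, e i)" for i
  have range: "\<sigma> i \<in> {1..n}" if "i \<in> {1..n}" for i using permutes_in_image[OF \<sigma>] that by blast
  have inj: "\<sigma> i = \<sigma> j \<longleftrightarrow> i = j" for i j using permutes_inj[OF \<sigma>] by (auto dest: injD)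
  have gr: "graded (map z is)" if "set is \<subseteq> {1..n}" for "is"
    using that x by (auto simp: graded_def z_def)
  have swap12: "l [x i, x j] = sg (e i * e j) (l [x j, x i])" if "i \<in> {1..n}" "j \<in> {1..n}" for i j
    using twilled_l_swap[of "[]" "z i" "z j" "[]"] gr[of "[i, j]"] that by (simp add: z_def)
  have swap3: "l [x i, x j, x k] = sg (e i * e j) (l [x j, x i, x k])"
    "l [x i, x j, x k] = sg (e j * e k) (l [x i, x k, x j])"
    if "i \<in> {1..n}" "j \<in> {1..n}" "k \<in> {1..n}" for i j k
    using twilled_l_swap[of "[]" "z i" "z j" "[z k]"] twilled_l_swap[of "[z i]" "z j" "z k" "[]"]
      gr[of "[i, j, k]"] that
    by (simp_all add: z_def del: twilled_l.simps)
  consider "n = 1" | "n = 2" | "n = 3" using n False by linarith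
  then show ?thesis
  proof cases
    case 1
    then have "\<sigma> 1 = 1" using range[of 1] by simp
    then show ?thesis using 1 by (simp add: koszul_exponent_triangle)
  next
    case 2
    have "\<sigma> 1 = 1 \<and> \<sigma> 2 = 2 \<or> \<sigma> 1 = 2 \<and> \<sigma> 2 = 1"
      using range[of 1] range[of 2] inj[of 1 2] 2 by auto
    then show ?thesis
      using swap12[of 2 1] 2
      by (auto simp: koszul_exponent_triangle eval_nat_numeral simp del: twilled_l.simps)
  next
    case 3
    have "\<sigma> 1 \<in> {1, 2, 3}" "\<sigma> 2 \<in> {1, 2, 3}" "\<sigma> 3 \<in> {1, 2, 3}"
      "\<sigma> 1 \<noteq> \<sigma> 2" "\<sigma> 1 \<noteq> \<sigma> 3" "\<sigma> 2 \<noteq> \<sigma> 3"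
      using range[of 1] range[of 2] range[of 3] inj 3 by auto
    then consider "\<sigma> 1 = 1" "\<sigma> 2 = 2" "\<sigma> 3 = 3" | "\<sigma> 1 = 1" "\<sigma> 2 = 3" "\<sigma> 3 = 2"
      | "\<sigma> 1 = 2" "\<sigma> 2 = 1" "\<sigma> 3 = 3" | "\<sigma> 1 = 2" "\<sigma> 2 = 3" "\<sigma> 3 = 1"
      | "\<sigma> 1 = 3" "\<sigma> 2 = 1" "\<sigma> 3 = 2" | "\<sigma> 1 = 3" "\<sigma> 2 = 2" "\<sigma> 3 = 1" by auto
    moreover have list: "[1..<n + 1] = [1, 2, 3]" using 3 by (simp add: upt_rec)
    moreover have expo: "koszul_exponent n e \<sigma> =
        (if \<sigma> 2 < \<sigma> 1 then e (\<sigma> 1) * e (\<sigma> 2) else 0)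
        + ((if \<sigma> 3 < \<sigma> 1 then e (\<sigma> 1) * e (\<sigma> 3) else 0)
        + (if \<sigma> 3 < \<sigma> 2 then e (\<sigma> 2) * e (\<sigma> 3) else 0))"
    proof -
      have "{1..n} = {1, 2, 3}" "{1..<1::nat} = {}" "{1..<2::nat} = {1}" "{1..<3::nat} = {1, 2}"
        using 3 by auto
      then show ?thesis unfolding koszul_exponent_triangle by simp
    qed
    have r: "1 \<in> {1..n}" "2 \<in> {1..n}" "3 \<in> {1..n}" using 3 by auto
    note sort = swap3(1)[OF r(2,1,3)] swap3(2)[OF r(1,3,2)] swap3(2)[OF r(2,3,1)]
      swap3(1)[OF r(3,1,2)] swap3(1)[OF r(3,2,1)]
    ultimately show ?thesis
      by cases (simp_all add: list expo sort add_ac del: twilled_l.simps upt_Suc)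
  qed
qed

lemma twilled_l_unshuffle_jacobi:
  assumes x: "\<And>i. i \<in> {1..n} \<Longrightarrow> x i \<in> C (e i)"
  shows "(\<Sum>i=1..n. \<Sum>\<sigma>\<in>unshuffles i (n - i). sg (koszul_exponent n e \<sigma>)
      (l (l (map (x \<circ> \<sigma>) [1..<i + 1]) # map (x \<circ> \<sigma>) [i + 1..<n + 1]))) = 0"
proof -
  define zs where "zs = map (\<lambda>i. (x i, e i)) [1..<n + 1]"
  have len: "length zs = n" by (simp add: zs_def del: upt_Suc)
  have nth: "zs ! (k - 1) = (x k, e k)" if "k \<in> {1..n}" for k
  proof -
    have "k - 1 < length [1..<n + 1]" "[1..<n + 1] ! (k - 1) = k"
      using that by (auto simp del: upt_Suc)
    then show ?thesis unfolding zs_def by (simp only: nth_map)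
  qed
  have "graded zs" using x by (auto simp: graded_def zs_def simp del: upt_Suc)
  have summand: "(\<Sum>\<sigma>\<in>unshuffles i (n - i). sg (koszul_exponent n e \<sigma>)
      (l (l (map (x \<circ> \<sigma>) [1..<i + 1]) # map (x \<circ> \<sigma>) [i + 1..<n + 1]))) =
    split_sum snd zs (\<lambda>A B. if length A = i then l (l (map fst A) # map fst B) else 0)"
    if i: "i \<in> {1..n}" for i
  proof -
    have n: "length zs = i + (n - i)" "i + (n - i) = n" using len i by auto
    show ?thesis
      unfolding sum_unshuffles_eq_split_sum[OF n(1), symmetric] n(2)
    proof (rule sum.cong[OF refl])
      fix \<sigma> assume "\<sigma> \<in> unshuffles i (n - i)"
      then have \<sigma>: "\<sigma> permutes {1..n}" using unshuffles_permutes n(2) by metis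
      have kos: "koszul_exponent n (\<lambda>m. snd (zs ! (m - 1))) \<sigma> = koszul_exponent n e \<sigma>"
        by (rule koszul_exponent_cong[OF \<sigma>]) (simp only: nth snd_conv)
      have args: "map fst (slice zs \<sigma> a b) = map (x \<circ> \<sigma>) [a..<b]"
        if "1 \<le> a" "b \<le> n + 1" for a b
        unfolding map_map
      proof (rule map_cong[OF refl])
        fix m assume "m \<in> set [a..<b]"
        then have "m \<in> {1..n}" using that by auto
        then have "\<sigma> m \<in> {1..n}" using permutes_in_image[OF \<sigma>] by blast
        then show "(fst \<circ> (\<lambda>m. zs ! (\<sigma> m - 1))) m = (x \<circ> \<sigma>) m" using nth by simp
      qed
      have "map fst (slice zs \<sigma> 1 (i + 1)) = map (x \<circ> \<sigma>) [1..<i + 1]"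
        "map fst (slice zs \<sigma> (i + 1) (n + 1)) = map (x \<circ> \<sigma>) [i + 1..<n + 1]"
        by (rule args; use i in simp)+
      then show "sg (koszul_exponent n e \<sigma>)
          (l (l (map (x \<circ> \<sigma>) [1..<i + 1]) # map (x \<circ> \<sigma>) [i + 1..<n + 1])) =
        sg (koszul_exponent n (\<lambda>m. snd (zs ! (m - 1))) \<sigma>)
          (l (l (map fst (slice zs \<sigma> 1 (i + 1))) #
             map fst (slice zs \<sigma> (i + 1) (n + 1))))"
        unfolding kos by (simp only:)
    qed
  qed
  show ?thesis
    by (rule trans[OF sum.cong[OF refl summand] twilled_l_jacobi[OF \<open>graded zs\<close>, unfolded len]])
qed

lemma twilled_L_infinity: "L_infinity_algebra cs G l"
proof -
  interpret GV: graded_vector_space cs G by (rule cochain_graded_vector_space)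
  have kos: "cs (of_int (koszul_sign n d \<sigma>)) P = sg (koszul_exponent n (\<lambda>i. nat \<bar>d i\<bar>) \<sigma>) P"
    for n d \<sigma> P
    by (simp add: koszul_sign_exponent cs_sign)
  show ?thesis
  proof unfold_locales
    fix xs assume "xs \<noteq> []" "set xs \<subseteq> GV.total"
    then show "l xs \<in> GV.total" by (rule twilled_l_closed)
  next
    fix xs i assume "set xs \<subseteq> GV.total" "i < length xs"
    then show "linear_on cs GV.total (\<lambda>y. l (xs[i := y]))" by (rule twilled_l_multilinear)
  next
    fix xs ds assume "list_all2 (\<lambda>x d. x \<in> G d) xs ds"
    then show "l xs \<in> G (sum_list ds + 1)" by (rule twilled_l_degree)
  next
    fix n :: nat and x d \<sigma>
    assume "n \<ge> 1" and x: "\<And>i. i \<in> {1..n} \<Longrightarrow> x i \<in> G (d i)" and "\<sigma> permutes {1..n}"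
    then show "l (map (x \<circ> \<sigma>) [1..<n + 1]) = cs (of_int (koszul_sign n d \<sigma>)) (l (map x [1..<n + 1]))"
      unfolding kos by (intro twilled_l_symmetric grading_nat)
  next
    fix n :: nat and x d
    assume "n \<ge> 1" and x: "\<And>i. i \<in> {1..n} \<Longrightarrow> x i \<in> G (d i)"
    show "(\<Sum>i=1..n. \<Sum>\<sigma>\<in>unshuffles i (n - i). cs (of_int (koszul_sign n d \<sigma>))
       (l (l (map (x \<circ> \<sigma>) [1..<i + 1]) # map (x \<circ> \<sigma>) [i + 1..<n + 1]))) = 0"
      unfolding kos by (rule twilled_l_unshuffle_jacobi[OF grading_nat[OF x]])
  qed
qed

end

theorem theorem2p17:
  fixes scale :: "'k::{alg_closed_field, field_char_0} \<Rightarrow> 'v::ab_group_add \<Rightarrow> 'v"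
    and Basis :: "'v set"
    and br :: "'v \<Rightarrow> 'v \<Rightarrow> 'v \<Rightarrow> 'v"
    and g1 g2 :: "'v set"
  assumes "twilled_three_Lie_algebra scale Basis br g1 g2"
  shows "(\<forall>m. \<forall>a \<in> cochains scale g2 g1 m.
      twilled_l scale br g1 g2 [a] \<in> cochains scale g2 g1 (m + 1) \<and>
      lift g1 g2 (twilled_l scale br g1 g2 [a]) =
        gbracket scale (mu2_hat br g1 g2) (lift g1 g2 a)) \<and>
    (\<forall>m n. \<forall>a \<in> cochains scale g2 g1 m. \<forall>b \<in> cochains scale g2 g1 n.
      twilled_l scale br g1 g2 [a, b] \<in> cochains scale g2 g1 (m + n + 1) \<and>
      lift g1 g2 (twilled_l scale br g1 g2 [a, b]) =
        gbracket scale (gbracket scale (psi_hat br g1 g2) (lift g1 g2 a)) (lift g1 g2 b)) \<and>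
    (\<forall>m n r. \<forall>a \<in> cochains scale g2 g1 m. \<forall>b \<in> cochains scale g2 g1 n.
      \<forall>c \<in> cochains scale g2 g1 r.
      twilled_l scale br g1 g2 [a, b, c] \<in> cochains scale g2 g1 (m + n + r + 1) \<and>
      lift g1 g2 (twilled_l scale br g1 g2 [a, b, c]) =
        gbracket scale (gbracket scale (gbracket scale (mu1_hat br g1 g2) (lift g1 g2 a))
          (lift g1 g2 b)) (lift g1 g2 c)) \<and>
    L_infinity_algebra (cochain_scale scale) (cochain_grading scale g2 g1)
      (twilled_l scale br g1 g2)"
proof -
  interpret twilled_three_Lie_algebra scale Basis br g1 g2 by (rule assms)
  note unfold = graded_def lifts_def structure_map_def add.assoc
  note one = twilled_l_graded[of "[(a, m)]" for a m]
    and two = twilled_l_graded[of "[(a, m), (b, n)]" for a m b n]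
    and three = twilled_l_graded[of "[(a, m), (b, n), (c, r)]" for a m b n c r]
  show ?thesis
    using one two three twilled_L_infinity by (auto simp: unfold simp del: twilled_l.simps)
qed

end
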